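(* For real $x>0$ let $$f_{12}(x)=\frac{e^{\pi ix}(205x^2-160x+32)\,\Gamma(x)^{10}}{32\,\Gamma(2x)^5}.$$ Then the following series converge and $$\sum_{k=1}^\infty f_{12}'(k)=15\zeta(4)-2\zeta(3)\pi i,\qquad \sum_{k=1}^\infty f_{12}''(k)=\frac{16}3\pi^2\zeta(3)-140\zeta(5)+\frac{\pi^5}3i,$$ $$\sum_{k=1}^\infty f_{12}'''(k)=60\big(4\zeta(6)-\zeta(3)^2\big)+12\pi i\big(\pi^2\zeta(3)-35\zeta(5)\big),$$ $$\sum_{k=1}^\infty f_{12}^{(4)}(k)=240\big(56\zeta(2)\zeta(5)-11\zeta(3)\zeta(4)-69\zeta(7)\big)+\frac{4\pi i}{63}\big(37\pi^6-3780\zeta(3)^2\big),$$ $$\sum_{k=1}^\infty f_{12}^{(5)}(k)=10\big(1536\zeta(5,3)-720\zeta(3)\zeta(5)+160\pi^2\zeta(3)^2-6157\zeta(8)\big)+24\pi i\big(350\pi^2\zeta(5)-3\pi^4\zeta(3)-3450\zeta(7)\big),$$ $$\sum_{k=1}^\infty f_{12}^{(6)}(k)=480\big(8280\zeta(2)\zeta(7)+288\zeta(3)\zeta(6)-5775\zeta(4)\zeta(5)-50\zeta(3)^3-6565\zeta(9)\big)+180\pi i\big(40\pi^2\zeta(3)^2-240\zeta(3)\zeta(5)+512\zeta(5,3)-679\zeta(8)\big).$$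
   Context: $i=\sqrt{-1}$, $e^{\pi i x}=\cos(\pi x)+i\sin(\pi x)$, $\Gamma$ is Euler's gamma function, and $f^{(m)}$ (also $f',f'',f'''$) is the $m$-th derivative of the complex-valued function $f$ of the real variable $x$. $\zeta(s)=\sum_{n\ge1}n^{-s}$ is the Riemann zeta function and $\zeta(5,3)=\sum_{k_1>k_2>0}\frac{1}{k_1^5k_2^3}$. *)

theory Defs
  imports "HOL-Analysis.Analysis"
begin

text \<open>Meaningful only for \<^term>\<open>Re s > 1\<close>, where the series converges; no analytic continuation.\<close>

definition zeta :: "complex \<Rightarrow> complex" where
  "zeta s = (\<Sum>n. of_nat (Suc n) powr (- s))"

text \<open>The argument order is the one in which the larger summation index carries the first exponent.\<close>

definition double_zeta :: "complex \<Rightarrow> complex \<Rightarrow> complex" where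
  "double_zeta a b =
     (\<Sum>\<^sub>\<infinity>(k1, k2)\<in>{(k1, k2). k1 > k2 \<and> k2 > (0::nat)}.
        1 / (of_nat k1 powr a * of_nat k2 powr b))"

text \<open>The derivative of order \<open>m\<close> of a complex-valued function of a real variable. The value at a
  point depends only on the function near that point, so a formula intended for positive arguments
  may be evaluated at positive integers regardless of its values elsewhere.\<close>

definition nth_derivative :: "nat \<Rightarrow> (real \<Rightarrow> complex) \<Rightarrow> real \<Rightarrow> complex" where
  "nth_derivative m f = ((\<lambda>g x. vector_derivative g (at x)) ^^ m) f"

definition f12 :: "real \<Rightarrow> complex" where
  "f12 x = exp (of_real pi * \<i> * of_real x) *
     of_real ((205 * x^2 - 160 * x + 32) * Gamma x ^ 10 / (32 * Gamma (2 * x) ^ 5))"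

end

theory Submission
  imports Defs "HOL-Complex_Analysis.Complex_Analysis" "HOL-Combinatorics.Permutations"
begin

text \<open>
Let \<open>W(u)\<close> be the sum over \<open>n\<close> of the well-poised terms \<open>wp_term u n\<close> in five parameters \<open>u\<^sub>0,\<dots>,u\<^sub>4\<close>. A WZ pair
telescopes the alternating series of the Gamma quotients at \<open>z + 1, z + 2, \<dots>\<close> to the Gamma quotient \<open>gamma_pref z\<close>
times \<open>W(2z,\<dots>,2z)\<close>. Since \<open>exp (\<pi> \<i> (z + k))\<close> supplies the sign \<open>(-1)\<^sup>k\<close>, the sum of the \<open>m\<close>-th derivatives at
the positive integers is \<open>m!\<close> times a Taylor coefficient of \<open>- exp (\<pi> \<i> z) gamma_pref z W(2z,\<dots>,2z)\<close>, which has to be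
found for \<open>m \<le> 6\<close>.

Although it is not visible from the terms, \<open>W\<close> is symmetric in all five parameters, and as soon as one parameter vanishes
it telescopes: a cubic form in the other parameters times \<open>W\<close> is a quotient of Gamma values minus 1. Its homogeneous part of degree
\<open>m\<close> is a polynomial of degree \<open>m\<close> in five variables. For \<open>m < 5\<close> inclusion-exclusion over the coordinate subspaces
recovers its value at \<open>(1,1,1,1,1)\<close> from the values at the 0/1 vectors with a vanishing coordinate; for
\<open>m = 5\<close> and \<open>m = 6\<close> the monomials containing every variable contribute as well, and these are detected by
one first derivative in the direction of a vanishing coordinate. The derivative with the other four parameters equal to 1 is
the only place where double zeta values enter, and the sum, stuffle and shuffle relations in weights 8 and 9 reduce those to
\<open>\<zeta>(5,3)\<close> and products of zeta values.
\<close>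

text \<open>Up to a factor, \<open>W\<close> is a very-well-poised 7F6 at argument 1 with one
  numerator parameter equal to 1. The exchange of \<open>u 0\<close> and \<open>u 1\<close> comes
  from a closed 1-form on the lattice quadrant: its sums along the two axes are multiples of
  \<open>W\<close> and of the exchanged \<open>W\<close>, and its sums along the far sides of
  growing squares tend to 0. The obstacle on the faces is that the cubic form vanishes at every 0/1
  vector with 0, 2 or 4 ones, so telescoping gives values only for 1 or 3 ones. For an even number
  of ones the Pochhammer symbols cancel, the terms become rational in \<open>n\<close>, and they are
  summed directly. The same split governs the first derivatives: for 1 or 3 ones the telescoped
  identity is differentiated, for 2 or 4 ones the single terms are. There the logarithmic derivative
  contains harmonic sums, which cancel for two ones and survive for four. Inclusion-exclusion is
  applied to the Taylor coefficients of single terms, which are visibly polynomials, and only then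
  summed over \<open>n\<close>; the limit need not be shown to be a polynomial.\<close>

definition wp_par :: "(nat \<Rightarrow> 'a::field_char_0) \<Rightarrow> 'a" where
  "wp_par u = (u 0 + u 1 + u 2 + u 3 + u 4) / 2"

definition wp_term :: "(nat \<Rightarrow> 'a::field_char_0) \<Rightarrow> nat \<Rightarrow> 'a" where
  "wp_term u n = (2 * of_nat n + 2 + wp_par u - u 0) *
     (\<Prod>i\<in>{1..4}. pochhammer (1 + wp_par u - u 0 - u i) n / pochhammer (1 + u i) (Suc n))"

lemma prod_1_4: "(\<Prod>i\<in>{1..4::nat}. f i) = f 1 * f 2 * f 3 * (f 4 :: 'a::comm_monoid_mult)"
proof -
  have "{1..4::nat} = {1,2,3,4}" by auto
  thus ?thesis by (simp add: mult_ac)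
qed

lemma all_less_5: "(\<forall>i<5. P i) \<longleftrightarrow> P 0 \<and> P 1 \<and> P 2 \<and> P 3 \<and> P (4::nat)"
  by (auto simp: less_Suc_eq numeral_eq_Suc)

section \<open>A closed 1-form on the lattice quadrant\<close>

definition grid_weight :: "(nat \<Rightarrow> complex) \<Rightarrow> nat \<Rightarrow> nat \<Rightarrow> complex" where
  "grid_weight u N m = pochhammer (1 + wp_par u - u 0 - u 1) (N + m) *
     (\<Prod>l\<in>{2,3,4}. pochhammer (1 + wp_par u - u 0 - u l) N * pochhammer (1 + wp_par u - u 1 - u l) m
                      / pochhammer (2 + u l) (N + m)) /
     (pochhammer (2 + u 1) N * pochhammer (2 + u 0) m)"

text \<open>\<open>edge0 u N m\<close> belongs to the edge from \<open>(N, m)\<close> to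
  \<open>(N + 1, m)\<close>, \<open>edge1 u N m\<close> to the edge from \<open>(N, m)\<close> to
  \<open>(N, m + 1)\<close>. Exchanging \<open>u 0\<close> with \<open>u 1\<close> and
  \<open>N\<close> with \<open>m\<close> preserves \<open>grid_weight\<close> and interchanges the
  two edge functions.\<close>

definition edge0 :: "(nat \<Rightarrow> complex) \<Rightarrow> nat \<Rightarrow> nat \<Rightarrow> complex" where
  "edge0 u N m = (2 + 2 * of_nat N + of_nat m + wp_par u - u 0) * (1 + of_nat m + u 0) * grid_weight u N m"

definition edge1 :: "(nat \<Rightarrow> complex) \<Rightarrow> nat \<Rightarrow> nat \<Rightarrow> complex" where
  "edge1 u N m = (2 + of_nat N + 2 * of_nat m + wp_par u - u 1) * (1 + of_nat N + u 1) * grid_weight u N m"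

text \<open>The radius 1/50 keeps the combinations \<open>wp_par u - u i - u j\<close> below 1/10 in
  norm, which leaves enough decay in the Pochhammer quotients for an absolutely convergent
  series.\<close>

definition small_par :: "(nat \<Rightarrow> 'a::real_normed_field) \<Rightarrow> bool" where
  "small_par u \<longleftrightarrow> (\<forall>i<5. norm (u i) \<le> 1/50)"

lemma small_par_add_nz:
  fixes u :: "nat \<Rightarrow> complex"
  assumes "small_par u" "i < 5"
  shows "of_nat (Suc n) + u i \<noteq> 0"
proof
  assume "of_nat (Suc n) + u i = 0"
  hence "u i = - of_nat (Suc n)" by (simp add: add_eq_0_iff)
  hence "norm (u i) = real (Suc n)" by (metis norm_minus_cancel norm_of_nat)
  thus False using assms by (auto simp: small_par_def dest!: spec[of _ i])
qed

lemma grid_weight_Suc0: "grid_weight u (Suc N) m = grid_weight u N m * ((1 + wp_par u - u 0 - u 1 + of_nat (N+m)) *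
     (\<Prod>l\<in>{2,3,4}. (1 + wp_par u - u 0 - u l + of_nat N) / (2 + u l + of_nat (N + m))) / (2 + u 1 + of_nat N))"
  unfolding grid_weight_def by (simp add: pochhammer_Suc divide_inverse mult_ac)

lemma grid_weight_Suc1: "grid_weight u N (Suc m) = grid_weight u N m * ((1 + wp_par u - u 0 - u 1 + of_nat (N+m)) *
     (\<Prod>l\<in>{2,3,4}. (1 + wp_par u - u 1 - u l + of_nat m) / (2 + u l + of_nat (N + m))) / (2 + u 0 + of_nat m))"
  unfolding grid_weight_def by (simp add: pochhammer_Suc divide_inverse mult_ac)

lemma grid_identity_aux:
  fixes C D E K L :: "'a::field_char_0"
  assumes "C + D + E = K + L"
  shows "L * ((K - C) * (K - D) * (K - E)) - K * ((L - C) * (L - D) * (L - E)) = (K - L) * (C * D * E)"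
proof -
  have "L * ((K - C) * (K - D) * (K - E)) - K * ((L - C) * (L - D) * (L - E)) - (K - L) * (C * D * E)
     = L * K * (K - L) * (K + L - (C + D + E))"
    by (simp add: algebra_simps)
  thus ?thesis by (simp add: assms)
qed

text \<open>Here \<open>K\<close> and \<open>L\<close> are the linear factors of the two shifted
  edges and \<open>C\<close>, \<open>D\<close>, \<open>E\<close> the new denominators. Then
  \<open>K - C\<close>, \<open>L - C\<close> and so on are the new numerators, and the condition on
  \<open>p\<close> turns into the balancing \<open>C + D + E = K + L\<close>.\<close>

lemma grid_identity:
  fixes a b c d e N m p :: "'a::field_char_0"
  assumes "2 * p = a + b + c + d + e"
  shows "((2 + 2*N + m + p - a) * (1 + m + a) - (2 + N + 2*m + p - b) * (1 + N + b)) * ((2+c+(N+m)) * (2+d+(N+m)) * (2+e+(N+m)))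
   = (1 + p - a - b + (N+m)) * ((3 + 2*N + m + p - a) * ((1 + p - b - c + m) * (1 + p - b - d + m) * (1 + p - b - e + m))
      - (3 + N + 2*m + p - b) * ((1 + p - a - c + N) * (1 + p - a - d + N) * (1 + p - a - e + N)))"
proof -
  define K L C D E where "K = 3 + N + 2*m + p - b" "L = 3 + 2*N + m + p - a"
    "C = 2+c+(N+m)" "D = 2+d+(N+m)" "E = 2+e+(N+m)"
  note defs = this
  have kc: "K - C = 1 + p - b - c + m" "K - D = 1 + p - b - d + m" "K - E = 1 + p - b - e + m" 
     "L - C = 1 + p - a - c + N" "L - D = 1 + p - a - d + N" "L - E = 1 + p - a - e + N"
    by (simp_all add: defs)
  have "(2 + 2*N + m + p - a) * (1 + m + a) - (2 + N + 2*m + p - b) * (1 + N + b)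
     = (1 + p - a - b + (N+m)) * (K - L)"
    unfolding defs by (simp add: algebra_simps)
  moreover have "C + D + E = K + L"
    unfolding defs using assms by (simp add: algebra_simps)
  ultimately show ?thesis using grid_identity_aux[of C D E K L] 
    unfolding kc defs(1,2)[symmetric] defs(3-5)[symmetric] by simp
qed
text \<open>The circulation around a unit square vanishes. Both shifted weights are rational
  multiples of the weight at the lower left corner with the common denominator \<open>D\<close>, so
  that after division by this weight only \<open>grid_identity\<close> is left.\<close>

lemma edge_closed:
  assumes "small_par u"
  shows "edge0 u N m + edge1 u (Suc N) m = edge1 u N m + edge0 u N (Suc m)"
proof -
  define a b c d e p where abc: "a = u 0" "b = u 1" "c = u 2" "d = u 3" "e = u 4" "p = wp_par u"
  define x y :: complex where xy: "x = of_nat N" "y = of_nat m"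
  define D where "D = (2+c+(x+y)) * (2+d+(x+y)) * (2+e+(x+y))"
  define P where "P = (1 + p - b - c + y) * (1 + p - b - d + y) * (1 + p - b - e + y)"
  define Q where "Q = (1 + p - a - c + x) * (1 + p - a - d + x) * (1 + p - a - e + x)"
  define q where "q = 1 + p - a - b + (x+y)"
  define K L where "K = 3 + x + 2*y + p - b" "L = 3 + 2*x + y + p - a"
  note KL = this
  define w where "w = grid_weight u N m"
  have nz: "of_nat (Suc n) + v \<noteq> 0" if "v \<in> {a,b,c,d,e}" for v n
    using small_par_add_nz[OF assms, of 0 n] small_par_add_nz[OF assms, of 1 n] small_par_add_nz[OF assms, of 2 n]
      small_par_add_nz[OF assms, of 3 n] small_par_add_nz[OF assms, of 4 n] that by (auto simp: abc)
  have nz': "2 + v + of_nat n \<noteq> 0" if "v \<in> {a,b,c,d,e}" for v n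
    using nz[OF that, of "Suc n"] by (simp add: algebra_simps)
  have "2 + v + (x + y) \<noteq> 0" if "v \<in> {a,b,c,d,e}" for v
    using nz'[OF that, of "N + m"] by (simp add: xy)
  hence D: "D \<noteq> 0" by (simp add: D_def)
  have ab: "2 + a + y \<noteq> 0" "2 + b + x \<noteq> 0" using nz' by (auto simp: xy)
  have id: "((2 + 2*x + y + p - a) * (1 + y + a) - (2 + x + 2*y + p - b) * (1 + x + b)) * D
   = q * (L * P - K * Q)"
    unfolding D_def P_def Q_def q_def KL by (rule grid_identity) (simp add: abc wp_par_def)
  have id': "(2 + 2*x + y + p - a) * (1 + y + a) - (2 + x + 2*y + p - b) * (1 + x + b)
     = q * (L * P - K * Q) / D"
    by (rule eq_divide_imp[OF D id])
  have w1: "grid_weight u (Suc N) m = w * (q * (Q / D) / (2 + b + x))"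
    unfolding grid_weight_Suc0 by (simp add: abc xy D_def w_def Q_def q_def mult.assoc)
  have w0: "grid_weight u N (Suc m) = w * (q * (P / D) / (2 + a + y))"
    unfolding grid_weight_Suc1 by (simp add: abc xy D_def w_def P_def q_def mult.assoc)
  have "edge1 u (Suc N) m = K * (2 + b + x) * (w * (q * (Q / D) / (2 + b + x)))"
    unfolding edge1_def w1 by (simp add: abc xy KL add_ac)
  hence e1: "edge1 u (Suc N) m = K * Q * (q / D * w)" using ab by simp
  have "edge0 u N (Suc m) = L * (2 + a + y) * (w * (q * (P / D) / (2 + a + y)))"
    unfolding edge0_def w0 by (simp add: abc xy KL add_ac)
  hence e0: "edge0 u N (Suc m) = L * P * (q / D * w)" using ab by simp
  have "edge0 u N m - edge1 u N m
     = ((2 + 2*x + y + p - a) * (1 + y + a) - (2 + x + 2*y + p - b) * (1 + x + b)) * w"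
    unfolding edge0_def edge1_def by (simp only: abc xy w_def left_diff_distrib)
  also have "\<dots> = (L * P - K * Q) * (q / D * w)"
    unfolding id' by simp
  also have "\<dots> = edge0 u N (Suc m) - edge1 u (Suc N) m"
    unfolding e0 e1 by (simp only: left_diff_distrib)
  finally show ?thesis by (simp only: diff_eq_eq add_ac) (simp add: algebra_simps)
qed

text \<open>Inner edges cancel: the inner induction adds the unit squares of one column, the outer
  one adds the columns.\<close>

lemma grid_rectangle:
  assumes "small_par u"
  shows "(\<Sum>n<N. edge0 u n 0) + (\<Sum>m<M. edge1 u N m) = (\<Sum>m<M. edge1 u 0 m) + (\<Sum>n<N. edge0 u n M)"
proof (induction N)
  case (Suc N)
  have *: "edge0 u N 0 + (\<Sum>m<M. edge1 u (Suc N) m) = (\<Sum>m<M. edge1 u N m) + edge0 u N M"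
  proof (induction M)
    case (Suc M)
    have "edge0 u N 0 + (\<Sum>m<Suc M. edge1 u (Suc N) m) = (edge0 u N 0 + (\<Sum>m<M. edge1 u (Suc N) m)) + edge1 u (Suc N) M"
      by simp
    also have "\<dots> = (\<Sum>m<M. edge1 u N m) + (edge0 u N M + edge1 u (Suc N) M)" unfolding Suc.IH by (simp add: add_ac)
    finally show ?case unfolding edge_closed[OF assms] by (simp add: add_ac)
  qed auto
  have "(\<Sum>n<Suc N. edge0 u n 0) + (\<Sum>m<M. edge1 u (Suc N) m) = (\<Sum>n<N. edge0 u n 0) + (edge0 u N 0 + (\<Sum>m<M. edge1 u (Suc N) m))"
    by simp
  also have "\<dots> = ((\<Sum>n<N. edge0 u n 0) + (\<Sum>m<M. edge1 u N m)) + edge0 u N M" unfolding * by (simp add: add_ac)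
  finally show ?case unfolding Suc.IH by simp
qed auto

subsection \<open>Convergence and symmetry\<close>

text \<open>The fourth power reflects the four Pochhammer quotients in a term. With
  \<open>t = n + 1\<close> the right-hand side telescopes to \<open>1 / (n + 1) ^ 3\<close>, hence
  order -2 remains after the linear factor of the term. One power of \<open>t / (t + 1)\<close> is
  given away to absorb the deviation of the parameters from 0.\<close>

lemma pochhammer_factor_bound:
  fixes t :: real
  assumes "t \<ge> 1"
  shows "((t + 1/10) / (t + 49/50)) ^ 4 \<le> (t / (t + 1)) ^ 3"
proof -
  have "(t + 1/10) / (t + 49/50) \<le> t / (t + 1) * (1 + 1 / (8 * t))"
  proof -
    have "(t + 1/10) * (t + 1) \<le> (t + 1/8) * (t + 49/50)" using assms by (simp add: field_simps)
    hence "(t + 1/10) / (t + 49/50) \<le> (t + 1/8) / (t + 1)" using assms by (simp add: field_simps)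
    also have "t + 1/8 = t * (1 + 1 / (8 * t))" using assms by (simp add: distrib_left)
    hence "(t + 1/8) / (t + 1) = t / (t + 1) * (1 + 1 / (8 * t))" by simp
    finally show ?thesis .
  qed
  moreover have "0 \<le> (t + 1/10) / (t + 49/50)" using assms by simp
  ultimately have "((t + 1/10) / (t + 49/50)) ^ 4 \<le> (t / (t + 1)) ^ 4 * (1 + 1 / (8 * t)) ^ 4"
    by (metis power_mono power_mult_distrib)
  also have "(1 + 1 / (8 * t)) ^ 4 \<le> (t + 1) / t"
  proof -
    define y where "y = 1 / (8 * t)"
    have y: "0 \<le> y" "y \<le> 1/8" using assms by (auto simp: y_def divide_simps)
    have y2: "y^2 \<le> y/8" "y^3 \<le> y/64" "y^4 \<le> y/512"
    proof -
      show 1: "y^2 \<le> y/8" using mult_left_mono[OF y(2,1)] by (simp add: power2_eq_square)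
      show 2: "y^3 \<le> y/64" using mult_right_mono[OF 1 y(1)] 1 by (simp add: power2_eq_square power3_eq_cube)
      show "y^4 \<le> y/512" using mult_right_mono[OF 2 y(1)] 1 by (simp add: power2_eq_square power3_eq_cube power4_eq_xxxx)
    qed
    have "(1 + y)^4 = 1 + 4 * y + 6 * y^2 + 4 * y^3 + y^4" by algebra
    also have "\<dots> \<le> 1 + 8 * y" using y y2 by linarith
    also have "\<dots> = (t + 1) / t" using assms by (simp add: y_def field_simps)
    finally show ?thesis by (simp add: y_def)
  qed
  hence "(t / (t + 1)) ^ 4 * (1 + 1 / (8 * t)) ^ 4 \<le> (t / (t + 1)) ^ 4 * ((t + 1) / t)"
    using assms by (intro mult_left_mono) auto
  also have "\<dots> = (t / (t + 1)) ^ 3" using assms by (simp add: power4_eq_xxxx power3_eq_cube)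
  finally show ?thesis by simp
qed

text \<open>The constants are the extreme cases 1 + 1/10 in the numerator and 2 - 1/50 in the
  denominator under \<open>small_par\<close>.\<close>

definition poch_majorant :: "nat \<Rightarrow> real" where
  "poch_majorant n = (\<Prod>j<n. (real j + 11/10) / (real j + 99/50))"

lemma poch_majorant_nonneg: "poch_majorant n \<ge> 0"
  unfolding poch_majorant_def by (intro prod_nonneg) auto

lemma poch_majorant_pow4: "poch_majorant n ^ 4 \<le> 1 / (real n + 1) ^ 3"
proof (induction n)
  case (Suc n)
  have "poch_majorant (Suc n) ^ 4 = poch_majorant n ^ 4 * ((real n + 11/10) / (real n + 99/50)) ^ 4"
    unfolding poch_majorant_def by (simp only: prod.lessThan_Suc power_mult_distrib)
  also have "\<dots> \<le> 1 / (real n + 1) ^ 3 * ((real n + 1) / (real n + 2)) ^ 3"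
    using pochhammer_factor_bound[of "real n + 1"] Suc
    by (intro mult_mono) (auto simp: add_ac)
  also have "\<dots> = 1 / (real (Suc n) + 1) ^ 3" by (simp add: power_divide add_ac)
  finally show ?case .
qed (simp add: poch_majorant_def)

lemma norm_add_upper: "norm v \<le> c \<Longrightarrow> norm (of_nat n + (v::complex)) \<le> real n + c"
  by (metis add_left_mono norm_of_nat norm_triangle_ineq order_trans)

lemma norm_add_lower: "norm v \<le> c \<Longrightarrow> norm (of_nat n + (v::complex)) \<ge> real n - c"
  by (metis diff_left_mono norm_diff_ineq norm_of_nat order_trans)

lemma pochhammer_quotient_bound:
  fixes v w :: complex
  assumes "norm v \<le> 1/10" "norm w \<le> 1/50"
  shows "norm (pochhammer (1 + v) n / pochhammer (2 + w) n) \<le> poch_majorant n"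
proof (induction n)
  case (Suc n)
  have 1: "norm (1 + v + of_nat n) \<le> real n + 11/10"
    using norm_add_upper[OF assms(1), of "Suc n"] by (simp add: add_ac)
  have 2: "norm (2 + w + of_nat n) \<ge> real n + 99/50"
    using norm_add_lower[OF assms(2), of "Suc (Suc n)"] by (simp add: add_ac)
  have 3: "norm ((1 + v + of_nat n) / (2 + w + of_nat n)) \<le> (real n + 11/10) / (real n + 99/50)"
    unfolding norm_divide using 1 2 by (intro frac_le) auto
  have "norm (pochhammer (1 + v) (Suc n) / pochhammer (2 + w) (Suc n)) =
     norm (pochhammer (1 + v) n / pochhammer (2 + w) n) * norm ((1 + v + of_nat n) / (2 + w + of_nat n))"
    by (simp add: pochhammer_Suc norm_mult norm_divide)
  also have "\<dots> \<le> poch_majorant n * ((real n + 11/10) / (real n + 99/50))"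
    by (intro mult_mono Suc 3 poch_majorant_nonneg) auto
  finally show ?case by (simp add: poch_majorant_def)
qed (simp add: poch_majorant_def)

lemma small_par_bounds:
  assumes "small_par (u :: nat \<Rightarrow> complex)"
  shows "i < 5 \<Longrightarrow> norm (u i) \<le> 1/50"
    and "i < 5 \<Longrightarrow> j < 5 \<Longrightarrow> norm (wp_par u - u i - u j) \<le> 1/10"
    and "i < 5 \<Longrightarrow> norm (wp_par u - u i) \<le> 1/10"
proof -
  show *: "i < 5 \<Longrightarrow> norm (u i) \<le> 1/50" for i using assms by (auto simp: small_par_def)
  have "norm (u 0 + u 1 + u 2 + u 3 + u 4) \<le> norm (u 0) + norm (u 1) + norm (u 2) + norm (u 3) + norm (u 4)"
    by (intro norm_triangle_le add_mono) auto
  also have "\<dots> \<le> 1/10" using *[of 0] *[of 1] *[of 2] *[of 3] *[of 4] by simp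
  finally have p: "norm (wp_par u) \<le> 1/20" by (simp add: wp_par_def norm_divide)
  show **: "i < 5 \<Longrightarrow> norm (wp_par u - u i) \<le> 1/10" for i
    using p *[of i] norm_triangle_ineq4[of "wp_par u" "u i"] by simp
  show "i < 5 \<Longrightarrow> j < 5 \<Longrightarrow> norm (wp_par u - u i - u j) \<le> 1/10" for i j
    using p *[of i] *[of j] norm_triangle_ineq4[of "wp_par u" "u i"] norm_triangle_ineq4[of "wp_par u - u i" "u j"] by simp
qed

lemma pochhammer_quotient_bound4:
  assumes "small_par (u :: nat \<Rightarrow> complex)"
  shows "norm (\<Prod>i\<in>{1..4}. pochhammer (1 + wp_par u - u 0 - u i) n / pochhammer (2 + u i) n) \<le> 1 / (real n + 1) ^ 3"
proof -
  have "norm (\<Prod>i\<in>{1..4}. pochhammer (1 + wp_par u - u 0 - u i) n / pochhammer (2 + u i) n)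
     = (\<Prod>i\<in>{1..4}. norm (pochhammer (1 + (wp_par u - u 0 - u i)) n / pochhammer (2 + u i) n))"
    by (simp add: prod_norm add_diff_eq)
  also have "\<dots> \<le> (\<Prod>i\<in>{1..4::nat}. poch_majorant n)"
    by (intro prod_mono conjI norm_ge_zero pochhammer_quotient_bound small_par_bounds[OF assms]) auto
  also have "\<dots> \<le> 1 / (real n + 1) ^ 3" using poch_majorant_pow4[of n] by simp
  finally show ?thesis .
qed

lemma wp_term_altdef:
  "wp_term u n = (2 * of_nat n + 2 + wp_par u - u 0) / (\<Prod>i\<in>{1..4}. 1 + u i) *
     (\<Prod>i\<in>{1..4}. pochhammer (1 + wp_par u - u 0 - u i) n / pochhammer (2 + u i) n)"
  unfolding wp_term_def prod_1_4 pochhammer_rec by (simp add: add_ac)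

lemma wp_term_bound:
  assumes "small_par (u :: nat \<Rightarrow> complex)"
  shows "norm (wp_term u n) \<le> 6 / (real n + 1) ^ 2"
proof -
  have 1: "norm (2 * of_nat n + 2 + wp_par u - u 0) \<le> 3 * (real n + 1)"
    using norm_add_upper[OF small_par_bounds(3)[OF assms, of 0], of "2 * n + 2"] by (simp add: algebra_simps)
  have 2: "norm (1 + u i) \<ge> 49/50" if "i < 5" for i
    using norm_add_lower[OF small_par_bounds(1)[OF assms that], of 1] by simp
  have "(49/50)^4 \<le> norm (\<Prod>i\<in>{1..4}. 1 + u i)"
  proof -
    have "(\<Prod>i\<in>{1..4::nat}. 49/50 :: real) \<le> (\<Prod>i\<in>{1..4}. norm (1 + u i))"
      by (intro prod_mono) (use 2 in auto)
    thus ?thesis by (simp add: prod_norm)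
  qed
  hence 3: "1/2 \<le> norm (\<Prod>i\<in>{1..4}. 1 + u i)" by (simp add: power_divide)
  have "norm (wp_term u n) \<le> (3 * (real n + 1)) / (1/2) * (1 / (real n + 1) ^ 3)"
    unfolding wp_term_altdef norm_mult norm_divide[of "_ + _ - _"]
    by (intro mult_mono frac_le 1 3 pochhammer_quotient_bound4 assms) auto
  also have "\<dots> = 6 / (real n + 1) ^ 2"
    by (simp add: divide_simps power2_eq_square power3_eq_cube)
  finally show ?thesis .
qed

lemma summable_inverse_squares_real: "summable (\<lambda>n. c / (real n + 1) ^ 2)"
proof -
  have "summable (\<lambda>n. c * (1 / (real (Suc n)) ^ 2))"
    using inverse_power_summable[of 2, where ?'a = real] 
    by (intro summable_mult) (subst summable_Suc_iff, simp add: inverse_eq_divide)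
  thus ?thesis by (simp add: add_ac)
qed

lemma wp_term_summable: "small_par (u :: nat \<Rightarrow> complex) \<Longrightarrow> summable (wp_term u)"
  by (rule summable_comparison_test'[OF summable_inverse_squares_real[of 6]]) (use wp_term_bound in auto)

definition swap01 :: "(nat \<Rightarrow> 'a) \<Rightarrow> nat \<Rightarrow> 'a" where
  "swap01 u = u(0 := u 1, 1 := u 0)"

lemma swap01_simps [simp]:
  "swap01 u 0 = u 1" "swap01 u (Suc 0) = u 0" "swap01 u 2 = u 2" "swap01 u 3 = u 3" "swap01 u 4 = u 4"
  "wp_par (swap01 u) = wp_par u"
  by (simp_all add: swap01_def wp_par_def)

lemma small_par_swap01 [simp]: "small_par (swap01 u) \<longleftrightarrow> small_par u"
  by (auto simp: small_par_def all_less_5)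

lemma edge0_conv_edge1: "edge0 u n m = edge1 (swap01 u) m n"
  by (simp add: edge0_def edge1_def grid_weight_def) (simp add: algebra_simps)

lemma grid_weight_0: 
  "grid_weight u n 0 = (\<Prod>i\<in>{1..4}. pochhammer (1 + wp_par u - u 0 - u i) n / pochhammer (2 + u i) n)"
  unfolding grid_weight_def prod_1_4 by (simp add: mult_ac)

lemma edge0_wp_term:
  assumes "small_par u"
  shows "edge0 u n 0 = (\<Prod>i\<in>{..<5}. 1 + u i) * wp_term u n"
proof -
  have nz: "1 + u i \<noteq> 0" if "i < 5" for i using small_par_add_nz[OF assms that, of 0] by simp
  have "{..<5::nat} = insert 0 {1..4}" by auto
  hence "(\<Prod>i\<in>{..<5}. 1 + u i) = (1 + u 0) * (\<Prod>i\<in>{1..4}. 1 + u i)" by simp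
  moreover have "(\<Prod>i\<in>{1..4}. 1 + u i) \<noteq> 0" using nz by auto
  ultimately show ?thesis unfolding edge0_def grid_weight_0 wp_term_altdef by (simp add: mult_ac)
qed

text \<open>Below the diagonal two of the numerators, of size about \<open>m\<close>, are at most
  half of denominators of size about \<open>N + m\<close>; this gives 1/4. The two remaining
  quotients are paired so that each is at most 1.\<close>

lemma grid_weight_decay:
  assumes "small_par u" "m < N"
  shows "norm (grid_weight u N (Suc m)) \<le> norm (grid_weight u N m) * (1/4)"
proof -
  define E where "E = N + m"
  note b = small_par_bounds[OF assms(1)]
  define U V where "U = (\<lambda>l. norm (1 + wp_par u - u 1 - u l + of_nat m))" "V = (\<lambda>l. norm (2 + u l + of_nat E))"
  have 1: "norm (1 + wp_par u - u 0 - u 1 + of_nat E) \<le> real E + 11/10"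
    using norm_add_upper[OF b(2)[of 0 1], of "Suc E"] by (simp add: algebra_simps)
  have U: "U l \<le> real m + 11/10" if "l < 5" for l
    using norm_add_upper[OF b(2)[of 1 l], of "Suc m"] that by (simp add: algebra_simps U_V_def)
  have V: "V l \<ge> real E + 99/50" if "l < 5" for l
    using norm_add_lower[OF b(1)[OF that], of "Suc (Suc E)"] by (simp add: algebra_simps U_V_def)
  have W: "norm (2 + u 0 + of_nat m) \<ge> real m + 99/50"
    using norm_add_lower[OF b(1)[of 0], of "Suc (Suc m)"] by (simp add: algebra_simps)
  have q1: "norm (1 + wp_par u - u 0 - u 1 + of_nat E) / V 2 \<le> 1"
    using 1 V[of 2] by (simp add: divide_simps)
  have q2: "U 2 / norm (2 + u 0 + of_nat m) \<le> 1"
    using U[of 2] W by (auto simp: divide_simps)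
  have q3: "U l / V k \<le> 1/2" if "l < 5" "k < 5" for l k
  proof -
    have "2 * U l \<le> V k" using U[OF that(1)] V[OF that(2)] assms(2) by (simp add: E_def)
    moreover have "V k > 0" using V[OF that(2)] by linarith
    ultimately show ?thesis by (simp add: divide_simps)
  qed
  have nn: "U l \<ge> 0" "V l \<ge> 0" for l by (auto simp: U_V_def)
  have "norm (grid_weight u N (Suc m)) = norm (grid_weight u N m) * 
     ((norm (1 + wp_par u - u 0 - u 1 + of_nat E) / V 2) * (U 2 / norm (2 + u 0 + of_nat m)) * (U 3 / V 3) * (U 4 / V 4))"
    unfolding grid_weight_Suc1 by (simp add: norm_mult norm_divide U_V_def E_def mult_ac)
  also have "\<dots> \<le> norm (grid_weight u N m) * (1 * 1 * (1/2) * (1/2))"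
    by (intro mult_left_mono mult_mono q1 q2 q3 mult_nonneg_nonneg divide_nonneg_nonneg nn norm_ge_zero) auto
  finally show ?thesis by simp
qed

lemma edge1_bound:
  assumes "small_par u" "m < N"
  shows "norm (edge1 u N m) \<le> 6 / (real N + 1) * (1/4) ^ m"
proof -
  note b = small_par_bounds[OF assms(1)]
  have g: "norm (grid_weight u N m) \<le> 1 / (real N + 1) ^ 3 * (1/4) ^ m" using assms(2)
  proof (induction m)
    case 0 thus ?case using pochhammer_quotient_bound4[OF assms(1), of N] by (simp add: grid_weight_0)
  next
    case (Suc m)
    have "norm (grid_weight u N (Suc m)) \<le> norm (grid_weight u N m) * (1/4)"
      using Suc.prems by (intro grid_weight_decay assms) auto
    thus ?case using Suc by simp
  qed
  have 1: "norm (2 + of_nat N + 2 * of_nat m + wp_par u - u 1) \<le> 3 * (real N + 1)"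
  proof -
    have "norm (2 + of_nat N + 2 * of_nat m + wp_par u - u 1) \<le> real (2 + N + 2 * m) + 1/10"
      using norm_add_upper[OF b(3)[of 1], of "2 + N + 2 * m"] by (simp add: algebra_simps)
    also have "\<dots> \<le> 3 * (real N + 1)" using assms(2) by simp
    finally show ?thesis .
  qed
  have 2: "norm (1 + of_nat N + u 1) \<le> 2 * (real N + 1)"
    using norm_add_upper[OF b(1)[of 1], of "Suc N"] by simp
  have "norm (edge1 u N m) \<le> (3 * (real N + 1)) * (2 * (real N + 1)) * (1 / (real N + 1) ^ 3 * (1/4) ^ m)"
    unfolding edge1_def norm_mult by (intro mult_mono 1 2 g) auto
  also have "\<dots> = 6 / (real N + 1) * (1/4) ^ m"
  proof -
    have *: "(3 * x) * (2 * x) * (1 / x ^ 3 * c) = 6 / x * c" if "x \<noteq> 0" for x c :: real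
      using that by (simp add: power3_eq_cube)
    show ?thesis by (rule *) simp
  qed
  finally show ?thesis .
qed

lemma sum_edge1_tendsto_0:
  assumes "small_par u"
  shows "(\<lambda>N. \<Sum>m<N. edge1 u N m) \<longlonglongrightarrow> 0"
proof (rule Lim_null_comparison)
  show "\<forall>\<^sub>F N in sequentially. norm (\<Sum>m<N. edge1 u N m) \<le> 8 / (real N + 1)"
  proof (intro always_eventually allI)
    fix N
    have "norm (\<Sum>m<N. edge1 u N m) \<le> (\<Sum>m<N. 6 / (real N + 1) * (1/4) ^ m)"
      by (rule sum_norm_le) (use edge1_bound[OF assms] in auto)
    also have "\<dots> = 6 / (real N + 1) * (\<Sum>m<N. (1/4) ^ m)" by (simp add: sum_distrib_left)
    also have "(\<Sum>m<N. (1/4::real) ^ m) \<le> 4/3" by (subst sum_gp_strict) simp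
    hence "6 / (real N + 1) * (\<Sum>m<N. (1/4) ^ m) \<le> 6 / (real N + 1) * (4/3)" by (intro mult_left_mono) auto
    finally show "norm (\<Sum>m<N. edge1 u N m) \<le> 8 / (real N + 1)" by (simp add: field_simps)
  qed
  show "(\<lambda>N. 8 / (real N + 1)) \<longlonglongrightarrow> 0"
    using tendsto_mult_left[OF LIMSEQ_inverse_real_of_nat, of 8] by (simp add: divide_inverse add_ac)
qed

text \<open>On an \<open>N\<close> by \<open>N\<close> square the two axes carry the partial sums
  for \<open>u\<close> and for the exchanged parameters, both with the nonzero factor
  \<open>P\<close>. The upper side is the right-hand side for the exchanged parameters, so one
  estimate removes both far sides.\<close>

theorem wp_sum_swap:
  assumes "small_par (u :: nat \<Rightarrow> complex)"
  shows "(\<Sum>n. wp_term (swap01 u) n) = (\<Sum>n. wp_term u n)"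
proof -
  have sw: "small_par (swap01 u)" using assms by simp
  define P where "P = (\<Prod>i\<in>{..<5}. 1 + u i)"
  have nz: "1 + u i \<noteq> 0" if "i < 5" for i using small_par_add_nz[OF assms that, of 0] by simp
  have P: "P \<noteq> 0" unfolding P_def using nz by auto
  have "{..<5} = {0,1,2,3,4::nat}" by auto
  hence P': "(\<Prod>i\<in>{..<5}. 1 + swap01 u i) = P" by (simp add: P_def)
  have s: "(\<lambda>N. \<Sum>n<N. P * wp_term u n) \<longlonglongrightarrow> P * (\<Sum>n. wp_term u n)" if "small_par u" for u :: "nat \<Rightarrow> complex"
    using sums_mult[OF summable_sums[OF wp_term_summable[OF that]], of P] by (simp add: sums_def)
  have "(\<lambda>N. (\<Sum>n<N. P * wp_term u n) + (\<Sum>m<N. edge1 u N m)) \<longlonglongrightarrow> P * (\<Sum>n. wp_term u n) + 0"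
    by (intro tendsto_add s sum_edge1_tendsto_0 assms)
  moreover have "(\<lambda>N. (\<Sum>n<N. P * wp_term (swap01 u) n) + (\<Sum>n<N. edge1 (swap01 u) N n)) \<longlonglongrightarrow> P * (\<Sum>n. wp_term (swap01 u) n) + 0"
    by (intro tendsto_add s sum_edge1_tendsto_0 sw)
  moreover have "(\<Sum>n<N. P * wp_term u n) + (\<Sum>m<N. edge1 u N m) = (\<Sum>n<N. P * wp_term (swap01 u) n) + (\<Sum>n<N. edge1 (swap01 u) N n)" for N
  proof -
    have "edge1 u 0 m = P * wp_term (swap01 u) m" for m
      using edge0_wp_term[OF sw, of m] unfolding P' by (simp add: edge0_conv_edge1 swap01_def)
    moreover have "edge0 u n 0 = P * wp_term u n" for n
      using edge0_wp_term[OF assms, of n] unfolding P_def by simp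
    ultimately show ?thesis using grid_rectangle[OF assms, of N N] by (simp add: edge0_conv_edge1)
  qed
  ultimately have "P * (\<Sum>n. wp_term u n) + 0 = P * (\<Sum>n. wp_term (swap01 u) n) + 0"
    by (simp only: LIMSEQ_unique)
  thus ?thesis using P by simp
qed

section \<open>Termwise differentiation of series of holomorphic functions\<close>

lemma holomorphic_series:
  assumes r: "r > 0"
    and hol: "\<And>n. f n holomorphic_on ball 0 r"
    and bd: "\<And>n z. z \<in> ball 0 r \<Longrightarrow> norm (f n z) \<le> M n"
    and M: "summable M"
  shows holomorphic_series_holomorphic: "(\<lambda>z. \<Sum>n. f n z) holomorphic_on ball 0 r"
    and higher_deriv_series: "(\<lambda>n. (deriv ^^ m) (f n) 0) sums (deriv ^^ m) (\<lambda>z. \<Sum>n. f n z) 0"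
proof -
  have ul: "uniform_limit (ball 0 r) (\<lambda>n x. \<Sum>i<n. f i x) (\<lambda>x. \<Sum>i. f i x) sequentially"
    by (rule Weierstrass_m_test[OF bd M])
  have h: "(\<lambda>x. \<Sum>i<n. f i x) holomorphic_on ball 0 r" for n
    by (intro holomorphic_intros hol)
  show "(\<lambda>z. \<Sum>n. f n z) holomorphic_on ball 0 r"
  proof (rule holomorphic_uniform_sequence[OF _ h])
    fix x assume "x \<in> ball (0::complex) r"
    then obtain d where d: "d > 0" "cball x d \<subseteq> ball 0 r"
      by (meson open_ball open_contains_cball)
    thus "\<exists>d>0. cball x d \<subseteq> ball 0 r \<and> uniform_limit (cball x d) (\<lambda>n x. \<Sum>i<n. f i x) (\<lambda>z. \<Sum>n. f n z) sequentially"
      using uniform_limit_on_subset[OF ul] by blast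
  qed auto
  have "(\<lambda>n. (deriv ^^ m) (\<lambda>x. \<Sum>i<n. f i x) 0) \<longlonglongrightarrow> (deriv ^^ m) (\<lambda>z. \<Sum>n. f n z) 0"
    by (rule higher_deriv_complex_uniform_limit[OF ul]) (use h r in auto)
  moreover have "(deriv ^^ m) (\<lambda>x. \<Sum>i<n. f i x) 0 = (\<Sum>i<n. (deriv ^^ m) (f i) 0)" for n
  proof (induction n)
    case (Suc n)
    thus ?case using higher_deriv_add[OF h[of n] hol[of n] open_ball, of 0 m] r by simp
  qed (simp add: higher_deriv_const)
  ultimately show "(\<lambda>n. (deriv ^^ m) (f n) 0) sums (deriv ^^ m) (\<lambda>z. \<Sum>n. f n z) 0"
    by (simp add: sums_def)
qed

subsection \<open>Homogeneous polynomials\<close>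

text \<open>Polynomials are handled as functions closed under the listed operations; the monomials
  are recovered in \<open>homog_words\<close>. Only the variables \<open>u 0\<close> to
  \<open>u 4\<close> can occur.\<close>

inductive homog :: "nat \<Rightarrow> ((nat \<Rightarrow> complex) \<Rightarrow> complex) \<Rightarrow> bool" where
  homog_const: "homog 0 (\<lambda>u. c)"
| homog_var: "homog m f \<Longrightarrow> i < 5 \<Longrightarrow> homog (Suc m) (\<lambda>u. u i * f u)"
| homog_add: "homog m f \<Longrightarrow> homog m g \<Longrightarrow> homog m (\<lambda>u. f u + g u)"

lemma homog_cmult: "homog m f \<Longrightarrow> homog m (\<lambda>u. c * f u)"
proof (induction rule: homog.induct)
  case (homog_var m f i)
  have "homog (Suc m) (\<lambda>u. u i * (c * f u))" by (intro homog.intros homog_var)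
  thus ?case by (simp add: mult_ac)
qed (auto simp: ring_distribs intro: homog.intros)

lemma homog_zero: "homog m (\<lambda>u. 0)"
proof (induction m)
  case (Suc m)
  have "homog (Suc m) (\<lambda>u. u 0 * 0)" by (intro homog.intros Suc) auto
  thus ?case by simp
qed (rule homog.intros)

lemma homog_mult: "homog m f \<Longrightarrow> homog k g \<Longrightarrow> homog (m + k) (\<lambda>u. f u * g u)"
proof (induction rule: homog.induct)
  case (homog_var m f i)
  have "homog (Suc (m + k)) (\<lambda>u. u i * (f u * g u))" by (intro homog.intros homog_var)
  thus ?case by (simp add: mult_ac)
qed (auto simp: ring_distribs intro: homog.intros homog_cmult)

lemma homog_sum: "finite A \<Longrightarrow> (\<And>i. i \<in> A \<Longrightarrow> homog m (f i)) \<Longrightarrow> homog m (\<lambda>u. \<Sum>i\<in>A. f i u)"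
  by (induction rule: finite_induct) (auto intro: homog_zero homog_add)

lemma homog_power: "homog 1 f \<Longrightarrow> homog m (\<lambda>u. f u ^ m)"
  by (induction m) (use homog_mult[of 1 f] in \<open>auto intro: homog.intros\<close>)

lemma homog_1_var: "i < 5 \<Longrightarrow> homog 1 (\<lambda>u. u i)"
  using homog_var[OF homog_const[of 1], of i] by simp

lemma homog_diff: "homog m f \<Longrightarrow> homog m g \<Longrightarrow> homog m (\<lambda>u. f u - g u)"
  using homog_add[of m f "\<lambda>u. (-1) * g u"] homog_cmult[of m g "-1"] by simp

text \<open>Monomials appear as words in the variable indices: the degree is the length, the support
  is the set of letters, an exponent is a letter count. Different words may denote the same
  monomial, which is harmless because only linear functionals are applied to the sum.\<close>

lemma homog_words:
  assumes "homog m f"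
  shows "\<exists>(N::nat) a w. (\<forall>i<N. length (w i) = m \<and> set (w i) \<subseteq> {..<5}) \<and>
    f = (\<lambda>u. \<Sum>i<N. a i * prod_list (map u (w i)))"
proof -
  from assms have "\<exists>ws. (\<forall>(a,w)\<in>set ws. length w = m \<and> set w \<subseteq> {..<5}) \<and>
     f = (\<lambda>u. \<Sum>(a,w)\<leftarrow>ws. a * prod_list (map u w))"
  proof (induction rule: homog.induct)
    case (homog_const c)
    show ?case by (rule exI[of _ "[(c, [])]"]) auto
  next
    case (homog_var m f i)
    then obtain ws where ws: "\<forall>(a,w)\<in>set ws. length w = m \<and> set w \<subseteq> {..<5}"
      "f = (\<lambda>u. \<Sum>(a,w)\<leftarrow>ws. a * prod_list (map u w))" by blast
    have "u i * (\<Sum>(a,w)\<leftarrow>ws. a * prod_list (map u w)) =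
       (\<Sum>(a,w)\<leftarrow>map (\<lambda>(a,w). (a, i # w)) ws. a * prod_list (map u w))" for u
      by (induction ws) (auto simp: algebra_simps)
    moreover have "\<forall>(a,w)\<in>set (map (\<lambda>(a,w). (a, i # w)) ws). length w = Suc m \<and> set w \<subseteq> {..<5}"
      using ws(1) homog_var.hyps by fastforce
    ultimately show ?case using ws(2) by blast
  next
    case (homog_add m f g)
    then obtain ws ws' where "\<forall>(a,w)\<in>set ws. length w = m \<and> set w \<subseteq> {..<5}"
      "f = (\<lambda>u. \<Sum>(a,w)\<leftarrow>ws. a * prod_list (map u w))" 
      "\<forall>(a,w)\<in>set ws'. length w = m \<and> set w \<subseteq> {..<5}"
      "g = (\<lambda>u. \<Sum>(a,w)\<leftarrow>ws'. a * prod_list (map u w))" by blast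
    thus ?case by (intro exI[of _ "ws @ ws'"]) auto
  qed
  then obtain ws where ws: "\<forall>(a,w)\<in>set ws. length w = m \<and> set w \<subseteq> {..<5}"
      "f = (\<lambda>u. \<Sum>(a,w)\<leftarrow>ws. a * prod_list (map u w))" by blast
  show ?thesis
  proof (intro exI conjI allI impI)
    show "length (snd (ws ! i)) = m" "set (snd (ws ! i)) \<subseteq> {..<5}" if "i < length ws" for i
      using ws(1) nth_mem[OF that] by (auto simp: case_prod_unfold)
    show "f = (\<lambda>u. \<Sum>i<length ws. fst (ws ! i) * prod_list (map u (snd (ws ! i))))"
      unfolding ws(2) by (simp add: sum_list_sum_nth case_prod_unfold atLeast0LessThan)
  qed
qed

definition ind_par :: "nat set \<Rightarrow> nat \<Rightarrow> complex" where
  "ind_par S i = (if i \<in> S then 1 else 0)"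

lemma prod_list_ind_par: "prod_list (map (ind_par S) w) = of_bool (set w \<subseteq> S)"
  by (induction w) (auto simp: ind_par_def)

lemma prod_list_ind_par_upd:
  "prod_list (map ((ind_par S)(j := d)) w) = d ^ count_list w j * of_bool (set w \<subseteq> insert j S)"
  by (induction w) (auto simp: ind_par_def)

text \<open>Inclusion-exclusion as the expansion of the product over \<open>i\<close> in
  \<open>U\<close> of 1 minus the indicator of \<open>i\<close> lying outside \<open>K\<close>. The
  product is 1 if \<open>K = U\<close>, and has a zero factor otherwise.\<close>

lemma alternating_subset_sum:
  assumes "finite U" "K \<subseteq> U"
  shows "(\<Sum>S\<in>Pow U. (-1) ^ card (U - S) * of_bool (K \<subseteq> S)) = (of_bool (K = U) :: complex)"
proof -
  have "(\<Prod>i\<in>U. 1 + (- of_bool (i \<notin> K) :: complex)) = (\<Sum>S\<in>Pow U. prod (\<lambda>_. 1) S * prod (\<lambda>i. - of_bool (i \<notin> K)) (U - S))"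
    by (rule prod_add[OF assms(1)])
  also have "\<dots> = (\<Sum>S\<in>Pow U. (-1) ^ card (U - S) * of_bool (K \<subseteq> S))"
  proof (rule sum.cong[OF refl])
    fix S assume S: "S \<in> Pow U"
    have fin: "finite (U - S)" using assms by auto
    have "(\<Prod>i\<in>U - S. - of_bool (i \<notin> K) :: complex) = (-1) ^ card (U - S) * (\<Prod>i\<in>U - S. of_bool (i \<notin> K))"
      by (subst prod_constant[symmetric], subst prod.distrib[symmetric]) simp
    also have "(\<Prod>i\<in>U - S. of_bool (i \<notin> K) :: complex) = of_bool (K \<subseteq> S)"
    proof (cases "K \<subseteq> S")
      case False
      then obtain x where "x \<in> K" "x \<notin> S" by auto
      thus ?thesis using assms fin False by (auto intro!: prod_zero bexI[of _ x])
    qed (auto intro!: prod.neutral)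
    finally show "prod (\<lambda>_. 1) S * prod (\<lambda>i. - of_bool (i \<notin> K)) (U - S) = (-1) ^ card (U - S) * (of_bool (K \<subseteq> S) :: complex)"
      by simp
  qed
  also have "(\<Prod>i\<in>U. 1 + (- of_bool (i \<notin> K) :: complex)) = of_bool (K = U)"
  proof (cases "K = U")
    case False
    then obtain x where "x \<in> U" "x \<notin> K" using assms by auto
    thus ?thesis using assms False by (auto intro!: prod_zero bexI[of _ x])
  qed (auto intro!: prod.neutral)
  finally show ?thesis by simp
qed

text \<open>Moebius inversion on the lattice of subsets, taken at the top element \<open>U\<close>.
  Applied to the values of a polynomial in the variables of \<open>U\<close> at 0/1 vectors, it
  keeps exactly the monomials containing all these variables.\<close>

definition subset_alt :: "(nat set \<Rightarrow> complex) \<Rightarrow> nat set \<Rightarrow> complex" where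
  "subset_alt F U = (\<Sum>S\<in>Pow U. (-1) ^ card (U - S) * F S)"

definition dir_deriv :: "nat \<Rightarrow> ((nat \<Rightarrow> complex) \<Rightarrow> complex) \<Rightarrow> nat set \<Rightarrow> complex" where
  "dir_deriv j f S = deriv (\<lambda>d. f ((ind_par S)(j := d))) 0"

lemma subset_alt_sum: "subset_alt (\<lambda>S. \<Sum>i<N. a i * g i S) U = (\<Sum>i<N. a i * subset_alt (g i) U)"
  unfolding subset_alt_def sum_distrib_left by (subst sum.swap) (simp add: mult_ac)

context
  fixes N :: nat and a :: "nat \<Rightarrow> complex" and w :: "nat \<Rightarrow> nat list" and f
  assumes f: "f = (\<lambda>u. \<Sum>i<N. a i * prod_list (map u (w i)))"
    and w: "\<And>i. i < N \<Longrightarrow> set (w i) \<subseteq> {..<5}"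
begin

lemma subset_alt_word_poly:
  "subset_alt (\<lambda>S. f (ind_par S)) {..<5} = (\<Sum>i<N. a i * of_bool (set (w i) = {..<5}))"
  unfolding f prod_list_ind_par subset_alt_sum
  by (intro sum.cong refl arg_cong2[of _ _ _ _ "(*)"])
     (unfold subset_alt_def, rule alternating_subset_sum, use w in auto)

lemma dir_deriv_word_poly:
  "dir_deriv j f S = (\<Sum>i<N. a i * of_bool (count_list (w i) j = 1 \<and> set (w i) \<subseteq> insert j S))"
proof -
  have "((\<lambda>d. \<Sum>i<N. a i * (d ^ count_list (w i) j * of_bool (set (w i) \<subseteq> insert j S))) has_field_derivative
     (\<Sum>i<N. a i * of_bool (count_list (w i) j = 1 \<and> set (w i) \<subseteq> insert j S))) (at 0)"
  proof (intro DERIV_sum DERIV_cmult)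
    fix i
    have "((\<lambda>d. d ^ k * c) has_field_derivative of_bool (k = 1) * c) (at 0)" for k and c :: complex
    proof -
      have "((\<lambda>d. d ^ k * c) has_field_derivative of_nat k * 0 ^ (k - 1) * c) (at 0)"
        by (auto intro!: derivative_eq_intros)
      also have "of_nat k * 0 ^ (k - 1) = (of_bool (k = 1) :: complex)" by (cases "k - 1") auto
      finally show ?thesis .
    qed
    from this[of "count_list (w i) j" "of_bool (set (w i) \<subseteq> insert j S)"]
    show "((\<lambda>d::complex. d ^ count_list (w i) j * of_bool (set (w i) \<subseteq> insert j S)) has_field_derivative
          of_bool (count_list (w i) j = 1 \<and> set (w i) \<subseteq> insert j S)) (at 0)"
      unfolding of_bool_conj .
  qed
  thus ?thesis unfolding dir_deriv_def f prod_list_ind_par_upd by (rule DERIV_imp_deriv)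
qed

text \<open>The derivative at 0 in direction \<open>j\<close> keeps the words containing
  \<open>j\<close> exactly once; the alternating sum over the other four coordinates then keeps
  those in which each of the other letters occurs.\<close>

lemma subset_alt_dir_deriv_word_poly:
  assumes "j < 5"
  shows "subset_alt (dir_deriv j f) ({..<5} - {j}) = (\<Sum>i<N. a i * of_bool (count_list (w i) j = 1 \<and> set (w i) = {..<5}))"
  unfolding dir_deriv_word_poly subset_alt_sum
proof (intro sum.cong refl arg_cong2[of _ _ _ _ "(*)"])
  fix i assume i: "i \<in> {..<N}"
  have "subset_alt (\<lambda>S. of_bool (count_list (w i) j = 1 \<and> set (w i) \<subseteq> insert j S)) ({..<5} - {j})
     = of_bool (count_list (w i) j = 1) * subset_alt (\<lambda>S. of_bool (set (w i) - {j} \<subseteq> S)) ({..<5} - {j})"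
    unfolding subset_alt_def sum_distrib_left by (intro sum.cong refl) auto
  also have "subset_alt (\<lambda>S. of_bool (set (w i) - {j} \<subseteq> S)) ({..<5} - {j}) = of_bool (set (w i) - {j} = {..<5} - {j})"
    unfolding subset_alt_def by (rule alternating_subset_sum) (use w i in auto)
  also have "of_bool (count_list (w i) j = 1) * of_bool (set (w i) - {j} = {..<5} - {j})
    = (of_bool (count_list (w i) j = 1 \<and> set (w i) = {..<5}) :: complex)"
  proof (cases "count_list (w i) j = 1")
    case True
    hence "j \<in> set (w i)" using count_list_0_iff[of "w i" j] by auto
    hence "set (w i) - {j} = {..<5} - {j} \<longleftrightarrow> set (w i) = {..<5}" using assms by blast
    thus ?thesis by simp
  qed simp
  finally show "subset_alt (\<lambda>S. of_bool (count_list (w i) j = 1 \<and> set (w i) \<subseteq> insert j S)) ({..<5} - {j})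
    = of_bool (count_list (w i) j = 1 \<and> set (w i) = {..<5})" .
qed

end

text \<open>A word with fewer than five letters cannot contain five different ones.\<close>

lemma subset_alt_low_degree:
  assumes "homog m f" "m < 5"
  shows "subset_alt (\<lambda>S. f (ind_par S)) {..<5} = 0"
proof -
  obtain N :: nat and a w where w: "\<And>i. i < N \<Longrightarrow> length (w i) = m" "\<And>i. i < N \<Longrightarrow> set (w i) \<subseteq> {..<5}"
    "f = (\<lambda>u. \<Sum>i<N. a i * prod_list (map u (w i)))" using homog_words[OF assms(1)] by blast
  have "set (w i) \<noteq> {..<5}" if "i < N" for i
  proof
    assume "set (w i) = {..<5}"
    thus False using card_length[of "w i"] w(1)[OF that] assms(2) by simp
  qed
  hence "(\<Sum>i<N. a i * of_bool (set (w i) = {..<5})) = 0"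
    by (intro sum.neutral ballI) simp
  moreover have "subset_alt (\<lambda>S. f (ind_par S)) {..<5} = (\<Sum>i<N. a i * of_bool (set (w i) = {..<5}))"
    by (rule subset_alt_word_poly[OF w(3,2)]) auto
  ultimately show ?thesis by (simp only:)
qed

text \<open>A word of length 5 containing all five letters contains each exactly once, in particular
  the letter 0, so the derivative in direction 0 sees it.\<close>

lemma subset_alt_degree_5:
  assumes "homog 5 f"
  shows "subset_alt (\<lambda>S. f (ind_par S)) {..<5} = subset_alt (dir_deriv 0 f) ({..<5} - {0})"
proof -
  obtain N :: nat and a w where w: "\<And>i. i < N \<Longrightarrow> length (w i) = 5" "\<And>i. i < N \<Longrightarrow> set (w i) \<subseteq> {..<5}"
    "f = (\<lambda>u. \<Sum>i<N. a i * prod_list (map u (w i)))" using homog_words[OF assms(1)] by blast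
  have "count_list (w i) 0 = 1" if "i < N" "set (w i) = {..<5}" for i
  proof -
    have s: "(\<Sum>j<5. count_list (w i) j) = 5"
      using sum_count_set[of "w i" "{..<5}"] that w(1)[OF that(1)] by simp
    have p: "count_list (w i) j \<ge> 1" if "j < 5" for j
      using count_list_0_iff[of "w i" j] that \<open>set (w i) = _\<close> by (cases "count_list (w i) j") auto
    have "{..<5} = {0,1,2,3,4::nat}" by auto
    thus ?thesis using s p[of 0] p[of 1] p[of 2] p[of 3] p[of 4] by simp
  qed
  hence "(\<Sum>i<N. a i * of_bool (set (w i) = {..<5})) =
     (\<Sum>i<N. a i * of_bool (count_list (w i) 0 = 1 \<and> set (w i) = {..<5}))"
    by (intro sum.cong) auto
  moreover have "subset_alt (dir_deriv 0 f) ({..<5} - {0}) = 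
      (\<Sum>i<N. a i * of_bool (count_list (w i) 0 = 1 \<and> set (w i) = {..<5}))"
    by (rule subset_alt_dir_deriv_word_poly[OF w(3,2)]) auto
  moreover have "subset_alt (\<lambda>S. f (ind_par S)) {..<5} = (\<Sum>i<N. a i * of_bool (set (w i) = {..<5}))"
    by (rule subset_alt_word_poly[OF w(3,2)]) auto
  ultimately show ?thesis by (simp only:)
qed

text \<open>A word of length 6 containing all five letters repeats exactly one of them. It is
  therefore seen by the derivatives in the four other directions, whence the factor 4.\<close>

lemma subset_alt_degree_6:
  assumes "homog 6 f"
  shows "4 * subset_alt (\<lambda>S. f (ind_par S)) {..<5} = (\<Sum>j<5. subset_alt (dir_deriv j f) ({..<5} - {j}))"
proof -
  obtain N :: nat and a w where w: "\<And>i. i < N \<Longrightarrow> length (w i) = 6" "\<And>i. i < N \<Longrightarrow> set (w i) \<subseteq> {..<5}"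
    "f = (\<lambda>u. \<Sum>i<N. a i * prod_list (map u (w i)))" using homog_words[OF assms(1)] by blast
  have *: "(\<Sum>j<5. of_bool (count_list (w i) j = 1)) = (4 :: complex)" if "i < N" "set (w i) = {..<5}" for i
  proof -
    have s: "(\<Sum>j<5. count_list (w i) j) = 6"
      using sum_count_set[of "w i" "{..<5}"] that w(1)[OF that(1)] by simp
    have p: "count_list (w i) j \<ge> 1" if "j < 5" for j
      using count_list_0_iff[of "w i" j] that \<open>set (w i) = _\<close> by (cases "count_list (w i) j") auto
    have aux: "of_bool (a = 1) + (of_bool (b = 1) + (of_bool (c = 1) + (of_bool (d = 1) + of_bool (e = 1)))) = (4::complex)"
      if "a + (b + (c + (d + e))) = 6" "a \<ge> 1" "b \<ge> 1" "c \<ge> 1" "d \<ge> 1" "e \<ge> 1" for a b c d e :: nat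
    proof -
      \<comment> \<open>All multiplicities are 1 or 2, and on these values the indicator of 1 is the
        linear function 2 - x; the five indicators add up to 10 - 6.\<close>
      have *: "of_bool (x = 1) = 2 - (of_nat x :: complex)" if "x = 1 \<or> x = 2" for x :: nat
        using that by auto
      have "a = 1 \<or> a = 2" "b = 1 \<or> b = 2" "c = 1 \<or> c = 2" "d = 1 \<or> d = 2" "e = 1 \<or> e = 2"
        using that by linarith+
      note this[THEN *]
      hence "of_bool (a = 1) + (of_bool (b = 1) + (of_bool (c = 1) + (of_bool (d = 1) + of_bool (e = 1))))
        = 10 - (of_nat (a + (b + (c + (d + e)))) :: complex)" by (simp only: of_nat_add) simp
      thus ?thesis unfolding that(1) by simp
    qed
    have U: "{..<5} = {0,1,2,3,4::nat}" by auto
    show ?thesis unfolding U using s[unfolded U]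
        aux[OF _ p[of 0] p[of 1] p[of 2] p[of 3] p[of 4]] by (simp del: sum_of_bool_eq)
  qed
  have "(\<Sum>j<5. subset_alt (dir_deriv j f) ({..<5} - {j})) = 
     (\<Sum>j<5. \<Sum>i<N. a i * of_bool (count_list (w i) j = 1 \<and> set (w i) = {..<5}))"
    by (rule sum.cong[OF refl], rule subset_alt_dir_deriv_word_poly[OF w(3,2)]) auto
  also have "\<dots> = (\<Sum>i<N. \<Sum>j<5. a i * of_bool (count_list (w i) j = 1 \<and> set (w i) = {..<5}))"
    by (rule sum.swap)
  also have "\<dots> = (\<Sum>i<N. 4 * (a i * of_bool (set (w i) = {..<5})))"
  proof (rule sum.cong[OF refl])
    fix i assume i: "i \<in> {..<N}"
    show "(\<Sum>j<5. a i * of_bool (count_list (w i) j = 1 \<and> set (w i) = {..<5})) = 4 * (a i * of_bool (set (w i) = {..<5}))"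
    proof (cases "set (w i) = {..<5}")
      case True
      have "(\<Sum>j<5. a i * of_bool (count_list (w i) j = 1)) = a i * 4"
        unfolding sum_distrib_left[symmetric] using *[of i] i True by simp
      thus ?thesis using True by simp
    qed simp
  qed
  also have "\<dots> = 4 * (\<Sum>i<N. a i * of_bool (set (w i) = {..<5}))"
    by (rule sum_distrib_left[symmetric])
  also have "(\<Sum>i<N. a i * of_bool (set (w i) = {..<5})) = subset_alt (\<lambda>S. f (ind_par S)) {..<5}"
    by (rule subset_alt_word_poly[OF w(3,2), symmetric]) auto
  finally show ?thesis by simp
qed

lemma homog_upd_holomorphic:
  assumes "homog m f"
  shows "(\<lambda>d. f (u(j := d))) holomorphic_on A"
proof -
  obtain N :: nat and a w where w: "f = (\<lambda>u. \<Sum>i<N. a i * prod_list (map u (w i :: nat list)))"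
    using homog_words[OF assms(1)] by blast
  have "(\<lambda>d. prod_list (map (u(j := d)) v)) holomorphic_on A" for v
  proof (induction v)
    case (Cons i v)
    have "(\<lambda>d. (u(j := d)) i) holomorphic_on A" by (cases "i = j") (auto intro!: holomorphic_intros)
    thus ?case using Cons by (auto intro!: holomorphic_intros)
  qed simp
  thus ?thesis unfolding w by (intro holomorphic_intros)
qed

section \<open>Taylor series of a single term along a ray\<close>

definition lin_fps :: "complex \<Rightarrow> complex \<Rightarrow> complex fps" where
  "lin_fps c v = fps_const c + fps_const v * fps_X"

text \<open>The Taylor series at \<open>z = 0\<close> of the term at \<open>z * u\<close>, kept as a
  product of linear series and their inverses so that homogeneity, cancellation and derivatives in a
  parameter can be treated factor by factor.\<close>

definition wp_fps :: "(nat \<Rightarrow> complex) \<Rightarrow> nat \<Rightarrow> complex fps" where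
  "wp_fps u n = lin_fps (2 * of_nat n + 2) (wp_par u - u 0) *
     (\<Prod>i\<in>{1..4}. (\<Prod>j<n. lin_fps (of_nat (Suc j)) (wp_par u - u 0 - u i)) *
                    (\<Prod>j<Suc n. inverse (lin_fps (of_nat (Suc j)) (u i))))"

lemma fps_nth_lin_fps: "fps_nth (lin_fps c v) k = (if k = 0 then c else if k = 1 then v else 0)"
  by (simp add: lin_fps_def fps_X_def fps_mult_fps_X_commute)

lemma has_fps_expansion_lin_fps: "(\<lambda>z. c + z * v) has_fps_expansion lin_fps c v"
proof -
  have "(\<lambda>z. c + v * z) has_fps_expansion lin_fps c v"
    unfolding lin_fps_def by (intro fps_expansion_intros)
  thus ?thesis by (simp add: mult_ac)
qed

lemma wp_par_scale: "wp_par (\<lambda>i. z * u i) = z * wp_par u"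
  by (simp add: wp_par_def algebra_simps)

lemma wp_term_scale:
  fixes u :: "nat \<Rightarrow> complex"
  shows "wp_term (\<lambda>i. z * u i) n = (2 * of_nat n + 2 + z * (wp_par u - u 0)) *
     (\<Prod>i\<in>{1..4}. (\<Prod>j<n. of_nat (Suc j) + z * (wp_par u - u 0 - u i)) *
                    (\<Prod>j<Suc n. inverse (of_nat (Suc j) + z * u i)))"
proof -
  have "pochhammer (1 + z * wp_par u - z * u 0 - z * u i) n = (\<Prod>j<n. of_nat (Suc j) + z * (wp_par u - u 0 - u i))" for i
    by (simp add: pochhammer_prod atLeast0LessThan algebra_simps)
  moreover have "inverse (pochhammer (1 + z * u i) (Suc n)) = (\<Prod>j<Suc n. inverse (of_nat (Suc j) + z * u i))" for i
    unfolding pochhammer_prod atLeast0LessThan prod_inversef[symmetric] by (simp add: o_def algebra_simps)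
  ultimately show ?thesis
    unfolding wp_term_def wp_par_scale divide_inverse by (simp only: right_diff_distrib add_diff_eq)
qed

lemma wp_fps_expansion: "(\<lambda>z. wp_term (\<lambda>i. z * u i) n) has_fps_expansion wp_fps u n"
  unfolding wp_term_scale wp_fps_def
  by (intro fps_expansion_intros has_fps_expansion_lin_fps) (simp del: of_nat_Suc add: fps_nth_lin_fps)

subsection \<open>Homogeneity of the Taylor coefficients\<close>

definition homog_fps :: "((nat \<Rightarrow> complex) \<Rightarrow> complex fps) \<Rightarrow> bool" where
  "homog_fps F \<longleftrightarrow> (\<forall>m. homog m (\<lambda>u. fps_nth (F u) m))"

lemma homog_fps_mult: "homog_fps F \<Longrightarrow> homog_fps G \<Longrightarrow> homog_fps (\<lambda>u. F u * G u)"
  unfolding homog_fps_def fps_mult_nth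
proof (intro allI homog_sum)
  fix m i :: nat
  assume "\<forall>m. homog m (\<lambda>u. fps_nth (F u) m)" "\<forall>m. homog m (\<lambda>u. fps_nth (G u) m)" "i \<in> {0..m}"
  thus "homog m (\<lambda>u. fps_nth (F u) i * fps_nth (G u) (m - i))"
    using homog_mult[of i "\<lambda>u. fps_nth (F u) i" "m - i" "\<lambda>u. fps_nth (G u) (m - i)"] by simp
qed auto

lemma homog_fps_lin: "homog 1 v \<Longrightarrow> homog_fps (\<lambda>u. lin_fps c (v u))"
  unfolding homog_fps_def fps_nth_lin_fps
proof
  fix m :: nat assume v: "homog 1 v"
  consider "m = 0" | "m = 1" | "m > 1" by linarith
  thus "homog m (\<lambda>u. if m = 0 then c else if m = 1 then v u else 0)"
    by cases (use v in \<open>auto intro: homog_zero homog_const\<close>)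
qed

text \<open>The geometric series; its coefficient of order \<open>m\<close> is a multiple of the
  \<open>m\<close>-th power of \<open>v\<close>, which is what makes inverses respect the
  grading.\<close>

lemma inverse_lin_fps:
  assumes "c \<noteq> 0"
  shows "inverse (lin_fps c v) = Abs_fps (\<lambda>m. (-1) ^ m * v ^ m / c ^ Suc m)"
proof (rule fps_inverse_unique)
  show "lin_fps c v * Abs_fps (\<lambda>m. (-1) ^ m * v ^ m / c ^ Suc m) = 1"
  proof (rule fps_ext)
    fix m
    show "fps_nth (lin_fps c v * Abs_fps (\<lambda>m. (-1) ^ m * v ^ m / c ^ Suc m)) m = fps_nth 1 m"
      using assms by (cases m) (simp_all add: lin_fps_def ring_distribs mult.assoc)
  qed
qed

lemma homog_fps_inverse_lin:
  assumes "homog 1 v" "c \<noteq> 0"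
  shows "homog_fps (\<lambda>u. inverse (lin_fps c (v u)))"
  unfolding homog_fps_def inverse_lin_fps[OF assms(2)] fps_nth_Abs_fps
proof
  fix m
  have "homog m (\<lambda>u. ((-1) ^ m / c ^ Suc m) * v u ^ m)" by (intro homog_cmult homog_power assms)
  thus "homog m (\<lambda>u. (-1) ^ m * v u ^ m / c ^ Suc m)" by simp
qed

lemma homog_fps_prod: "finite A \<Longrightarrow> (\<And>i. i \<in> A \<Longrightarrow> homog_fps (F i)) \<Longrightarrow> homog_fps (\<lambda>u. \<Prod>i\<in>A. F i u)"
proof (induction rule: finite_induct)
  case empty
  have "homog m (\<lambda>u. fps_nth 1 m)" for m
    by (cases m) (auto intro: homog_const homog_zero)
  thus ?case by (simp add: homog_fps_def)
qed (auto intro: homog_fps_mult)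

lemma wp_fps_homog: "homog m (\<lambda>u. fps_nth (wp_fps u n) m)"
proof -
  have par: "homog 1 wp_par"
  proof -
    have "homog 1 (\<lambda>u. (1/2) * (u 0 + u 1 + u 2 + u 3 + u 4))"
      by (intro homog_cmult homog_add homog_1_var) auto
    thus ?thesis by (simp add: wp_par_def[abs_def])
  qed
  have "homog_fps (\<lambda>u. wp_fps u n)"
    unfolding wp_fps_def
    by (intro homog_fps_mult homog_fps_prod homog_fps_lin homog_fps_inverse_lin homog_diff par homog_1_var)
       (auto simp del: of_nat_Suc)
  thus ?thesis by (simp add: homog_fps_def)
qed

subsection \<open>Taylor coefficients of the sum\<close>

definition wp_coeff :: "(nat \<Rightarrow> complex) \<Rightarrow> nat \<Rightarrow> complex" where
  "wp_coeff u m = fps_nth (fps_expansion (\<lambda>z. \<Sum>n. wp_term (\<lambda>i. z * u i) n) 0) m"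

definition unit_par :: "(nat \<Rightarrow> complex) \<Rightarrow> bool" where
  "unit_par u \<longleftrightarrow> (\<forall>i<5. norm (u i) \<le> 1)"

lemma unit_par_small:
  assumes "unit_par u" "z \<in> ball 0 (1/50)"
  shows "small_par (\<lambda>i. z * u i)"
  unfolding small_par_def norm_mult
proof (intro allI impI)
  fix i :: nat assume "i < 5"
  thus "norm z * norm (u i) \<le> 1 / 50"
    using mult_mono[of "norm z" "1/50" "norm (u i)" 1] assms by (simp add: unit_par_def)
qed

lemma wp_term_holomorphic:
  assumes "unit_par u"
  shows "(\<lambda>z. wp_term (\<lambda>i. z * u i) n) holomorphic_on ball 0 (1/50)"
  unfolding wp_term_scale
proof (intro holomorphic_intros)
  fix z i j assume "z \<in> ball (0::complex) (1/50)" "i \<in> {1..4::nat}"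
  thus "of_nat (Suc j) + z * u i \<noteq> 0"
    by (intro small_par_add_nz[OF unit_par_small[OF assms]]) simp_all
qed

lemma wp_term_bound_unit:
  "unit_par u \<Longrightarrow> z \<in> ball 0 (1/50) \<Longrightarrow> norm (wp_term (\<lambda>i. z * u i) n) \<le> 6 / (real n + 1) ^ 2"
  by (rule wp_term_bound[OF unit_par_small])

lemma fps_nth_wp_fps: "fps_nth (wp_fps u n) m = (deriv ^^ m) (\<lambda>z. wp_term (\<lambda>i. z * u i) n) 0 / fact m"
  by (subst fps_expansion_eqI[OF wp_fps_expansion[of u n], symmetric]) (simp add: fps_expansion_def)

lemma wp_coeff_sums:
  assumes "unit_par u"
  shows "(\<lambda>n. fps_nth (wp_fps u n) m) sums wp_coeff u m"
proof -
  have "(\<lambda>n. (deriv ^^ m) (\<lambda>z. wp_term (\<lambda>i. z * u i) n) 0) sums (deriv ^^ m) (\<lambda>z. \<Sum>n. wp_term (\<lambda>i. z * u i) n) 0"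
    by (rule higher_deriv_series[OF _ wp_term_holomorphic[OF assms] wp_term_bound_unit[OF assms] summable_inverse_squares_real])
       simp_all
  from sums_divide[OF this, of "fact m"] show ?thesis
    by (simp add: fps_nth_wp_fps wp_coeff_def fps_expansion_def)
qed

lemma wp_sum_holomorphic:
  assumes "unit_par u"
  shows "(\<lambda>z. \<Sum>n. wp_term (\<lambda>i. z * u i) n) holomorphic_on ball 0 (1/50)"
  by (rule holomorphic_series_holomorphic[OF _ wp_term_holomorphic[OF assms] wp_term_bound_unit[OF assms] summable_inverse_squares_real])
     simp_all

lemma wp_sum_fps_expansion:
  assumes "unit_par u"
  shows "(\<lambda>z. \<Sum>n. wp_term (\<lambda>i. z * u i) n) has_fps_expansion Abs_fps (wp_coeff u)"
proof -
  have "(\<lambda>z. \<Sum>n. wp_term (\<lambda>i. z * u i) n) has_fps_expansion fps_expansion (\<lambda>z. \<Sum>n. wp_term (\<lambda>i. z * u i) n) 0"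
    by (rule has_fps_expansion_fps_expansion[OF open_ball _ wp_sum_holomorphic[OF assms]]) auto
  moreover have "fps_expansion (\<lambda>z. \<Sum>n. wp_term (\<lambda>i. z * u i) n) 0 = Abs_fps (wp_coeff u)"
    by (rule fps_ext) (simp add: wp_coeff_def)
  ultimately show ?thesis by simp
qed

text \<open>Cauchy's inequality on the circle of radius 1/100. The bound is uniform over the unit
  polydisc, so the series of coefficients also converges normally in \<open>u\<close> and may be
  differentiated in a parameter.\<close>

lemma wp_fps_coeff_bound:
  assumes "unit_par u"
  shows "norm (fps_nth (wp_fps u n) m) \<le> 6 * 100 ^ m / (real n + 1) ^ 2"
proof -
  have sub: "cball 0 (1/100) \<subseteq> ball (0::complex) (1/50)" by auto
  have "norm ((deriv ^^ m) (\<lambda>z. wp_term (\<lambda>i. z * u i) n) 0) \<le> fact m * (6 / (real n + 1) ^ 2) / (1/100) ^ m"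
  proof (rule Cauchy_inequality)
    show "(\<lambda>z. wp_term (\<lambda>i. z * u i) n) holomorphic_on ball 0 (1/100)"
      by (rule holomorphic_on_subset[OF wp_term_holomorphic[OF assms]]) auto
    show "continuous_on (cball 0 (1/100)) (\<lambda>z. wp_term (\<lambda>i. z * u i) n)"
      by (rule holomorphic_on_imp_continuous_on, rule holomorphic_on_subset[OF wp_term_holomorphic[OF assms] sub])
    show "norm (wp_term (\<lambda>i. x * u i) n) \<le> 6 / (real n + 1) ^ 2" if "norm (0 - x) = 1/100" for x
      by (rule wp_term_bound_unit[OF assms]) (use that in auto)
  qed auto
  thus ?thesis unfolding fps_nth_wp_fps norm_divide by (simp add: field_simps)
qed

lemma dir_deriv_sums:
  assumes "j < 5"
  shows "(\<lambda>n. dir_deriv j (\<lambda>u. fps_nth (wp_fps u n) m) S) sums dir_deriv j (\<lambda>u. wp_coeff u m) S"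
proof -
  have unit: "unit_par ((ind_par S)(j := d))" if "d \<in> ball 0 1" for d
    using that by (auto simp: unit_par_def ind_par_def)
  have "(\<lambda>n. (deriv ^^ 1) (\<lambda>d. fps_nth (wp_fps ((ind_par S)(j := d)) n) m) 0) sums
     (deriv ^^ 1) (\<lambda>d. \<Sum>n. fps_nth (wp_fps ((ind_par S)(j := d)) n) m) 0"
    by (rule higher_deriv_series[where r = 1, OF _ _ wp_fps_coeff_bound[OF unit] summable_inverse_squares_real])
       (auto intro!: homog_upd_holomorphic wp_fps_homog)
  moreover have "deriv (\<lambda>d. \<Sum>n. fps_nth (wp_fps ((ind_par S)(j := d)) n) m) 0 = deriv (\<lambda>d. wp_coeff ((ind_par S)(j := d)) m) 0"
  proof (rule deriv_cong_ev)
    have "eventually (\<lambda>d. d \<in> ball (0::complex) 1) (nhds 0)" by (intro eventually_nhds_in_open) auto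
    thus "\<forall>\<^sub>F d in nhds 0. (\<Sum>n. fps_nth (wp_fps ((ind_par S)(j := d)) n) m) = wp_coeff ((ind_par S)(j := d)) m"
      by eventually_elim (metis sums_unique unit wp_coeff_sums)
  qed auto
  ultimately show ?thesis by (simp add: dir_deriv_def)
qed

lemma subset_alt_sums: "(\<And>S. (\<lambda>n. F n S) sums G S) \<Longrightarrow> (\<lambda>n. subset_alt (F n) U) sums subset_alt G U"
  unfolding subset_alt_def by (intro sums_sum sums_mult)

lemma unit_ind_par: "unit_par (ind_par S)"
  by (auto simp: unit_par_def ind_par_def)

text \<open>The alternating sum vanishes for the polynomial coming from each single term, and being
  a finite combination of values it commutes with the summation over \<open>n\<close>.\<close>

lemma wp_coeff_low_degree:
  assumes "m < 5"
  shows "subset_alt (\<lambda>S. wp_coeff (ind_par S) m) {..<5} = 0"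
proof -
  have "(\<lambda>n. subset_alt (\<lambda>S. fps_nth (wp_fps (ind_par S) n) m) {..<5}) sums 
    subset_alt (\<lambda>S. wp_coeff (ind_par S) m) {..<5}"
    by (intro subset_alt_sums wp_coeff_sums unit_ind_par)
  thus ?thesis
    unfolding subset_alt_low_degree[OF wp_fps_homog assms] using sums_zero sums_unique2 by blast
qed

lemma wp_coeff_degree_5:
  "subset_alt (\<lambda>S. wp_coeff (ind_par S) 5) {..<5} = subset_alt (dir_deriv 0 (\<lambda>u. wp_coeff u 5)) ({..<5} - {0})"
proof -
  have "(\<lambda>n. subset_alt (\<lambda>S. fps_nth (wp_fps (ind_par S) n) 5) {..<5}) sums 
    subset_alt (\<lambda>S. wp_coeff (ind_par S) 5) {..<5}"
    by (intro subset_alt_sums wp_coeff_sums unit_ind_par)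
  moreover have "(\<lambda>n. subset_alt (dir_deriv 0 (\<lambda>u. fps_nth (wp_fps u n) 5)) ({..<5} - {0})) sums 
    subset_alt (dir_deriv 0 (\<lambda>u. wp_coeff u 5)) ({..<5} - {0})"
    by (intro subset_alt_sums dir_deriv_sums) auto
  ultimately show ?thesis
    unfolding subset_alt_degree_5[OF wp_fps_homog] by (rule sums_unique2)
qed

lemma wp_coeff_degree_6:
  "4 * subset_alt (\<lambda>S. wp_coeff (ind_par S) 6) {..<5} = (\<Sum>j<5. subset_alt (dir_deriv j (\<lambda>u. wp_coeff u 6)) ({..<5} - {j}))"
proof -
  have "(\<lambda>n. 4 * subset_alt (\<lambda>S. fps_nth (wp_fps (ind_par S) n) 6) {..<5}) sums 
    (4 * subset_alt (\<lambda>S. wp_coeff (ind_par S) 6) {..<5})"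
    by (intro sums_mult subset_alt_sums wp_coeff_sums unit_ind_par)
  moreover have "(\<lambda>n. \<Sum>j<5. subset_alt (dir_deriv j (\<lambda>u. fps_nth (wp_fps u n) 6)) ({..<5} - {j})) sums 
    (\<Sum>j<5. subset_alt (dir_deriv j (\<lambda>u. wp_coeff u 6)) ({..<5} - {j}))"
    by (intro sums_sum subset_alt_sums dir_deriv_sums) auto
  ultimately show ?thesis
    unfolding subset_alt_degree_6[OF wp_fps_homog] by (rule sums_unique2)
qed

subsection \<open>Symmetry\<close>

lemma wp_coeff_swap01:
  assumes "unit_par u"
  shows "wp_coeff (swap01 u) m = wp_coeff u m"
proof -
  have unit: "unit_par (swap01 u)" using assms by (auto simp: unit_par_def swap01_def)
  have "\<forall>\<^sub>F z in nhds 0. (\<Sum>n. wp_term (\<lambda>i. z * u i) n) = (\<Sum>n. wp_term (\<lambda>i. z * swap01 u i) n)"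
  proof -
    have "eventually (\<lambda>z. z \<in> ball (0::complex) (1/50)) (nhds 0)" by (intro eventually_nhds_in_open) auto
    thus ?thesis
    proof eventually_elim
      case (elim z)
      have "(\<lambda>i. z * swap01 u i) = swap01 (\<lambda>i. z * u i)" by (auto simp: swap01_def)
      thus ?case using wp_sum_swap[OF unit_par_small[OF assms elim]] by simp
    qed
  qed
  thus ?thesis unfolding wp_coeff_def fps_expansion_def by (simp add: higher_deriv_cong_ev[OF _ refl])
qed

text \<open>The indices 1 to 4 enter the terms only through a sum and a product, so here already the
  single terms agree.\<close>

lemma wp_coeff_transpose_aux:
  assumes "a \<in> {1..4}" "b \<in> {1..4}"
  shows "wp_coeff (u \<circ> Transposition.transpose a b) m = wp_coeff u m"
proof -
  define p where "p = Transposition.transpose a b"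
  have p: "p permutes {1..4}" unfolding p_def using assms by (rule permutes_swap_id)
  have p0: "p 0 = 0" using p by (rule permutes_not_in) simp
  have *: "wp_par u = (u 0 + (\<Sum>i\<in>{1..4}. u i)) / 2" for u :: "nat \<Rightarrow> complex"
  proof -
    have "{1..4} = {1,2,3,4::nat}" by auto
    thus ?thesis by (simp add: wp_par_def)
  qed
  have "(\<Sum>i\<in>{1..4}. (u \<circ> p) i) = (\<Sum>i\<in>{1..4}. u i)"
    using sum.permute[OF p, of u] by (simp only: o_def)
  hence par: "wp_par (u \<circ> p) = wp_par u"
    unfolding * o_apply p0 by (simp only:)
  have "wp_term (\<lambda>i. z * (u \<circ> p) i) n = wp_term (\<lambda>i. z * u i) n" for z n
    unfolding wp_term_def wp_par_scale par o_apply p0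
    using prod.permute[OF p, of "\<lambda>i. pochhammer (1 + z * wp_par u - z * u 0 - z * u i) n / pochhammer (1 + z * u i) (Suc n)"]
    by (simp only: o_def par[unfolded o_def])
  thus ?thesis by (simp only: wp_coeff_def p_def)
qed

lemma unit_par_comp: "unit_par u \<Longrightarrow> p permutes {..<5} \<Longrightarrow> unit_par (u \<circ> p)"
  using permutes_in_image[of p "{..<5}"] by (auto simp: unit_par_def)

text \<open>The one nontrivial case is a transposition of 0 with some \<open>c\<close>; it is the
  conjugate of the transposition of 0 and 1, supplied by \<open>wp_sum_swap\<close>, under the
  transposition of 1 and \<open>c\<close>.\<close>

lemma wp_coeff_transpose:
  assumes "unit_par u" "a < 5" "b < 5"
  shows "wp_coeff (u \<circ> Transposition.transpose a b) m = wp_coeff u m"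
proof -
  have 01: "wp_coeff (u \<circ> Transposition.transpose 0 1) m = wp_coeff u m" if "unit_par u" for u
  proof -
    have "u \<circ> Transposition.transpose 0 1 = swap01 u" by (auto simp: swap01_def Transposition.transpose_def fun_eq_iff)
    thus ?thesis using wp_coeff_swap01[OF that] by simp
  qed
  have 0: "wp_coeff (u \<circ> Transposition.transpose 0 c) m = wp_coeff u m" if c: "c \<in> {1..4}" and u: "unit_par u" for u c
  proof (cases "c = 1")
    case False
    have "Transposition.transpose 0 c = Transposition.transpose 1 c \<circ> Transposition.transpose 0 1 \<circ> Transposition.transpose 1 c"
      using False c by (auto simp: Transposition.transpose_def fun_eq_iff)
    moreover have "wp_coeff (u \<circ> Transposition.transpose 1 c \<circ> Transposition.transpose 0 1 \<circ> Transposition.transpose 1 c) m = wp_coeff u m"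
    proof -
      have u': "unit_par (u \<circ> Transposition.transpose 1 c)"
        using c by (intro unit_par_comp[OF u] permutes_swap_id) auto
      have 1: "1 \<in> {1..4::nat}" by simp
      show ?thesis unfolding wp_coeff_transpose_aux[OF 1 c] 01[OF u'] ..
    qed
    ultimately show ?thesis by (simp add: o_assoc)
  qed (use 01[OF u] in simp)
  consider "a = b" | "a = 0" "b \<in> {1..4}" | "b = 0" "a \<in> {1..4}" | "a \<in> {1..4}" "b \<in> {1..4}"
    using assms(2,3) by force
  thus ?thesis
  proof cases
    case 2 thus ?thesis using 0[OF 2(2) assms(1)] by simp
  next
    case 3 thus ?thesis using 0[OF 3(2) assms(1)] by (simp add: Transposition.transpose_commute)
  next
    case 4 thus ?thesis by (rule wp_coeff_transpose_aux)
  qed simp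
qed

lemma wp_coeff_permutes:
  assumes "p permutes {..<5}" "unit_par u"
  shows "wp_coeff (u \<circ> p) m = wp_coeff u m"
proof -
  have "finite {..<5::nat}" by simp
  from assms(1) this show ?thesis using assms(2)
  proof (induction arbitrary: u rule: permutes_induct)
    case (swap a b p)
    have "wp_coeff (u \<circ> (Transposition.transpose a b \<circ> p)) m = wp_coeff ((u \<circ> Transposition.transpose a b) \<circ> p) m" by (simp add: o_assoc)
    also have "\<dots> = wp_coeff (u \<circ> Transposition.transpose a b) m"
      using swap by (intro swap.IH unit_par_comp permutes_swap_id) auto
    also have "\<dots> = wp_coeff u m" using swap by (intro wp_coeff_transpose) auto
    finally show ?case .
  qed auto
qed

lemma exists_permutation_between:
  assumes "finite U" "S \<subseteq> U" "T \<subseteq> U" "card S = card T"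
  obtains p where "p permutes U" "\<And>x. p x \<in> T \<longleftrightarrow> x \<in> S"
proof -
  have fin: "finite S" "finite T" using assms finite_subset by auto
  obtain f where f: "bij_betw f S T" using finite_same_card_bij[OF fin assms(4)] by blast
  have "card (U - S) = card (U - T)" using assms fin by (simp add: card_Diff_subset)
  then obtain g where g: "bij_betw g (U - S) (U - T)"
    using finite_same_card_bij[of "U - S" "U - T"] assms(1) by auto
  define p where "p = (\<lambda>x. if x \<in> S then f x else if x \<in> U then g x else x)"
  have 1: "bij_betw p S T" using f by (subst bij_betw_cong[of S p f]) (auto simp: p_def)
  have 2: "bij_betw p (U - S) (U - T)" using g by (subst bij_betw_cong[of _ p g]) (auto simp: p_def)
  have "bij_betw p (S \<union> (U - S)) (T \<union> (U - T))" by (rule bij_betw_combine[OF 1 2]) auto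
  moreover have "S \<union> (U - S) = U" "T \<union> (U - T) = U" using assms by auto
  ultimately have "bij_betw p U U" by simp
  hence p: "p permutes U" by (rule bij_imp_permutes) (use assms in \<open>auto simp: p_def\<close>)
  have "p x \<in> T \<longleftrightarrow> x \<in> S" for x
  proof (cases "x \<in> U")
    case True
    thus ?thesis using bij_betwE[OF 1] bij_betwE[OF 2] assms by blast
  next
    case False
    thus ?thesis using assms by (auto simp: p_def)
  qed
  thus ?thesis using that[OF p] by blast
qed

lemma wp_coeff_ind_par_card:
  assumes "S \<subseteq> {..<5}" "T \<subseteq> {..<5}" "card S = card T"
  shows "wp_coeff (ind_par S) m = wp_coeff (ind_par T) m"
proof -
  obtain p where p: "p permutes {..<5}" "\<And>x. p x \<in> T \<longleftrightarrow> x \<in> S"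
    using exists_permutation_between[OF _ assms] by auto
  have "ind_par S = ind_par T \<circ> p" by (auto simp: ind_par_def p(2))
  thus ?thesis using wp_coeff_permutes[OF p(1) unit_ind_par] by simp
qed

text \<open>A permutation taking \<open>j\<close> to \<open>k\<close> and \<open>S\<close> to
  \<open>T\<close> identifies the two curves in parameter space. It is the transposition of
  \<open>j\<close> and \<open>k\<close> followed by a permutation that fixes
  \<open>k\<close>.\<close>

lemma dir_deriv_wp_coeff_card:
  assumes "S \<subseteq> {..<5} - {j}" "T \<subseteq> {..<5} - {k}" "card S = card T" "j < 5" "k < 5"
  shows "dir_deriv j (\<lambda>u. wp_coeff u m) S = dir_deriv k (\<lambda>u. wp_coeff u m) T"
proof -
  define t where "t = Transposition.transpose j k"
  have t: "t permutes {..<5}" unfolding t_def by (rule permutes_swap_id) (use assms in auto)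
  have tt: "t (t x) = x" "t j = k" "t k = j" for x by (simp_all add: t_def)
  have tS: "t ` S \<subseteq> {..<5} - {k}"
  proof
    fix y assume "y \<in> t ` S"
    then obtain x where x: "x \<in> S" "y = t x" by auto
    have "y \<noteq> k" using x assms(1) tt(1)[of x] tt(3) by auto
    moreover have "y < 5" using x assms(1) permutes_in_image[OF t, of x] by auto
    ultimately show "y \<in> {..<5} - {k}" by simp
  qed
  have cS: "card (t ` S) = card T"
    using assms(3) by (subst card_image) (auto simp: inj_on_def intro: permutes_inj[OF t, THEN injD])
  have fin: "finite ({..<5} - {k})" by simp
  obtain p where p: "p permutes {..<5} - {k}" "\<And>x. p x \<in> T \<longleftrightarrow> x \<in> t ` S"
    by (rule exists_permutation_between[OF fin tS assms(2) cS]) blast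
  have pk: "p k = k" using p(1) by (rule permutes_not_in) simp
  have p5: "p permutes {..<5}" using p(1) by (rule permutes_subset) auto
  have pt: "p \<circ> t permutes {..<5}" using t p5 by (rule permutes_compose)
  have "(ind_par S)(j := d) = (ind_par T)(k := d) \<circ> (p \<circ> t)" for d
  proof
    fix x
    have "p (t x) \<in> T \<longleftrightarrow> x \<in> S" using p(2)[of "t x"] tt(1) by (metis image_iff)
    moreover have "p (t x) = k \<longleftrightarrow> x = j"
      using pk tt(1,2,3) permutes_inj[OF p5] by (metis injD)
    ultimately show "((ind_par S)(j := d)) x = ((ind_par T)(k := d) \<circ> (p \<circ> t)) x"
      by (simp add: ind_par_def)
  qed
  moreover have "wp_coeff ((ind_par T)(k := d) \<circ> (p \<circ> t)) m = wp_coeff ((ind_par T)(k := d)) m" if "norm d < 1" for d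
    by (rule wp_coeff_permutes[OF pt]) (use that in \<open>auto simp: unit_par_def ind_par_def\<close>)
  ultimately have eq: "wp_coeff ((ind_par S)(j := d)) m = wp_coeff ((ind_par T)(k := d)) m" if "norm d < 1" for d
    using that by simp
  have "eventually (\<lambda>d. d \<in> ball (0::complex) 1) (nhds 0)" by (intro eventually_nhds_in_open) auto
  hence "\<forall>\<^sub>F d in nhds 0. wp_coeff ((ind_par S)(j := d)) m = wp_coeff ((ind_par T)(k := d)) m"
    by eventually_elim (simp add: eq)
  thus ?thesis unfolding dir_deriv_def by (rule deriv_cong_ev) simp
qed

section \<open>Coefficients depending only on the number of ones\<close>

lemma subset_alt_card:
  assumes "finite U" "\<And>S. S \<subseteq> U \<Longrightarrow> F S = g (card S)"
  shows "subset_alt F U = (\<Sum>k\<le>card U. (-1) ^ (card U - k) * of_nat (card U choose k) * g k)"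
proof -
  have "subset_alt F U = (\<Sum>S\<in>Pow U. (-1) ^ (card U - card S) * g (card S))"
    unfolding subset_alt_def using assms by (intro sum.cong) (auto simp: card_Diff_subset finite_subset)
  also have "\<dots> = (\<Sum>k\<le>card U. \<Sum>S\<in>{S\<in>Pow U. card S = k}. (-1) ^ (card U - card S) * g (card S))"
    by (rule sum.group[symmetric]) (use assms in \<open>auto intro: card_mono\<close>)
  also have "\<dots> = (\<Sum>k\<le>card U. of_nat (card {S. S \<subseteq> U \<and> card S = k}) * ((-1) ^ (card U - k) * g k))"
    by (intro sum.cong refl) simp
  also have "\<dots> = (\<Sum>k\<le>card U. (-1) ^ (card U - k) * of_nat (card U choose k) * g k)"
    by (intro sum.cong refl) (simp add: n_subsets[OF assms(1)])
  finally show ?thesis .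
qed

definition face_coeff :: "nat \<Rightarrow> nat \<Rightarrow> complex" where
  "face_coeff m k = wp_coeff (ind_par {..<k}) m"

text \<open>The derivative in a vanishing direction when \<open>k\<close> of the other four
  parameters are 1. It has this meaning for \<open>k\<close> at most 4, where 4 is not among the
  ones.\<close>

definition edge_coeff :: "nat \<Rightarrow> nat \<Rightarrow> complex" where
  "edge_coeff m k = dir_deriv 4 (\<lambda>u. wp_coeff u m) {..<k}"

lemma face_coeff_eq: "S \<subseteq> {..<5} \<Longrightarrow> wp_coeff (ind_par S) m = face_coeff m (card S)"
  unfolding face_coeff_def using card_mono[of "{..<5::nat}" S]
  by (intro wp_coeff_ind_par_card) auto

lemma edge_coeff_eq: "j < 5 \<Longrightarrow> S \<subseteq> {..<5} - {j} \<Longrightarrow> dir_deriv j (\<lambda>u. wp_coeff u m) S = edge_coeff m (card S)"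
  unfolding edge_coeff_def using card_mono[of "{..<5::nat} - {j}" S]
  by (intro dir_deriv_wp_coeff_card) auto

lemma sum_atMost_4_5:
  "(\<Sum>k\<le>5. h k) = h 0 + h 1 + h 2 + h 3 + h 4 + (h (5::nat) :: complex)"
  "(\<Sum>k\<le>4. h k) = h 0 + h 1 + h 2 + h 3 + (h (4::nat) :: complex)"
  by (simp_all add: numeral_eq_Suc)

lemma face_sum:
  "subset_alt (\<lambda>S. wp_coeff (ind_par S) m) {..<5} = face_coeff m 5 - 5 * face_coeff m 4 + 10 * face_coeff m 3
     - 10 * face_coeff m 2 + 5 * face_coeff m 1 - face_coeff m 0"
  by (subst subset_alt_card[where g = "face_coeff m"])
     (auto simp: face_coeff_eq sum_atMost_4_5 binomial_eq_0 numeral_eq_Suc algebra_simps)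

lemma edge_sum:
  assumes "j < 5"
  shows "subset_alt (dir_deriv j (\<lambda>u. wp_coeff u m)) ({..<5} - {j}) = edge_coeff m 4 - 4 * edge_coeff m 3
     + 6 * edge_coeff m 2 - 4 * edge_coeff m 1 + edge_coeff m 0"
proof -
  have c: "card ({..<5} - {j}) = 4" using assms by simp
  show ?thesis
    by (subst subset_alt_card[where g = "edge_coeff m"])
       (use assms in \<open>auto simp: c edge_coeff_eq sum_atMost_4_5 numeral_eq_Suc\<close>)
qed

theorem top_coeff_low:
  "m < 5 \<Longrightarrow> face_coeff m 5 = 5 * face_coeff m 4 - 10 * face_coeff m 3
     + 10 * face_coeff m 2 - 5 * face_coeff m 1 + face_coeff m 0"
  using wp_coeff_low_degree[of m] unfolding face_sum by (simp add: algebra_simps)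

theorem top_coeff_5:
  "face_coeff 5 5 = 5 * face_coeff 5 4 - 10 * face_coeff 5 3
     + 10 * face_coeff 5 2 - 5 * face_coeff 5 1 + face_coeff 5 0 +
     (edge_coeff 5 4 - 4 * edge_coeff 5 3 + 6 * edge_coeff 5 2 - 4 * edge_coeff 5 1 + edge_coeff 5 0)"
  using wp_coeff_degree_5 unfolding face_sum edge_sum[of 0 5, simplified] by (simp add: algebra_simps)

text \<open>By symmetry the five directions contribute equally, while every full monomial is counted
  four times; hence 5/4.\<close>

theorem top_coeff_6:
  "face_coeff 6 5 = 5 * face_coeff 6 4 - 10 * face_coeff 6 3
     + 10 * face_coeff 6 2 - 5 * face_coeff 6 1 + face_coeff 6 0 +
     5 / 4 * (edge_coeff 6 4 - 4 * edge_coeff 6 3 + 6 * edge_coeff 6 2 - 4 * edge_coeff 6 1 + edge_coeff 6 0)"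
proof -
  define E where "E = edge_coeff 6 4 - 4 * edge_coeff 6 3 + 6 * edge_coeff 6 2 - 4 * edge_coeff 6 1 + edge_coeff 6 0"
  have "(\<Sum>j<5. subset_alt (dir_deriv j (\<lambda>u. wp_coeff u 6)) ({..<5} - {j})) = 5 * E"
    by (simp add: edge_sum E_def)
  hence "4 * (face_coeff 6 5 - 5 * face_coeff 6 4 + 10 * face_coeff 6 3
     - 10 * face_coeff 6 2 + 5 * face_coeff 6 1 - face_coeff 6 0) = 5 * E"
    using wp_coeff_degree_6 unfolding face_sum by simp
  thus ?thesis unfolding E_def[symmetric] by (simp add: field_simps)
qed

subsection \<open>Telescoping on the face\<close>

text \<open>Half the difference of the third elementary symmetric functions of the
  \<open>A - u i\<close> and of the \<open>u i\<close>. It is zero if 0, 2 or 4 of the parameters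
  are 1 and the others 0, and equals -1/8 and 1/8 for one and three ones.\<close>

definition tele_const :: "(nat \<Rightarrow> complex) \<Rightarrow> complex" where
  "tele_const u = (let a = u 1; b = u 2; c = u 3; d = u 4; A = (a + b + c + d) / 2 in
     ((A-a)*(A-b)*(A-c) + (A-a)*(A-b)*(A-d) + (A-a)*(A-c)*(A-d) + (A-b)*(A-c)*(A-d)
       - (a*b*c + a*b*d + a*c*d + b*c*d)) / 2)"

definition tele_prod :: "(nat \<Rightarrow> complex) \<Rightarrow> nat \<Rightarrow> complex" where
  "tele_prod u n = (\<Prod>i\<in>{1..4}. pochhammer (1 + wp_par u - u i) n / pochhammer (1 + u i) n)"

text \<open>The reflection of \<open>N\<close> to \<open>- A - N\<close> exchanges the two products.
  Their difference is thus odd about \<open>- A / 2\<close>; its terms of degree 4 and 3 cancel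
  because the four parameters add up to \<open>2 * A\<close>, so oddness leaves a multiple of
  \<open>2 * N + A\<close>. The multiple is half the coefficient of \<open>N\<close>.\<close>

lemma tele_identity:
  fixes a b c d N A :: complex
  assumes "A = (a + b + c + d) / 2"
  shows "(N + A - a) * (N + A - b) * (N + A - c) * (N + A - d) - (N + a) * (N + b) * (N + c) * (N + d)
    = (2 * N + A) * (((A-a)*(A-b)*(A-c) + (A-a)*(A-b)*(A-d) + (A-a)*(A-c)*(A-d) + (A-b)*(A-c)*(A-d)
       - (a*b*c + a*b*d + a*c*d + b*c*d)) / 2)"
proof -
  have d: "d = 2 * A - a - b - c" using assms by (simp add: field_simps)
  show ?thesis unfolding d by (simp add: field_simps)
qed

text \<open>For \<open>u 0 = 0\<close> the numerators of the term lag one step behind those of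
  \<open>tele_prod\<close>, so consecutive products differ by the two quartic products of
  \<open>tele_identity\<close> over a common denominator.\<close>

lemma tele_step:
  assumes "small_par u" "u 0 = 0"
  shows "tele_prod u (Suc n) - tele_prod u n = tele_const u * wp_term u n"
proof -
  define N where "N = (of_nat (Suc n) :: complex)"
  define X where "X = (\<lambda>i. pochhammer (1 + wp_par u - u i) n)"
  define Y where "Y = (\<lambda>i. pochhammer (1 + u i) n)"
  have nz: "N + u i \<noteq> 0" if "i < 5" for i
    using small_par_add_nz[OF assms(1) that, of n] by (simp add: N_def)
  have s: "pochhammer (1 + wp_par u - u i) (Suc n) = X i * (N + wp_par u - u i)"
    "pochhammer (1 + u i) (Suc n) = Y i * (N + u i)" for i
    by (simp_all add: pochhammer_Suc X_def Y_def N_def add_ac diff_add_eq)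
  have X': "X i = pochhammer (1 + wp_par u - u i) n" for i by (simp add: X_def)
  have N2: "2 * of_nat n + 2 + wp_par u = 2 * N + wp_par u" by (simp add: N_def)
  define P where "P = (\<Prod>i\<in>{1..4}. X i / Y i)"
  define D where "D = (N + u 1) * (N + u 2) * (N + u 3) * (N + u 4)"
  have D: "D \<noteq> 0" using nz by (simp add: D_def)
  have "tele_prod u n = P" by (simp add: tele_prod_def P_def X_def Y_def)
  moreover have "tele_prod u (Suc n) = P * ((N + wp_par u - u 1) * (N + wp_par u - u 2) * (N + wp_par u - u 3) * (N + wp_par u - u 4)) / D"
    unfolding tele_prod_def s P_def prod_1_4 D_def by (simp add: mult_ac)
  moreover have "wp_term u n = P * (2 * N + wp_par u) / D"
    unfolding wp_term_def assms(2) diff_zero s unfolding X'[symmetric] P_def prod_1_4 D_def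
    by (simp only: N2) (simp add: mult_ac)
  moreover have "(N + wp_par u - u 1) * (N + wp_par u - u 2) * (N + wp_par u - u 3) * (N + wp_par u - u 4) - D
     = (2 * N + wp_par u) * tele_const u"
  proof -
    have A: "wp_par u = (u 1 + u 2 + u 3 + u 4) / 2" using assms(2) by (simp add: wp_par_def)
    have TC: "tele_const u = (((wp_par u-u 1)*(wp_par u-u 2)*(wp_par u-u 3) + (wp_par u-u 1)*(wp_par u-u 2)*(wp_par u-u 4)
       + (wp_par u-u 1)*(wp_par u-u 3)*(wp_par u-u 4) + (wp_par u-u 2)*(wp_par u-u 3)*(wp_par u-u 4)
       - (u 1*u 2*u 3 + u 1*u 2*u 4 + u 1*u 3*u 4 + u 2*u 3*u 4)) / 2)"
      by (simp only: tele_const_def Let_def A)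
    show ?thesis unfolding D_def TC by (rule tele_identity[OF A])
  qed
  moreover have "P * M / D - P = k * (P * L / D)" if "M - D = L * k" for M L k :: complex
  proof -
    have "M = D + L * k" using that by (simp add: algebra_simps)
    thus ?thesis using D by (simp add: field_simps)
  qed
  ultimately show ?thesis by (simp only:)
qed

text \<open>Each quotient behaves like a power of \<open>n\<close> with exponent
  \<open>wp_par u - 2 * u i\<close>. For \<open>u 0 = 0\<close> these exponents add up to 0, and
  only Gamma values remain.\<close>

lemma tele_prod_limit:
  assumes "small_par u" "u 0 = 0"
  shows "tele_prod u \<longlonglongrightarrow> (\<Prod>i\<in>{1..4}. Gamma (1 + u i) / Gamma (1 + wp_par u - u i))"
proof -
  have nz: "1 + u i \<notin> \<int>\<^sub>\<le>\<^sub>0" if "i \<in> {1..4}" for i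
  proof
    assume "1 + u i \<in> \<int>\<^sub>\<le>\<^sub>0"
    then obtain k where "1 + u i = - of_nat k" by (auto elim!: nonpos_Ints_cases')
    moreover have "of_nat (Suc k) + u i = (1 + u i) + of_nat k" by simp
    ultimately have "of_nat (Suc k) + u i = 0" by simp
    thus False using small_par_add_nz[OF assms(1), of i k] that by simp
  qed
  have A: "wp_par u = (u 1 + u 2 + u 3 + u 4) / 2" using assms(2) by (simp add: wp_par_def)
  have lim: "(\<lambda>n. \<Prod>i\<in>{1..4}. rGamma_series (1 + wp_par u - u i) n / rGamma_series (1 + u i) n) \<longlonglongrightarrow>
     (\<Prod>i\<in>{1..4}. rGamma (1 + wp_par u - u i) / rGamma (1 + u i))"
    by (intro tendsto_intros rGamma_series_LIMSEQ) (use nz in \<open>auto simp: rGamma_eq_zero_iff\<close>)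
  have eq: "(\<Prod>i\<in>{1..4}. rGamma_series (1 + wp_par u - u i) n / rGamma_series (1 + u i) n) = tele_prod u (Suc n)" for n
  proof -
    define L where "L = (\<lambda>z::complex. exp (z * of_real (ln (real n))))"
    have "rGamma_series (1 + wp_par u - u i) n / rGamma_series (1 + u i) n =
       (pochhammer (1 + wp_par u - u i) (Suc n) / pochhammer (1 + u i) (Suc n)) * (L (1 + u i) / L (1 + wp_par u - u i))" for i
      by (simp add: rGamma_series_def L_def)
    hence "(\<Prod>i\<in>{1..4}. rGamma_series (1 + wp_par u - u i) n / rGamma_series (1 + u i) n) = 
      tele_prod u (Suc n) * (\<Prod>i\<in>{1..4}. L (1 + u i) / L (1 + wp_par u - u i))"
      by (simp only: prod.distrib tele_prod_def)
    also have "(\<Prod>i\<in>{1..4}. L (1 + u i) / L (1 + wp_par u - u i)) = (\<Prod>i\<in>{1..4}. L (2 * u i - wp_par u))"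
      unfolding L_def by (simp add: exp_diff[symmetric] algebra_simps)
    also have "\<dots> = 1"
      unfolding L_def prod_1_4 A by (simp add: exp_add[symmetric] algebra_simps)
    finally show ?thesis by simp
  qed
  have "(\<lambda>n. tele_prod u (Suc n)) \<longlonglongrightarrow> (\<Prod>i\<in>{1..4}. Gamma (1 + u i) / Gamma (1 + wp_par u - u i))"
    using lim unfolding eq by (simp add: rGamma_inverse_Gamma divide_inverse mult.commute)
  thus ?thesis by (simp only: filterlim_sequentially_Suc)
qed

theorem wp_sum_face:
  assumes "small_par u" "u 0 = 0"
  shows "tele_const u * (\<Sum>n. wp_term u n) = (\<Prod>i\<in>{1..4}. Gamma (1 + u i) / Gamma (1 + wp_par u - u i)) - 1"
proof -
  have "(\<lambda>n. tele_prod u (Suc n) - tele_prod u n) sums ((\<Prod>i\<in>{1..4}. Gamma (1 + u i) / Gamma (1 + wp_par u - u i)) - tele_prod u 0)"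
    by (rule telescope_sums[OF tele_prod_limit[OF assms]])
  hence "(\<lambda>n. tele_const u * wp_term u n) sums ((\<Prod>i\<in>{1..4}. Gamma (1 + u i) / Gamma (1 + wp_par u - u i)) - 1)"
    unfolding tele_step[OF assms] by (simp add: tele_prod_def)
  moreover have "(\<lambda>n. tele_const u * wp_term u n) sums (tele_const u * (\<Sum>n. wp_term u n))"
    by (intro sums_mult summable_sums wp_term_summable assms)
  ultimately show ?thesis by (rule sums_unique2[symmetric])
qed

subsection \<open>Power series of exponential type\<close>

definition zeta_nat :: "nat \<Rightarrow> complex" where
  "zeta_nat k = (\<Sum>n. 1 / of_nat (Suc n) ^ k)"

lemma zeta_nat_sums: "k \<ge> 2 \<Longrightarrow> (\<lambda>n. 1 / of_nat (Suc n) ^ k) sums zeta_nat k"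
proof -
  assume "k \<ge> 2"
  hence "summable (\<lambda>n. inverse (of_nat (Suc n) ^ k :: complex))"
    using inverse_power_summable[of k] by (subst summable_Suc_iff)
  thus ?thesis unfolding zeta_nat_def by (intro summable_sums) (simp add: inverse_eq_divide)
qed

text \<open>The function is the exponential of the integral of \<open>l\<close>. Encoding this by a
  differential equation with initial value 1 avoids logarithms and makes products additive in
  \<open>l\<close>.\<close>

definition log_deriv_fps :: "(complex \<Rightarrow> complex) \<Rightarrow> complex fps \<Rightarrow> bool" where
  "log_deriv_fps f l \<longleftrightarrow> (\<exists>F. f has_fps_expansion F \<and> fps_nth F 0 = 1 \<and> fps_deriv F = F * l)"

lemma log_deriv_fps_mult:
  assumes "log_deriv_fps f l" "log_deriv_fps g k"
  shows "log_deriv_fps (\<lambda>z. f z * g z) (l + k)"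
proof -
  from assms obtain F G where FG: "f has_fps_expansion F" "fps_nth F 0 = 1" "fps_deriv F = F * l"
    "g has_fps_expansion G" "fps_nth G 0 = 1" "fps_deriv G = G * k" by (auto simp: log_deriv_fps_def)
  thus ?thesis unfolding log_deriv_fps_def
    by (intro exI[of _ "F * G"] conjI has_fps_expansion_mult) (auto simp: algebra_simps)
qed

lemma log_deriv_fps_inverse:
  assumes "log_deriv_fps f l"
  shows "log_deriv_fps (\<lambda>z. inverse (f z)) (-l)"
proof -
  from assms obtain F where F: "f has_fps_expansion F" "fps_nth F 0 = 1" "fps_deriv F = F * l"
    by (auto simp: log_deriv_fps_def)
  have "fps_deriv (inverse F) = - fps_deriv F * (inverse F)\<^sup>2"
    using F(2) by (intro fps_inverse_deriv) auto
  also have "\<dots> = inverse F * (- l) * (F * inverse F)" unfolding F(3) by (simp add: power2_eq_square)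
  also have "F * inverse F = 1" using F(2) by (simp add: inverse_mult_eq_1')
  finally show ?thesis unfolding log_deriv_fps_def
    using F by (intro exI[of _ "inverse F"] conjI has_fps_expansion_inverse) auto
qed

lemma log_deriv_fps_1: "log_deriv_fps (\<lambda>_. 1) 0"
  unfolding log_deriv_fps_def by (intro exI[of _ 1]) auto

lemma log_deriv_fps_prod:
  "finite A \<Longrightarrow> (\<And>i. i \<in> A \<Longrightarrow> log_deriv_fps (f i) (l i)) \<Longrightarrow> log_deriv_fps (\<lambda>z. \<Prod>i\<in>A. f i z) (\<Sum>i\<in>A. l i)"
  by (induction rule: finite_induct) (auto intro: log_deriv_fps_1 log_deriv_fps_mult)

text \<open>The Taylor series in \<open>z\<close> of \<open>c * Digamma (1 + c * z)\<close>.\<close>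

definition digamma_fps :: "complex \<Rightarrow> complex fps" where
  "digamma_fps c = Abs_fps (\<lambda>k. if k = 0 then - euler_mascheroni * c else (-1) ^ Suc k * zeta_nat (Suc k) * c ^ Suc k)"

lemma log_deriv_fps_Gamma: "log_deriv_fps (\<lambda>z. Gamma (1 + c * z)) (digamma_fps c)"
proof -
  define A where "A = {z::complex. norm z < 1}"
  have A: "open A" "0 \<in> A" unfolding A_def by (auto intro!: open_Collect_less continuous_intros)
  have nz: "1 + z \<notin> \<int>\<^sub>\<le>\<^sub>0" if "z \<in> A" for z
  proof
    assume "1 + z \<in> \<int>\<^sub>\<le>\<^sub>0"
    then obtain k where "1 + z = - of_nat k" by (auto elim!: nonpos_Ints_cases')
    moreover have "z = (1 + z) - 1" by simp
    ultimately have "z = - of_nat (Suc k)" by simp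
    hence "norm z = real (Suc k)" by (metis norm_minus_cancel norm_of_nat)
    thus False using that by (simp add: A_def)
  qed
  define P where "P = fps_expansion (\<lambda>z. Digamma (1 + z :: complex)) 0"
  have holo: "(\<lambda>z. Digamma (1 + z)) holomorphic_on A" 
    by (rule holomorphic_on_compose_gen[of "\<lambda>z. 1 + z" A Digamma "-\<int>\<^sub>\<le>\<^sub>0", unfolded o_def])
       (use nz in \<open>auto intro!: holomorphic_intros holomorphic_on_Polygamma\<close>)
  have P: "(\<lambda>z. Digamma (1 + z)) has_fps_expansion P"
    unfolding P_def by (rule has_fps_expansion_fps_expansion[OF A holo])
  have der: "(deriv ^^ k) (\<lambda>z. Digamma (1 + z)) z = Polygamma k (1 + z)" if "z \<in> A" for k z
    using that
  proof (induction k arbitrary: z)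
    case (Suc k)
    have "(deriv ^^ Suc k) (\<lambda>z. Digamma (1 + z)) z = deriv ((deriv ^^ k) (\<lambda>z. Digamma (1 + z))) z" by simp
    also have "\<dots> = deriv (\<lambda>z. Polygamma k (1 + z)) z"
    proof (rule deriv_cong_ev)
      have "eventually (\<lambda>z. z \<in> A) (nhds z)" using A Suc.prems by (intro eventually_nhds_in_open) auto
      thus "\<forall>\<^sub>F z in nhds z. (deriv ^^ k) (\<lambda>z. Digamma (1 + z)) z = Polygamma k (1 + z)"
        by eventually_elim (rule Suc.IH)
    qed auto
    also have "\<dots> = Polygamma (Suc k) (1 + z)"
      by (rule DERIV_imp_deriv) (use nz[OF Suc.prems] in \<open>auto intro!: derivative_eq_intros\<close>)
    finally show ?case .
  qed auto
  have Pn: "fps_nth P k = (if k = 0 then - euler_mascheroni else (-1) ^ Suc k * zeta_nat (Suc k))" for k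
  proof -
    have "fps_nth P k = Polygamma k 1 / fact k"
      using der[OF A(2), of k] by (simp add: P_def fps_expansion_def)
    also have "\<dots> = (if k = 0 then - euler_mascheroni else (-1) ^ Suc k * zeta_nat (Suc k))"
      by (simp add: Polygamma_def zeta_nat_def Digamma_1 inverse_eq_divide add_ac flip: of_nat_Suc)
    finally show ?thesis .
  qed
  define G where "G = fps_expansion (\<lambda>z. Gamma (1 + z :: complex)) 0"
  have holoG: "(\<lambda>z. Gamma (1 + z)) holomorphic_on A" 
    by (rule holomorphic_on_compose_gen[of "\<lambda>z. 1 + z" A Gamma "-\<int>\<^sub>\<le>\<^sub>0", unfolded o_def])
       (use nz in \<open>auto intro!: holomorphic_intros holomorphic_Gamma\<close>)
  have G: "(\<lambda>z. Gamma (1 + z)) has_fps_expansion G"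
    unfolding G_def by (rule has_fps_expansion_fps_expansion[OF A holoG])
  have "deriv (\<lambda>z. Gamma (1 + z)) has_fps_expansion fps_deriv G" by (rule has_fps_expansion_deriv[OF G])
  moreover have e2: "(\<lambda>z. Gamma (1 + z) * Digamma (1 + z)) has_fps_expansion G * P"
    by (rule has_fps_expansion_mult[OF G P])
  moreover have ev: "\<forall>\<^sub>F z in nhds (0::complex). deriv (\<lambda>z. Gamma (1 + z)) z = Gamma (1 + z) * Digamma (1 + z)"
  proof -
    have "eventually (\<lambda>z. z \<in> A) (nhds 0)" using A by (intro eventually_nhds_in_open) auto
    thus ?thesis
      by eventually_elim (use nz in \<open>auto intro!: DERIV_imp_deriv derivative_eq_intros\<close>)
  qed
  moreover have "deriv (\<lambda>z. Gamma (1 + z)) has_fps_expansion G * P"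
    using e2 has_fps_expansion_cong[OF ev refl] by blast
  ultimately have G': "fps_deriv G = G * P"
    using fps_expansion_unique_complex by blast
  have G0: "fps_nth G 0 = 1" by (simp add: G_def fps_expansion_def)
  \<comment> \<open>The case \<open>c = 1\<close> is complete; a general \<open>c\<close>, including
    0, is obtained by substituting \<open>c * X\<close> into the power series.\<close>
  define H where "H = fps_compose G (fps_const c * fps_X)"
  have "((\<lambda>z. Gamma (1 + z)) \<circ> (\<lambda>z. c * z)) has_fps_expansion H"
    unfolding H_def by (intro has_fps_expansion_compose G fps_expansion_intros) auto
  moreover have "fps_nth H 0 = 1" by (simp add: H_def G0)
  moreover have "fps_deriv H = H * digamma_fps c"
  proof -
    have "fps_deriv H = fps_compose (G * P) (fps_const c * fps_X) * fps_deriv (fps_const c * fps_X)"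
      unfolding H_def by (subst fps_compose_deriv) (simp_all add: G')
    also have "fps_deriv (fps_const c * fps_X) = fps_const c" by simp
    also have "fps_compose (G * P) (fps_const c * fps_X) = H * fps_compose P (fps_const c * fps_X)"
      unfolding H_def by (rule fps_compose_mult_distrib) simp
    also have "H * fps_compose P (fps_const c * fps_X) * fps_const c = H * digamma_fps c"
    proof -
      have "fps_compose P (fps_const c * fps_X) * fps_const c = digamma_fps c"
        by (rule fps_ext) (simp add: Pn digamma_fps_def)
      thus ?thesis by (simp add: mult.assoc)
    qed
    finally show ?thesis .
  qed
  ultimately show ?thesis unfolding log_deriv_fps_def by (intro exI[of _ H]) (simp add: o_def)
qed

text \<open>The coefficients of the exponential of the series with coefficients \<open>a k\<close>,
  where \<open>a 1 = 0\<close>, from the recursion that equates the coefficients in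
  \<open>F' = F * l\<close>. Order 9 is required because the cubic form shifts degree 6 by
  3.\<close>

lemma exp_type_coeffs:
  fixes F l :: "complex fps"
  assumes F0: "fps_nth F 0 = 1" and F': "fps_deriv F = F * l" and l0: "fps_nth l 0 = 0"
  defines "a \<equiv> (\<lambda>k. fps_nth l (k - 1) / of_nat k)"
  shows "fps_nth F 1 = 0" "fps_nth F 2 = a 2" "fps_nth F 3 = a 3" "fps_nth F 4 = a 4 + a 2 ^ 2 / 2"
    "fps_nth F 5 = a 5 + a 2 * a 3" "fps_nth F 6 = a 6 + a 2 * a 4 + a 3 ^ 2 / 2 + a 2 ^ 3 / 6"
    "fps_nth F 7 = a 7 + a 2 * a 5 + a 3 * a 4 + a 2 ^ 2 * a 3 / 2"
    "fps_nth F 8 = a 8 + a 2 * a 6 + a 3 * a 5 + a 4 ^ 2 / 2 + a 2 ^ 2 * a 4 / 2 + a 2 * a 3 ^ 2 / 2 + a 2 ^ 4 / 24"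
    "fps_nth F 9 = a 9 + a 2 * a 7 + a 3 * a 6 + a 4 * a 5 + a 2 ^ 2 * a 5 / 2 + a 2 * a 3 * a 4 + a 3 ^ 3 / 6 + a 2 ^ 3 * a 3 / 6"
proof -
  have rec: "of_nat (Suc n) * fps_nth F (Suc n) = (\<Sum>i=0..n. fps_nth F i * fps_nth l (n - i))" for n
    using arg_cong[OF F', of "\<lambda>f. fps_nth f n"] by (simp add: fps_mult_nth)
  have la: "fps_nth l k = of_nat (Suc k) * a (Suc k)" for k by (simp add: a_def del: of_nat_Suc)
  have a1: "a 1 = 0" using l0 by (simp add: a_def)
  define f where "f = fps_nth F"
  have f0: "f 0 = 1" using F0 by (simp add: f_def)
  have f1: "f 1 = 0" using rec[of 0] a1 unfolding la f_def[symmetric] by (simp add: f0)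
  have r2: "f 2 = a 2" using rec[of 1] a1 f1 unfolding la f_def[symmetric] by (simp add: f0 eval_nat_numeral)
  have f3: "f 3 = a 3" using rec[of 2] a1 f1 unfolding la f_def[symmetric] by (simp add: f0 r2 eval_nat_numeral)
  have f4: "4 * f 4 = 4 * a 4 + 2 * (a 2 * f 2)"
    using rec[of 3] a1 f1 unfolding la f_def[symmetric] by (simp add: f0 eval_nat_numeral algebra_simps)
  have f5: "5 * f 5 = 5 * a 5 + 3 * (f 2 * a 3) + 2 * (f 3 * a 2)"
    using rec[of 4] a1 f1 unfolding la f_def[symmetric] by (simp add: f0 eval_nat_numeral algebra_simps)
  have f6: "6 * f 6 = 6 * a 6 + 4 * (f 2 * a 4) + 3 * (f 3 * a 3) + 2 * (f 4 * a 2)"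
    using rec[of 5] a1 f1 unfolding la f_def[symmetric] by (simp add: f0 eval_nat_numeral algebra_simps)
  have f7: "7 * f 7 = 7 * a 7 + 5 * (f 2 * a 5) + 4 * (f 3 * a 4) + 3 * (f 4 * a 3) + 2 * (f 5 * a 2)"
    using rec[of 6] a1 f1 unfolding la f_def[symmetric] by (simp add: f0 eval_nat_numeral algebra_simps)
  have f8: "8 * f 8 = 8 * a 8 + 6 * (f 2 * a 6) + 5 * (f 3 * a 5) + 4 * (f 4 * a 4) + 3 * (f 5 * a 3) + 2 * (f 6 * a 2)"
    using rec[of 7] a1 f1 unfolding la f_def[symmetric] by (simp add: f0 eval_nat_numeral algebra_simps)
  have f9: "9 * f 9 = 9 * a 9 + 7 * (f 2 * a 7) + 6 * (f 3 * a 6) + 5 * (f 4 * a 5) + 4 * (f 5 * a 4) + 3 * (f 6 * a 3) + 2 * (f 7 * a 2)"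
    using rec[of 8] a1 f1 unfolding la f_def[symmetric] by (simp add: f0 eval_nat_numeral algebra_simps)
  show "fps_nth F 1 = 0" "fps_nth F 2 = a 2" "fps_nth F 3 = a 3" using f1 r2 f3 by (simp_all add: f_def)
  have r4: "f 4 = a 4 + a 2 ^ 2 / 2" 
  proof -
    have "f 4 = (4 * f 4) / 4" by simp
    also have "\<dots> = a 4 + a 2 ^ 2 / 2" unfolding f4 r2 by (simp add: field_simps power2_eq_square)
    finally show ?thesis .
  qed
  have r5: "f 5 = a 5 + a 2 * a 3"
  proof -
    have "f 5 = (5 * f 5) / 5" by simp
    also have "\<dots> = a 5 + a 2 * a 3" unfolding f5 r2 f3 r4
      by (simp add: field_simps power2_eq_square power3_eq_cube power4_eq_xxxx)
    finally show ?thesis .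
  qed
  have r6: "f 6 = a 6 + a 2 * a 4 + a 3 ^ 2 / 2 + a 2 ^ 3 / 6"
  proof -
    have "f 6 = (6 * f 6) / 6" by simp
    also have "\<dots> = a 6 + a 2 * a 4 + a 3 ^ 2 / 2 + a 2 ^ 3 / 6" unfolding f6 r2 f3 r4 r5
      by (simp add: field_simps power2_eq_square power3_eq_cube power4_eq_xxxx)
    finally show ?thesis .
  qed
  have r7: "f 7 = a 7 + a 2 * a 5 + a 3 * a 4 + a 2 ^ 2 * a 3 / 2"
  proof -
    have "f 7 = (7 * f 7) / 7" by simp
    also have "\<dots> = a 7 + a 2 * a 5 + a 3 * a 4 + a 2 ^ 2 * a 3 / 2" unfolding f7 r2 f3 r4 r5 r6
      by (simp add: field_simps power2_eq_square power3_eq_cube power4_eq_xxxx)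
    finally show ?thesis .
  qed
  have r8: "f 8 = a 8 + a 2 * a 6 + a 3 * a 5 + a 4 ^ 2 / 2 + a 2 ^ 2 * a 4 / 2 + a 2 * a 3 ^ 2 / 2 + a 2 ^ 4 / 24"
  proof -
    have "f 8 = (8 * f 8) / 8" by simp
    also have "\<dots> = a 8 + a 2 * a 6 + a 3 * a 5 + a 4 ^ 2 / 2 + a 2 ^ 2 * a 4 / 2 + a 2 * a 3 ^ 2 / 2 + a 2 ^ 4 / 24" unfolding f8 r2 f3 r4 r5 r6 r7
      by (simp add: field_simps power2_eq_square power3_eq_cube power4_eq_xxxx)
    finally show ?thesis .
  qed
  have r9: "f 9 = a 9 + a 2 * a 7 + a 3 * a 6 + a 4 * a 5 + a 2 ^ 2 * a 5 / 2 + a 2 * a 3 * a 4 + a 3 ^ 3 / 6 + a 2 ^ 3 * a 3 / 6"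
  proof -
    have "f 9 = (9 * f 9) / 9" by simp
    also have "\<dots> = a 9 + a 2 * a 7 + a 3 * a 6 + a 4 * a 5 + a 2 ^ 2 * a 5 / 2 + a 2 * a 3 * a 4 + a 3 ^ 3 / 6 + a 2 ^ 3 * a 3 / 6" unfolding f9 r2 f3 r4 r5 r6 r7 r8
      by (simp add: field_simps power2_eq_square power3_eq_cube power4_eq_xxxx)
    finally show ?thesis .
  qed
  show "fps_nth F 4 = a 4 + a 2 ^ 2 / 2"
    "fps_nth F 5 = a 5 + a 2 * a 3" "fps_nth F 6 = a 6 + a 2 * a 4 + a 3 ^ 2 / 2 + a 2 ^ 3 / 6"
    "fps_nth F 7 = a 7 + a 2 * a 5 + a 3 * a 4 + a 2 ^ 2 * a 3 / 2"
    "fps_nth F 8 = a 8 + a 2 * a 6 + a 3 * a 5 + a 4 ^ 2 / 2 + a 2 ^ 2 * a 4 / 2 + a 2 * a 3 ^ 2 / 2 + a 2 ^ 4 / 24"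
    "fps_nth F 9 = a 9 + a 2 * a 7 + a 3 * a 6 + a 4 * a 5 + a 2 ^ 2 * a 5 / 2 + a 2 * a 3 * a 4 + a 3 ^ 3 / 6 + a 2 ^ 3 * a 3 / 6"
    using r4 r5 r6 r7 r8 r9 by (simp_all only: f_def)
qed

lemma sum_1_4: "(\<Sum>i\<in>{1..4::nat}. f i) = f 1 + f 2 + f 3 + (f 4 :: 'a::comm_monoid_add)"
proof -
  have "{1..4::nat} = {1,2,3,4}" by auto
  thus ?thesis by (simp add: add_ac)
qed

lemma wp_coeff_upd_holomorphic:
  assumes "j < 5"
  shows "(\<lambda>d. wp_coeff ((ind_par S)(j := d)) m) holomorphic_on ball 0 1"
proof -
  have unit: "unit_par ((ind_par S)(j := d))" if "d \<in> ball 0 1" for d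
    using that by (auto simp: unit_par_def ind_par_def)
  have "(\<lambda>d. \<Sum>n. fps_nth (wp_fps ((ind_par S)(j := d)) n) m) holomorphic_on ball 0 1"
    by (rule holomorphic_series_holomorphic[where r = 1, OF _ _ wp_fps_coeff_bound[OF unit] summable_inverse_squares_real])
       (simp_all add: homog_upd_holomorphic[OF wp_fps_homog])
  moreover have "(\<Sum>n. fps_nth (wp_fps ((ind_par S)(j := d)) n) m) = wp_coeff ((ind_par S)(j := d)) m" if "d \<in> ball 0 1" for d
    by (rule sums_unique[symmetric, OF wp_coeff_sums[OF unit[OF that]]])
  ultimately show ?thesis by (rule holomorphic_transform)
qed

lemma wp_coeff_upd_has_derivative:
  assumes "j < 5"
  shows "((\<lambda>d. wp_coeff ((ind_par S)(j := d)) m) has_field_derivative dir_deriv j (\<lambda>u. wp_coeff u m) S) (at 0)"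
  unfolding dir_deriv_def
  by (rule holomorphic_derivI[OF wp_coeff_upd_holomorphic[OF assms]]) auto

text \<open>The coefficient of the \<open>k\<close>-th power of \<open>z\<close> in the logarithm of
  the Gamma quotient, for \<open>k\<close> at least 2.\<close>

definition gamma_exponent :: "(nat \<Rightarrow> complex) \<Rightarrow> nat \<Rightarrow> complex" where
  "gamma_exponent u k = (-1) ^ k * zeta_nat k / of_nat k * (\<Sum>i\<in>{1..4}. u i ^ k - (wp_par u - u i) ^ k)"

lemma tele_const_scale: "tele_const (\<lambda>i. z * u i) = z ^ 3 * tele_const u"
proof -
  have "(z * a + z * b + z * c + z * d) / 2 = z * ((a + b + c + d) / 2)" for a b c d :: complex
    by (simp add: ring_distribs add_divide_distrib)
  thus ?thesis
    unfolding tele_const_def Let_def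
    by (simp add: right_diff_distrib[symmetric] power3_eq_cube) (simp add: algebra_simps)
qed

definition gamma_quot_fps :: "(nat \<Rightarrow> complex) \<Rightarrow> complex fps" where
  "gamma_quot_fps u = fps_expansion (\<lambda>z. \<Prod>i\<in>{1..4}. Gamma (1 + u i * z) * inverse (Gamma (1 + (wp_par u - u i) * z))) 0"

lemma gamma_quot_fps:
  assumes "u 0 = 0"
  defines "l \<equiv> (\<Sum>i\<in>{1..4}. digamma_fps (u i) + - digamma_fps (wp_par u - u i))"
  shows "(\<lambda>z. \<Prod>i\<in>{1..4}. Gamma (1 + u i * z) * inverse (Gamma (1 + (wp_par u - u i) * z))) has_fps_expansion gamma_quot_fps u"
    and "fps_nth (gamma_quot_fps u) 0 = 1" and "fps_deriv (gamma_quot_fps u) = gamma_quot_fps u * l"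
    and "fps_nth l 0 = 0" and "k \<ge> 2 \<Longrightarrow> fps_nth l (k - 1) / of_nat k = gamma_exponent u k"
proof -
  have "log_deriv_fps (\<lambda>z. \<Prod>i\<in>{1..4}. Gamma (1 + u i * z) * inverse (Gamma (1 + (wp_par u - u i) * z))) l"
    unfolding l_def by (intro log_deriv_fps_prod log_deriv_fps_mult log_deriv_fps_inverse log_deriv_fps_Gamma) auto
  then obtain F where F: "(\<lambda>z. \<Prod>i\<in>{1..4}. Gamma (1 + u i * z) * inverse (Gamma (1 + (wp_par u - u i) * z))) has_fps_expansion F"
    "fps_nth F 0 = 1" "fps_deriv F = F * l" unfolding log_deriv_fps_def by blast
  have "gamma_quot_fps u = F" unfolding gamma_quot_fps_def by (rule fps_expansion_eqI[OF F(1)])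
  with F show "(\<lambda>z. \<Prod>i\<in>{1..4}. Gamma (1 + u i * z) * inverse (Gamma (1 + (wp_par u - u i) * z))) has_fps_expansion gamma_quot_fps u"
    "fps_nth (gamma_quot_fps u) 0 = 1" "fps_deriv (gamma_quot_fps u) = gamma_quot_fps u * l" by simp_all
  \<comment> \<open>This balance removes the Euler-Mascheroni terms, so the exponent has no linear
    part.\<close>
  have A: "2 * wp_par u = u 1 + u 2 + u 3 + u 4" using assms(1) by (simp add: wp_par_def)
  have "fps_nth l 0 = - euler_mascheroni * (2 * (u 1 + u 2 + u 3 + u 4) - 2 * (2 * wp_par u))"
    unfolding l_def prod_1_4 by (simp add: fps_sum_nth digamma_fps_def numeral_eq_Suc algebra_simps)
  thus "fps_nth l 0 = 0" unfolding A by simp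
  assume k: "k \<ge> 2"
  have d: "fps_nth (digamma_fps c) (k - 1) = (-1) ^ k * zeta_nat k * c ^ k" for c
    using k by (cases k) (auto simp: digamma_fps_def)
  show "fps_nth l (k - 1) / of_nat k = gamma_exponent u k"
    unfolding l_def gamma_exponent_def
    unfolding sum_1_4 fps_add_nth fps_neg_nth d by (simp add: field_simps)
qed

text \<open>\<open>wp_sum_face\<close> along the ray \<open>z * u\<close>: the cubic form
  contributes the third power of \<open>z\<close> and hence the shift of the index by 3.\<close>

lemma wp_coeff_face:
  assumes "unit_par u" "u 0 = 0"
  shows "tele_const u * wp_coeff u m = fps_nth (gamma_quot_fps u) (m + 3)"
proof -
  define F where "F = (\<lambda>z. \<Sum>n. wp_term (\<lambda>i. z * u i) n)"
  have F: "F has_fps_expansion Abs_fps (wp_coeff u)"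
    unfolding F_def by (rule wp_sum_fps_expansion[OF assms(1)])
  have L: "(\<lambda>z. z ^ 3 * (tele_const u * F z)) has_fps_expansion fps_X ^ 3 * (fps_const (tele_const u) * Abs_fps (wp_coeff u))"
    by (intro has_fps_expansion_mult has_fps_expansion_cmult_left F fps_expansion_intros)
  have "eventually (\<lambda>z. z \<in> ball (0::complex) (1/50)) (nhds 0)" by (intro eventually_nhds_in_open) auto
  hence ev: "\<forall>\<^sub>F z in nhds 0. (\<Prod>i\<in>{1..4}. Gamma (1 + u i * z) * inverse (Gamma (1 + (wp_par u - u i) * z))) - 1 = z ^ 3 * (tele_const u * F z)"
  proof eventually_elim
    case (elim z)
    have "tele_const (\<lambda>i. z * u i) * F z =
       (\<Prod>i\<in>{1..4}. Gamma (1 + z * u i) / Gamma (1 + wp_par (\<lambda>i. z * u i) - z * u i)) - 1"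
      unfolding F_def by (rule wp_sum_face[OF unit_par_small[OF assms(1) elim]]) (simp add: assms)
    moreover have "1 + z * wp_par u - z * u i = 1 + (wp_par u - u i) * z" for i by (simp add: algebra_simps)
    ultimately show ?case
      by (simp add: tele_const_scale wp_par_scale divide_inverse mult_ac)
  qed
  have R: "(\<lambda>z. (\<Prod>i\<in>{1..4}. Gamma (1 + u i * z) * inverse (Gamma (1 + (wp_par u - u i) * z))) - 1) has_fps_expansion gamma_quot_fps u - 1"
    by (rule has_fps_expansion_diff[OF gamma_quot_fps(1)[where u = u, OF assms(2)] has_fps_expansion_1])
  have "gamma_quot_fps u - 1 = fps_X ^ 3 * (fps_const (tele_const u) * Abs_fps (wp_coeff u))"
    by (rule fps_expansion_unique_complex[OF R]) (use L has_fps_expansion_cong[OF ev refl] in blast)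
  hence "fps_nth (gamma_quot_fps u - 1) (m + 3) = fps_nth (fps_X ^ 3 * (fps_const (tele_const u) * Abs_fps (wp_coeff u))) (m + 3)"
    by simp
  thus ?thesis by (simp add: fps_X_power_mult_nth)
qed

text \<open>The coefficient of order \<open>m + 3\<close> of the exponential of the series with
  coefficients \<open>a k\<close>, \<open>k\<close> at least 2. The last branch is the formula for
  \<open>m = 6\<close>, and the definition has this meaning only up to there.\<close>

definition exp_poly :: "(nat \<Rightarrow> complex) \<Rightarrow> nat \<Rightarrow> complex" where
  "exp_poly a m = (if m = 0 then a 3 else if m = 1 then a 4 + a 2 ^ 2 / 2 else if m = 2 then a 5 + a 2 * a 3
     else if m = 3 then a 6 + a 2 * a 4 + a 3 ^ 2 / 2 + a 2 ^ 3 / 6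
     else if m = 4 then a 7 + a 2 * a 5 + a 3 * a 4 + a 2 ^ 2 * a 3 / 2
     else if m = 5 then a 8 + a 2 * a 6 + a 3 * a 5 + a 4 ^ 2 / 2 + a 2 ^ 2 * a 4 / 2 + a 2 * a 3 ^ 2 / 2 + a 2 ^ 4 / 24
     else a 9 + a 2 * a 7 + a 3 * a 6 + a 4 * a 5 + a 2 ^ 2 * a 5 / 2 + a 2 * a 3 * a 4 + a 3 ^ 3 / 6 + a 2 ^ 3 * a 3 / 6)"

lemma exp_type_exp_poly:
  fixes F l :: "complex fps"
  assumes F: "fps_nth F 0 = 1" "fps_deriv F = F * l" "fps_nth l 0 = 0"
    and a: "\<And>k. k \<ge> 2 \<Longrightarrow> fps_nth l (k - 1) / of_nat k = a k"
  shows "fps_nth F 1 = 0" "fps_nth F 2 = a 2" "m \<le> 6 \<Longrightarrow> fps_nth F (m + 3) = exp_poly a m"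
proof -
  note c = exp_type_coeffs[OF F]
  have e: "fps_nth l (2 - 1) / of_nat 2 = a 2" "fps_nth l (3 - 1) / of_nat 3 = a 3" "fps_nth l (4 - 1) / of_nat 4 = a 4"
    "fps_nth l (5 - 1) / of_nat 5 = a 5" "fps_nth l (6 - 1) / of_nat 6 = a 6" "fps_nth l (7 - 1) / of_nat 7 = a 7"
    "fps_nth l (8 - 1) / of_nat 8 = a 8" "fps_nth l (9 - 1) / of_nat 9 = a 9"
    by (rule a; simp)+
  note c' = c[unfolded e]
  show "fps_nth F 1 = 0" "fps_nth F 2 = a 2" by (fact c')+
  have n: "0 + 3 = (3::nat)" "1 + 3 = (4::nat)" "2 + 3 = (5::nat)" "3 + 3 = (6::nat)" "4 + 3 = (7::nat)" "5 + 3 = (8::nat)" "6 + 3 = (9::nat)"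
    by simp_all
  assume "m \<le> 6"
  hence "m = 0 \<or> m = 1 \<or> m = 2 \<or> m = 3 \<or> m = 4 \<or> m = 5 \<or> m = 6" by linarith
  thus "fps_nth F (m + 3) = exp_poly a m"
    by (elim disjE; hypsubst) (simp_all only: n c', simp_all add: exp_poly_def)
qed

lemma wp_coeff_face_explicit:
  assumes "unit_par u" "u 0 = 0" "m \<le> 6"
  shows "tele_const u * wp_coeff u m = exp_poly (gamma_exponent u) m"
proof -
  note g = gamma_quot_fps[where u = u, OF assms(2)]
  show ?thesis unfolding wp_coeff_face[OF assms(1,2)] by (rule exp_type_exp_poly(3)[OF g(2-5) assms(3)])
qed

lemma exp_poly_derivative:
  assumes a: "\<And>k. k \<ge> 2 \<Longrightarrow> ((\<lambda>d. a d k) has_field_derivative a' k) (at 0)"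
  shows "((\<lambda>d. exp_poly (a d) 5) has_field_derivative
      (let b = a 0 in a' 8 + (a' 2 * b 6 + b 2 * a' 6) + (a' 3 * b 5 + b 3 * a' 5) + b 4 * a' 4 +
         (b 2 * a' 2 * b 4 + b 2 ^ 2 * a' 4 / 2) + (a' 2 * b 3 ^ 2 / 2 + b 2 * b 3 * a' 3) + b 2 ^ 3 * a' 2 / 6)) (at 0)"
    and "((\<lambda>d. exp_poly (a d) 6) has_field_derivative
      (let b = a 0 in a' 9 + (a' 2 * b 7 + b 2 * a' 7) + (a' 3 * b 6 + b 3 * a' 6) + (a' 4 * b 5 + b 4 * a' 5) +
         (b 2 * a' 2 * b 5 + b 2 ^ 2 * a' 5 / 2) + (a' 2 * b 3 * b 4 + b 2 * a' 3 * b 4 + b 2 * b 3 * a' 4) +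
         b 3 ^ 2 * a' 3 / 2 + (b 2 ^ 2 * a' 2 * b 3 / 2 + b 2 ^ 3 * a' 3 / 6))) (at 0)"
proof -
  have d: "((\<lambda>d. a d 2) has_field_derivative a' 2) (at 0)" "((\<lambda>d. a d 3) has_field_derivative a' 3) (at 0)"
    "((\<lambda>d. a d 4) has_field_derivative a' 4) (at 0)" "((\<lambda>d. a d 5) has_field_derivative a' 5) (at 0)"
    "((\<lambda>d. a d 6) has_field_derivative a' 6) (at 0)" "((\<lambda>d. a d 7) has_field_derivative a' 7) (at 0)"
    "((\<lambda>d. a d 8) has_field_derivative a' 8) (at 0)" "((\<lambda>d. a d 9) has_field_derivative a' 9) (at 0)"
    by (rule a; simp)+
  show "((\<lambda>d. exp_poly (a d) 5) has_field_derivative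
      (let b = a 0 in a' 8 + (a' 2 * b 6 + b 2 * a' 6) + (a' 3 * b 5 + b 3 * a' 5) + b 4 * a' 4 +
         (b 2 * a' 2 * b 4 + b 2 ^ 2 * a' 4 / 2) + (a' 2 * b 3 ^ 2 / 2 + b 2 * b 3 * a' 3) + b 2 ^ 3 * a' 2 / 6)) (at 0)"
    unfolding exp_poly_def by simp (auto intro!: derivative_eq_intros d simp: Let_def field_simps power2_eq_square power3_eq_cube)
  show "((\<lambda>d. exp_poly (a d) 6) has_field_derivative
      (let b = a 0 in a' 9 + (a' 2 * b 7 + b 2 * a' 7) + (a' 3 * b 6 + b 3 * a' 6) + (a' 4 * b 5 + b 4 * a' 5) +
         (b 2 * a' 2 * b 5 + b 2 ^ 2 * a' 5 / 2) + (a' 2 * b 3 * b 4 + b 2 * a' 3 * b 4 + b 2 * b 3 * a' 4) +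
         b 3 ^ 2 * a' 3 / 2 + (b 2 ^ 2 * a' 2 * b 3 / 2 + b 2 ^ 3 * a' 3 / 6))) (at 0)"
    unfolding exp_poly_def by simp (auto intro!: derivative_eq_intros d simp: Let_def field_simps power2_eq_square power3_eq_cube)
qed

section \<open>Faces and edges with one or three ones\<close>

definition exponent3 :: "nat \<Rightarrow> complex" where
  "exponent3 k = (-1) ^ k * zeta_nat k / of_nat k * (3 - 3 * (1/2) ^ k - (3/2) ^ k)"

definition exponent1 :: "nat \<Rightarrow> complex" where
  "exponent1 k = (-1) ^ k * zeta_nat k / of_nat k * (1 - (-1/2) ^ k - 3 * (1/2) ^ k)"

lemma face_coeff_3:
  assumes "m \<le> 6"
  shows "face_coeff m 3 = 8 * exp_poly exponent3 m"
proof -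
  define u where "u = ind_par {1,2,3}"
  have u: "u 0 = 0" "u 1 = 1" "u 2 = 1" "u 3 = 1" "u 4 = 0" by (simp_all add: u_def ind_par_def)
  have p: "wp_par u = 3/2" unfolding wp_par_def u by simp
  have t: "tele_const u = 1/8" unfolding tele_const_def Let_def u by simp
  have "exp_poly (gamma_exponent u) m = exp_poly exponent3 m"
  proof -
    have "gamma_exponent u k = exponent3 k" if "k \<ge> 2" for k
      using that unfolding gamma_exponent_def exponent3_def p sum_1_4 u
      by (simp add: power_0_left)
    thus ?thesis by (simp add: exp_poly_def)
  qed
  hence "tele_const u * wp_coeff u m = exp_poly exponent3 m"
    using wp_coeff_face_explicit[of u m] unit_ind_par[of "{1,2,3}"] u(1) assms by (simp add: u_def)
  moreover have "wp_coeff u m = face_coeff m 3"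
    unfolding u_def by (subst face_coeff_eq) (auto simp: eval_nat_numeral)
  ultimately show ?thesis unfolding t by (simp add: field_simps)
qed

lemma face_coeff_1:
  assumes "m \<le> 6"
  shows "face_coeff m 1 = - 8 * exp_poly exponent1 m"
proof -
  define u where "u = ind_par {1}"
  have u: "u 0 = 0" "u 1 = 1" "u 2 = 0" "u 3 = 0" "u 4 = 0" by (simp_all add: u_def ind_par_def)
  have p: "wp_par u = 1/2" unfolding wp_par_def u by simp
  have t: "tele_const u = -1/8" unfolding tele_const_def Let_def u by simp
  have "exp_poly (gamma_exponent u) m = exp_poly exponent1 m"
  proof -
    have "gamma_exponent u k = exponent1 k" if "k \<ge> 2" for k
      using that unfolding gamma_exponent_def exponent1_def p sum_1_4 u
      by (simp add: power_0_left)
    thus ?thesis by (simp add: exp_poly_def)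
  qed
  hence E: "tele_const u * wp_coeff u m = exp_poly exponent1 m"
    using wp_coeff_face_explicit[of u m] unit_ind_par[of "{1}"] u(1) assms by (simp add: u_def)
  have "wp_coeff u m = face_coeff m 1"
    unfolding u_def by (subst face_coeff_eq) (auto simp: eval_nat_numeral)
  moreover have "wp_coeff u m = - 8 * (tele_const u * wp_coeff u m)" unfolding t by simp
  ultimately show ?thesis unfolding E by simp
qed

text \<open>The derivative of the exponent at \<open>d = 0\<close> when a vanishing parameter
  becomes \<open>d\<close> beside three ones. The power of \<open>d\<close> itself contributes
  nothing, since \<open>k\<close> is at least 2; the half comes from \<open>wp_par\<close>.\<close>

definition exponent3' :: "nat \<Rightarrow> complex" where
  "exponent3' k = (-1) ^ k * zeta_nat k * ((3/2) ^ (k - 1) / 2 - 3 / 2 * (1/2) ^ (k - 1))"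

definition exponent1' :: "nat \<Rightarrow> complex" where
  "exponent1' k = (-1) ^ k * zeta_nat k * (- ((1/2) ^ (k - 1)) / 2 - (-1/2) ^ (k - 1) / 2)"

text \<open>The product rule at \<open>d = 0\<close> for the telescoped identity, whose left-hand
  side is \<open>t d * W d\<close>. It determines the edge coefficient only if \<open>t 0\<close> is
  nonzero, that is, for one or three ones.\<close>

lemma edge_coeff_by_face:
  fixes S m c c' a'
  assumes S: "S \<subseteq> {2,3,4}" and m: "m \<le> 6"
    and t: "\<And>d. tele_const ((ind_par S)(1 := d)) = t d" and t': "(t has_field_derivative t') (at 0)"
    and E: "((\<lambda>d. exp_poly (gamma_exponent ((ind_par S)(1 := d))) m) has_field_derivative e) (at 0)"
  shows "t' * face_coeff m (card S) + t 0 * edge_coeff m (card S) = e"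
proof -
  define W where "W = (\<lambda>d. wp_coeff ((ind_par S)(1 := d)) m)"
  have S1: "1 \<notin> S" "0 \<notin> S" "S \<subseteq> {..<5} - {1}" "S \<subseteq> {..<5}" using S by auto
  have W: "(W has_field_derivative edge_coeff m (card S)) (at 0)"
    unfolding W_def using wp_coeff_upd_has_derivative[of 1 S m] edge_coeff_eq[of 1 S m] S1 by simp
  have "((\<lambda>d. t d * W d) has_field_derivative (t' * W 0 + edge_coeff m (card S) * t 0)) (at 0)"
    using DERIV_mult[OF t' W] by simp
  moreover have "W 0 = face_coeff m (card S)"
  proof -
    have "(ind_par S)(1 := 0) = ind_par S" using S1 by (auto simp: ind_par_def)
    thus ?thesis unfolding W_def using face_coeff_eq[OF S1(4)] by simp
  qed
  moreover have "((\<lambda>d. t d * W d) has_field_derivative e) (at 0)"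
  \<comment> \<open>The identity is available for \<open>d\<close> in the unit disc, where all
    parameters have norm at most 1; agreement near 0 is enough for the derivative.\<close>
  proof (rule DERIV_cong_ev[THEN iffD1, OF refl _ refl E])
    have "eventually (\<lambda>d. d \<in> ball (0::complex) 1) (nhds 0)" by (intro eventually_nhds_in_open) auto
    thus "\<forall>\<^sub>F d in nhds 0. exp_poly (gamma_exponent ((ind_par S)(1 := d))) m = t d * W d"
    proof eventually_elim
      case (elim d)
      have "unit_par ((ind_par S)(1 := d))" using elim by (auto simp: unit_par_def ind_par_def)
      moreover have "((ind_par S)(1 := d)) 0 = 0" using S1 by (simp add: ind_par_def)
      ultimately show ?case
        using wp_coeff_face_explicit[OF _ _ m] t unfolding W_def by metis
    qed
  qed
  ultimately show ?thesis using DERIV_unique by (fastforce simp: mult.commute)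
qed

lemma exponent_derivative_3:
  assumes "k \<ge> 2"
  shows "((\<lambda>d. gamma_exponent ((ind_par {2,3,4})(1 := d)) k) has_field_derivative exponent3' k) (at 0)"
proof -
  have eq: "gamma_exponent ((ind_par {2,3,4})(1 := d)) k =
    (-1) ^ k * zeta_nat k / of_nat k * (d ^ k + 3 - ((3 - d) / 2) ^ k - 3 * ((1 + d) / 2) ^ k)" for d
  proof -
    define u where "u = (ind_par {2,3,4})(1 := d)"
    have u: "u 0 = 0" "u 1 = d" "u 2 = 1" "u 3 = 1" "u 4 = 1" by (simp_all add: u_def ind_par_def)
    have p: "wp_par u = (3 + d) / 2" unfolding wp_par_def u by simp
    have q: "(3 + d) / 2 - d = (3 - d) / 2" "(3 + d) / 2 - 1 = (1 + d) / 2" by (simp_all add: field_simps)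
    show ?thesis unfolding u_def[symmetric] gamma_exponent_def sum_1_4 p u q by simp
  qed
  obtain j where j: "k = Suc (Suc j)" using assms by (metis add_2_eq_Suc le_Suc_ex)
  have k0: "k \<noteq> 0" using assms by linarith
  hence nz: "complex_of_nat k \<noteq> 0" by simp
  have "((\<lambda>d. (-1) ^ k * zeta_nat k / of_nat k * (d ^ k + 3 - ((3 - d) / 2) ^ k - 3 * ((1 + d) / 2) ^ k)) has_field_derivative
     (-1) ^ k * zeta_nat k / of_nat k * (of_nat k * 0 ^ (k - 1) - of_nat k * (3/2) ^ (k - 1) * (-1/2) - 3 * (of_nat k * (1/2) ^ (k - 1) * (1/2)))) (at 0)"
    using k0 by (auto intro!: derivative_eq_intros)
  also have "(-1) ^ k * zeta_nat k / of_nat k * (of_nat k * 0 ^ (k - 1) - of_nat k * (3/2) ^ (k - 1) * (-1/2) - 3 * (of_nat k * (1/2) ^ (k - 1) * (1/2)))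
     = exponent3' k"
    using nz k0 assms unfolding exponent3'_def by (auto simp: power_0_left field_simps)
  finally show ?thesis unfolding eq .
qed

lemma exponent_derivative_1:
  assumes "k \<ge> 2"
  shows "((\<lambda>d. gamma_exponent ((ind_par {2})(1 := d)) k) has_field_derivative exponent1' k) (at 0)"
proof -
  have eq: "gamma_exponent ((ind_par {2})(1 := d)) k =
    (-1) ^ k * zeta_nat k / of_nat k * (d ^ k + 1 - ((1 - d) / 2) ^ k - ((d - 1) / 2) ^ k - 2 * ((1 + d) / 2) ^ k)" for d
  proof -
    define u where "u = (ind_par {2})(1 := d)"
    have u: "u 0 = 0" "u 1 = d" "u 2 = 1" "u 3 = 0" "u 4 = 0" by (simp_all add: u_def ind_par_def)
    have p: "wp_par u = (1 + d) / 2" unfolding wp_par_def u by simp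
    have q: "(1 + d) / 2 - d = (1 - d) / 2" "(1 + d) / 2 - 1 = (d - 1) / 2" by (simp_all add: field_simps)
    show ?thesis unfolding u_def[symmetric] gamma_exponent_def sum_1_4 p u q using assms by (simp add: power_0_left)
  qed
  have k0: "k \<noteq> 0" using assms by linarith
  hence nz: "complex_of_nat k \<noteq> 0" by simp
  have "((\<lambda>d. (-1) ^ k * zeta_nat k / of_nat k * (d ^ k + 1 - ((1 - d) / 2) ^ k - ((d - 1) / 2) ^ k - 2 * ((1 + d) / 2) ^ k)) has_field_derivative
     (-1) ^ k * zeta_nat k / of_nat k * (of_nat k * 0 ^ (k - 1) - of_nat k * (1/2) ^ (k - 1) * (-1/2) - of_nat k * (-1/2) ^ (k - 1) * (1/2) - 2 * (of_nat k * (1/2) ^ (k - 1) * (1/2)))) (at 0)"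
    using k0 by (auto intro!: derivative_eq_intros)
  also have "(-1) ^ k * zeta_nat k / of_nat k * (of_nat k * 0 ^ (k - 1) - of_nat k * (1/2) ^ (k - 1) * (-1/2) - of_nat k * (-1/2) ^ (k - 1) * (1/2) - 2 * (of_nat k * (1/2) ^ (k - 1) * (1/2)))
     = exponent1' k"
    using nz k0 assms unfolding exponent1'_def by (auto simp: power_0_left field_simps)
  finally show ?thesis unfolding eq .
qed

definition exp_poly_deriv :: "(nat \<Rightarrow> complex) \<Rightarrow> (nat \<Rightarrow> complex) \<Rightarrow> nat \<Rightarrow> complex" where
  "exp_poly_deriv b a' m = (if m = 5 then a' 8 + (a' 2 * b 6 + b 2 * a' 6) + (a' 3 * b 5 + b 3 * a' 5) + b 4 * a' 4 +
         (b 2 * a' 2 * b 4 + b 2 ^ 2 * a' 4 / 2) + (a' 2 * b 3 ^ 2 / 2 + b 2 * b 3 * a' 3) + b 2 ^ 3 * a' 2 / 6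
     else a' 9 + (a' 2 * b 7 + b 2 * a' 7) + (a' 3 * b 6 + b 3 * a' 6) + (a' 4 * b 5 + b 4 * a' 5) +
         (b 2 * a' 2 * b 5 + b 2 ^ 2 * a' 5 / 2) + (a' 2 * b 3 * b 4 + b 2 * a' 3 * b 4 + b 2 * b 3 * a' 4) +
         b 3 ^ 2 * a' 3 / 2 + (b 2 ^ 2 * a' 2 * b 3 / 2 + b 2 ^ 3 * a' 3 / 6))"

text \<open>The base values \<open>b\<close> are kept separate from \<open>a 0\<close> because the
  special exponents agree with the general ones only for \<open>k\<close> at least 2.\<close>

lemma exp_poly_has_derivative:
  assumes a: "\<And>k. k \<ge> 2 \<Longrightarrow> ((\<lambda>d. a d k) has_field_derivative a' k) (at 0)" and m: "m \<in> {5, 6}"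
    and b: "\<And>k. k \<ge> 2 \<Longrightarrow> a 0 k = b k"
  shows "((\<lambda>d. exp_poly (a d) m) has_field_derivative exp_poly_deriv b a' m) (at 0)"
proof -
  have "m = 5 \<or> m = 6" using m by simp
  thus ?thesis
    using exp_poly_derivative[OF a] by (elim disjE) (simp_all add: exp_poly_deriv_def Let_def b)
qed

lemma edge_coeff_3:
  assumes m: "m \<in> {5, 6}"
  shows "edge_coeff m 3 = 8 * exp_poly_deriv exponent3 exponent3' m + 24 * exp_poly exponent3 m"
proof -
  have t: "tele_const ((ind_par {2,3,4})(1 := d)) = (1 - d) ^ 3 / 8" for d
    unfolding tele_const_def Let_def by (simp add: ind_par_def field_simps power3_eq_cube)
  have t': "((\<lambda>d. (1 - d) ^ 3 / 8) has_field_derivative (- 3/8 :: complex)) (at 0)"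
    by (auto intro!: derivative_eq_intros)
  have "((\<lambda>d. exp_poly (gamma_exponent ((ind_par {2,3,4})(1 := d))) m) has_field_derivative exp_poly_deriv exponent3 exponent3' m) (at 0)"
  proof (rule exp_poly_has_derivative[OF exponent_derivative_3 m])
    fix k :: nat assume k: "k \<ge> 2"
    have p: "wp_par ((ind_par {2,3,4})(1 := 0)) = 3/2" by (simp add: wp_par_def ind_par_def)
    show "gamma_exponent ((ind_par {2,3,4})(1 := 0)) k = exponent3 k"
      unfolding gamma_exponent_def exponent3_def p sum_1_4 using k by (simp add: ind_par_def power_0_left)
  qed
  from edge_coeff_by_face[OF _ _ t t' this] m
  have "- 3/8 * face_coeff m 3 + 1/8 * edge_coeff m 3 = exp_poly_deriv exponent3 exponent3' m"
    by (auto simp: eval_nat_numeral)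
  moreover have "face_coeff m 3 = 8 * exp_poly exponent3 m" by (rule face_coeff_3) (use m in auto)
  moreover have "x = 8 * y + 24 * z" if "-3/8 * w + 1/8 * x = y" "w = 8 * z" for x y z w :: complex
  proof -
    have "8 * y + 24 * z = 8 * (-3/8 * w + 1/8 * x) + 3 * w" using that by simp
    thus ?thesis by (simp add: ring_distribs)
  qed
  ultimately show ?thesis by blast
qed

lemma edge_coeff_1:
  assumes m: "m \<in> {5, 6}"
  shows "edge_coeff m 1 = - 8 * exp_poly_deriv exponent1 exponent1' m - 8 * exp_poly exponent1 m"
proof -
  have t: "tele_const ((ind_par {2})(1 := d)) = - ((1 - d) ^ 2 * (1 + d)) / 8" for d
    unfolding tele_const_def Let_def by (simp add: ind_par_def field_simps power2_eq_square)
  have t': "((\<lambda>d. - ((1 - d) ^ 2 * (1 + d)) / 8) has_field_derivative (1/8 :: complex)) (at 0)"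
    by (auto intro!: derivative_eq_intros)
  have "((\<lambda>d. exp_poly (gamma_exponent ((ind_par {2})(1 := d))) m) has_field_derivative exp_poly_deriv exponent1 exponent1' m) (at 0)"
  proof (rule exp_poly_has_derivative[OF exponent_derivative_1 m])
    fix k :: nat assume k: "k \<ge> 2"
    have p: "wp_par ((ind_par {2})(1 := 0)) = 1/2" by (simp add: wp_par_def ind_par_def)
    show "gamma_exponent ((ind_par {2})(1 := 0)) k = exponent1 k"
      unfolding gamma_exponent_def exponent1_def p sum_1_4 using k by (simp add: ind_par_def power_0_left)
  qed
  from edge_coeff_by_face[OF _ _ t t' this] m
  have "1/8 * face_coeff m 1 + (-1/8) * edge_coeff m 1 = exp_poly_deriv exponent1 exponent1' m"
    by auto
  moreover have "face_coeff m 1 = - 8 * exp_poly exponent1 m" by (rule face_coeff_1) (use m in auto)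
  moreover have "x = - 8 * y - 8 * z" if "1/8 * w + (-1/8) * x = y" "w = - 8 * z" for x y z w :: complex
  proof -
    have "- 8 * y - 8 * z = - 8 * (1/8 * w + (-1/8) * x) + w" using that by simp
    thus ?thesis by (simp add: ring_distribs)
  qed
  ultimately show ?thesis by blast
qed

section \<open>Faces with none, two or four ones, summed directly\<close>

lemma lin_fps_nz: "c \<noteq> 0 \<Longrightarrow> lin_fps c v * inverse (lin_fps c v) = 1"
  by (rule inverse_mult_eq_1') (simp add: fps_nth_lin_fps)

text \<open>The negative binomial series, by induction on the power with Pascal's rule.\<close>

lemma inverse_lin_fps_power_nth:
  assumes "c \<noteq> 0"
  shows "fps_nth (inverse (lin_fps c 1) ^ Suc p) m = (-1) ^ m * of_nat ((m + p) choose p) / c ^ (m + p + 1)"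
proof -
  define R where "R = (\<lambda>p. Abs_fps (\<lambda>m. (-1) ^ m * of_nat ((m + p) choose p) / c ^ (m + p + 1)))"
  have R0: "R 0 = inverse (lin_fps c 1)"
    unfolding R_def inverse_lin_fps[OF assms] by (rule fps_ext) simp
  have RS: "lin_fps c 1 * R (Suc p) = R p" for p
  proof (rule fps_ext)
    fix m
    show "fps_nth (lin_fps c 1 * R (Suc p)) m = fps_nth (R p) m"
    proof (cases m)
      case 0 thus ?thesis using assms by (simp add: lin_fps_def R_def ring_distribs binomial_eq_0)
    next
      case (Suc k)
      have "(Suc k + Suc p choose Suc p) = (Suc k + p choose p) + (k + Suc p choose Suc p)" by simp
      hence b: "of_nat (Suc k + Suc p choose Suc p) = (of_nat (Suc k + p choose p) + of_nat (k + Suc p choose Suc p) :: complex)"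
        by (simp only: of_nat_add)
      have "fps_nth (lin_fps c 1 * R (Suc p)) m = c * fps_nth (R (Suc p)) (Suc k) + fps_nth (R (Suc p)) k"
        by (simp add: lin_fps_def ring_distribs Suc mult.assoc)
      also have "\<dots> = fps_nth (R p) m"
      proof -
        have gen: "c * ((-1) ^ Suc k * (X + Y) / c ^ (Suc k + Suc p + 1)) + (-1) ^ k * Y / c ^ (k + Suc p + 1)
          = (-1) ^ Suc k * X / c ^ (Suc k + p + 1)" for X Y :: complex
        proof -
          define E where "E = c ^ (k + Suc p + 1)"
          have E: "c ^ (Suc k + Suc p + 1) = c * E" "c ^ (k + Suc p + 1) = E" "c ^ (Suc k + p + 1) = E" by (simp_all add: E_def)
          have "E \<noteq> 0" using assms by (simp add: E_def)
          thus ?thesis unfolding E using assms by (simp add: divide_simps) (simp add: algebra_simps)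
        qed
        show ?thesis unfolding R_def fps_nth_Abs_fps b Suc by (rule gen)
      qed
      finally show ?thesis .
    qed
  qed
  have R1: "R (Suc p) = R p * inverse (lin_fps c 1)" for p
  proof -
    have "R (Suc p) = R (Suc p) * (lin_fps c 1 * inverse (lin_fps c 1))" unfolding lin_fps_nz[OF assms] by (rule mult_1_right[symmetric])
    also have "\<dots> = (lin_fps c 1 * R (Suc p)) * inverse (lin_fps c 1)" by (simp only: mult_ac)
    finally show ?thesis unfolding RS .
  qed
  have "inverse (lin_fps c 1) ^ Suc p = R p"
  proof (induction p)
    case 0 show ?case unfolding R0 by simp
  next
    case (Suc p) show ?case unfolding power_Suc[of _ "Suc p"] Suc R1[of p] by (rule mult.commute)
  qed
  thus ?thesis by (simp add: R_def)
qed

lemma inverse_lin_fps_0: "c \<noteq> 0 \<Longrightarrow> inverse (lin_fps c 0) = fps_const (1 / c)"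
  unfolding inverse_lin_fps by (rule fps_ext) (simp add: power_0_left)

lemma lin_fps_scale: "lin_fps (k * c) (k * v) = fps_const k * lin_fps c v"
  by (rule fps_ext) (simp add: fps_nth_lin_fps)

lemma lin_fps_cancel:
  "(\<Prod>j<n. lin_fps (of_nat (Suc j)) v) * (\<Prod>j<Suc n. inverse (lin_fps (of_nat (Suc j)) v)) = inverse (lin_fps (of_nat (Suc n)) v)"
proof -
  have "(\<Prod>j<n. lin_fps (of_nat (Suc j)) v) * (\<Prod>j<n. inverse (lin_fps (of_nat (Suc j)) v)) = 1"
    unfolding prod.distrib[symmetric] by (intro prod.neutral ballI lin_fps_nz) (simp del: of_nat_Suc)
  thus ?thesis by (simp add: mult.assoc[symmetric])
qed

lemma of_nat_Suc_nz [simp]: "(1 + of_nat n :: complex) \<noteq> 0"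
  using of_nat_neq_0[of n] by (metis of_nat_Suc)

text \<open>With \<open>u 0 = 0\<close> and the other parameters equal to \<open>z\<close>, all
  numerators and denominators have the same parameter \<open>1 + z\<close>. Each quotient collapses
  to a reciprocal of \<open>n + 1 + z\<close>, and the linear factor is twice that number.\<close>

lemma wp_fps_face_4: "wp_fps (ind_par {1,2,3,4}) n = fps_const 2 * inverse (lin_fps (of_nat (Suc n)) 1) ^ 3"
proof -
  define u where "u = ind_par {1,2,3,4}"
  have u: "u 0 = 0" "u 1 = 1" "u 2 = 1" "u 3 = 1" "u 4 = 1" by (simp_all add: u_def ind_par_def)
  have p: "wp_par u = 2" unfolding wp_par_def u by simp
  define I where "I = inverse (lin_fps (of_nat (Suc n)) 1)"
  have l: "lin_fps (2 * of_nat n + 2) 2 = fps_const 2 * lin_fps (of_nat (Suc n)) 1"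
    unfolding lin_fps_scale[symmetric] by (simp add: algebra_simps)
  have LI: "lin_fps (of_nat (Suc n)) 1 * I = 1" unfolding I_def by (rule lin_fps_nz) (simp del: of_nat_Suc)
  have A: "2 - 1 = (1 :: complex)" by simp
  have "wp_fps u n = lin_fps (2 * of_nat n + 2) 2 * (I * I * I * I)"
    unfolding wp_fps_def p u prod_1_4 diff_zero A I_def lin_fps_cancel ..
  also have "\<dots> = fps_const 2 * I ^ 3 * (lin_fps (of_nat (Suc n)) 1 * I)" unfolding l by (simp add: power3_eq_cube mult_ac)
  finally show ?thesis unfolding LI by (simp add: u_def I_def)
qed

text \<open>No single quotient collapses here. The numerators for the two zeros cancel the
  denominators for the two ones and conversely, so the factors are regrouped before
  cancelling.\<close>

lemma wp_fps_face_2: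
  "wp_fps (ind_par {2,3}) n = lin_fps (2 * of_nat (Suc n)) 1 * inverse (lin_fps (of_nat (Suc n)) 1) ^ 2 * fps_const (1 / of_nat (Suc n) ^ 2)"
proof -
  define u where "u = ind_par {2,3}"
  have u: "u 0 = 0" "u 1 = 0" "u 2 = 1" "u 3 = 1" "u 4 = 0" by (simp_all add: u_def ind_par_def)
  have p: "wp_par u = 1" unfolding wp_par_def u by simp
  define P D where "P = (\<lambda>v. \<Prod>j<n. lin_fps (of_nat (Suc j)) v)" "D = (\<lambda>v. \<Prod>j<Suc n. inverse (lin_fps (of_nat (Suc j)) v))"
  have PD: "P v * D v = inverse (lin_fps (of_nat (Suc n)) v)" for v
    unfolding P_D_def by (rule lin_fps_cancel)
  have "wp_fps u n = lin_fps (2 * of_nat n + 2) 1 * ((P 1 * D 0) * (P 0 * D 1) * (P 0 * D 1) * (P 1 * D 0))"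
    unfolding wp_fps_def p u prod_1_4 diff_zero by (simp only: diff_self P_D_def)
  also have "\<dots> = lin_fps (2 * of_nat n + 2) 1 * ((P 1 * D 1) ^ 2 * (P 0 * D 0) ^ 2)"
    by (simp add: power2_eq_square mult_ac)
  also have "\<dots> = lin_fps (2 * of_nat (Suc n)) 1 * inverse (lin_fps (of_nat (Suc n)) 1) ^ 2 * fps_const (1 / of_nat (Suc n) ^ 2)"
    unfolding PD inverse_lin_fps_0[OF of_nat_neq_0] by (simp add: fps_const_power power_divide mult_ac add_ac)
  finally show ?thesis by (simp add: u_def)
qed

lemma wp_fps_face_0: "wp_fps (ind_par {}) n = fps_const (2 / of_nat (Suc n) ^ 3)"
proof -
  define u where "u = ind_par {}"
  have u: "u i = 0" for i by (simp_all add: u_def ind_par_def)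
  have p: "wp_par u = 0" unfolding wp_par_def u by simp
  have c: "lin_fps (2 * of_nat n + 2) 0 = fps_const (2 * of_nat (Suc n))"
    by (simp add: lin_fps_def algebra_simps)
  have nz: "(of_nat (Suc n) :: complex) \<noteq> 0" by (rule of_nat_neq_0)
  have "wp_fps u n = lin_fps (2 * of_nat n + 2) 0 * fps_const (1 / of_nat (Suc n)) ^ 4"
    unfolding wp_fps_def p u prod_1_4 diff_self lin_fps_cancel unfolding inverse_lin_fps_0[OF of_nat_neq_0]
    by (simp only: power4_eq_xxxx)
  also have "\<dots> = fps_const (2 / of_nat (Suc n) ^ 3)"
    unfolding c fps_const_power fps_const_mult using nz by (simp add: field_simps power3_eq_cube power4_eq_xxxx del: of_nat_Suc)
  finally show ?thesis by (simp add: u_def)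
qed

lemma wp_coeff_sums_eq:
  assumes "\<And>n. fps_nth (wp_fps (ind_par S) n) m = c * (1 / of_nat (Suc n) ^ k)" "k \<ge> 2" "S \<subseteq> {..<5}"
  shows "face_coeff m (card S) = c * zeta_nat k"
proof -
  have "(\<lambda>n. fps_nth (wp_fps (ind_par S) n) m) sums face_coeff m (card S)"
    using wp_coeff_sums[OF unit_ind_par, of S m] unfolding face_coeff_eq[OF assms(3)] .
  hence "(\<lambda>n. c * (1 / of_nat (Suc n) ^ k)) sums face_coeff m (card S)" unfolding assms(1) .
  moreover have "(\<lambda>n. c * (1 / of_nat (Suc n) ^ k)) sums (c * zeta_nat k)"
    by (intro sums_mult zeta_nat_sums assms(2))
  ultimately show ?thesis by (rule sums_unique2)
qed

lemma face_coeff_4: "face_coeff m 4 = 2 * (-1) ^ m * of_nat ((m + 2) choose 2) * zeta_nat (m + 3)"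
proof -
  have "face_coeff m (card {1,2,3,4::nat}) = 2 * (-1) ^ m * of_nat ((m + 2) choose 2) * zeta_nat (m + 3)"
  proof (rule wp_coeff_sums_eq)
    fix n
    have n: "Suc 2 = 3" "m + 2 + 1 = m + 3" by simp_all
    show "fps_nth (wp_fps (ind_par {1,2,3,4}) n) m = 2 * (-1) ^ m * of_nat ((m + 2) choose 2) * (1 / of_nat (Suc n) ^ (m + 3))"
      unfolding wp_fps_face_4 fps_mult_left_const_nth
        inverse_lin_fps_power_nth[OF of_nat_neq_0, of n 2 m, unfolded n] by (simp only: times_divide_eq_right mult_1_right mult.assoc)
  qed auto
  moreover have "card {1,2,3,4::nat} = 4" by simp
  ultimately show ?thesis by (simp only:)
qed

text \<open>The function is \<open>1 / (c + z) + c / (c + z) ^ 2\<close>, and the two parts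
  contribute 1 and \<open>m + 1\<close>.\<close>

lemma lin_inverse_lin_nth:
  assumes c: "c \<noteq> 0"
  shows "fps_nth (lin_fps (2 * c) 1 * inverse (lin_fps c 1) ^ 2) m = (-1) ^ m * of_nat (m + 2) / c ^ (m + 1)"
proof -
  define I where "I = inverse (lin_fps c 1)"
  have I2: "fps_nth (I ^ 2) k = (-1) ^ k * of_nat (k + 1) / c ^ (k + 2)" for k
    unfolding I_def using inverse_lin_fps_power_nth[OF c, of 1 k] by (simp add: numeral_2_eq_2)
  have "fps_nth (lin_fps (2 * c) 1 * I ^ 2) m = (-1) ^ m * of_nat (m + 2) / c ^ (m + 1)"
  proof (cases m)
    case 0
    have "fps_nth (lin_fps (2 * c) 1 * I ^ 2) 0 = 2 * c * fps_nth (I ^ 2) 0"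
      by (simp only: fps_mult_nth_0 fps_nth_lin_fps simp_thms if_True)
    also have "\<dots> = 2 / c" unfolding I2 using c by (simp add: power2_eq_square)
    finally have "fps_nth (lin_fps (2 * c) 1 * I ^ 2) 0 = 2 / c" .
    thus ?thesis unfolding 0 by (simp only:) simp
  next
    case (Suc k)
    have "fps_nth (lin_fps (2 * c) 1 * I ^ 2) m = 2 * c * fps_nth (I ^ 2) (Suc k) + fps_nth (I ^ 2) k"
      by (simp add: lin_fps_def ring_distribs Suc mult.assoc)
    also have "\<dots> = (-1) ^ m * of_nat (m + 2) / c ^ (m + 1)"
      unfolding I2 Suc using c by (simp add: field_simps)
    finally show ?thesis .
  qed
  thus ?thesis by (simp only: I_def)
qed

lemma face_coeff_2: "face_coeff m 2 = (-1) ^ m * of_nat (m + 2) * zeta_nat (m + 3)"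
proof -
  have "face_coeff m (card {2,3::nat}) = (-1) ^ m * of_nat (m + 2) * zeta_nat (m + 3)"
  proof (rule wp_coeff_sums_eq)
    fix n
    show "fps_nth (wp_fps (ind_par {2,3}) n) m = (-1) ^ m * of_nat (m + 2) * (1 / of_nat (Suc n) ^ (m + 3))"
      unfolding wp_fps_face_2 fps_mult_right_const_nth lin_inverse_lin_nth[OF of_nat_neq_0]
      by (simp add: power_add power2_eq_square power3_eq_cube)
  qed auto
  thus ?thesis by (simp add: numeral_2_eq_2)
qed

lemma face_coeff_0: "face_coeff m 0 = (if m = 0 then 2 * zeta_nat 3 else 0)"
proof -
  have "face_coeff m (card ({} :: nat set)) = of_bool (m = 0) * 2 * zeta_nat 3"
    by (rule wp_coeff_sums_eq) (simp_all add: wp_fps_face_0)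
  thus ?thesis by simp
qed

subsection \<open>Logarithmic derivatives in a parameter\<close>

text \<open>Here the differentiation is in the parameter \<open>d\<close> at 0, coefficient by
  coefficient, whereas \<open>log_deriv_fps\<close> differentiates in the series variable.\<close>

definition has_log_deriv :: "(complex \<Rightarrow> complex fps) \<Rightarrow> complex fps \<Rightarrow> bool" where
  "has_log_deriv F l \<longleftrightarrow> (\<forall>m. ((\<lambda>d. fps_nth (F d) m) has_field_derivative fps_nth (F 0 * l) m) (at 0))"

lemma has_log_deriv_mult:
  assumes "has_log_deriv F l" "has_log_deriv G k"
  shows "has_log_deriv (\<lambda>d. F d * G d) (l + k)"
  unfolding has_log_deriv_def
proof
  fix m
  have "((\<lambda>d. \<Sum>i=0..m. fps_nth (F d) i * fps_nth (G d) (m - i)) has_field_derivative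
     (\<Sum>i=0..m. fps_nth (F 0 * l) i * fps_nth (G 0) (m - i) + fps_nth (G 0 * k) (m - i) * fps_nth (F 0) i)) (at 0)"
    using assms unfolding has_log_deriv_def by (intro DERIV_sum DERIV_mult) auto
  also have "(\<Sum>i=0..m. fps_nth (F 0 * l) i * fps_nth (G 0) (m - i) + fps_nth (G 0 * k) (m - i) * fps_nth (F 0) i) =
     fps_nth ((F 0 * l) * G 0) m + fps_nth (F 0 * (G 0 * k)) m"
    by (simp only: fps_mult_nth[of "F 0 * l" "G 0" m] fps_mult_nth[of "F 0" "G 0 * k" m] sum.distrib
          mult.commute[of "fps_nth (G 0 * k) _"])
  also have "\<dots> = fps_nth (F 0 * G 0 * (l + k)) m" by (simp add: algebra_simps)
  finally show "((\<lambda>d. fps_nth (F d * G d) m) has_field_derivative fps_nth (F 0 * G 0 * (l + k)) m) (at 0)"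
    by (simp add: fps_mult_nth[of "F _"])
qed

lemma has_log_deriv_const: "has_log_deriv (\<lambda>_. c) 0"
  by (simp add: has_log_deriv_def)

lemma has_log_deriv_prod:
  "finite A \<Longrightarrow> (\<And>i. i \<in> A \<Longrightarrow> has_log_deriv (F i) (l i)) \<Longrightarrow> has_log_deriv (\<lambda>d. \<Prod>i\<in>A. F i d) (\<Sum>i\<in>A. l i)"
  by (induction rule: finite_induct) (auto intro: has_log_deriv_const has_log_deriv_mult)

lemma has_log_deriv_lin:
  assumes "c \<noteq> 0"
  shows "has_log_deriv (\<lambda>d. lin_fps c (a + b * d)) (fps_const b * fps_X * inverse (lin_fps c a))"
proof -
  have "lin_fps c (a + b * 0) * (fps_const b * fps_X * inverse (lin_fps c a)) = fps_const b * fps_X * (lin_fps c a * inverse (lin_fps c a))"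
    by (simp add: mult_ac)
  also have "\<dots> = fps_const b * fps_X" unfolding lin_fps_nz[OF assms] by simp
  finally have eq: "lin_fps c (a + b * 0) * (fps_const b * fps_X * inverse (lin_fps c a)) = fps_const b * fps_X" .
  show ?thesis unfolding has_log_deriv_def eq fps_nth_lin_fps
  proof
    fix m :: nat
    consider "m = 0" | "m = 1" | "m > 1" by linarith
    thus "((\<lambda>d. if m = 0 then c else if m = 1 then a + b * d else 0) has_field_derivative fps_nth (fps_const b * fps_X) m) (at 0)"
      by cases (auto intro!: derivative_eq_intros)
  qed
qed

lemma has_log_deriv_inverse_lin_0:
  assumes "c \<noteq> 0"
  shows "has_log_deriv (\<lambda>d. inverse (lin_fps c d)) (- fps_const (1 / c) * fps_X)"
proof -
  have eq: "inverse (lin_fps c 0) * (- fps_const (1 / c) * fps_X) = fps_const (- 1 / c ^ 2) * fps_X"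
  proof -
    have "fps_const (1 / c) * (- fps_const (1 / c)) = fps_const (- 1 / c ^ 2)" by (simp add: power2_eq_square)
    thus ?thesis unfolding inverse_lin_fps_0[OF assms] by (simp only: mult.assoc[symmetric])
  qed
  show ?thesis unfolding has_log_deriv_def eq unfolding inverse_lin_fps[OF assms] fps_nth_Abs_fps
  proof
    fix m :: nat
    have "((\<lambda>d. (-1) ^ m * d ^ m / c ^ Suc m) has_field_derivative (-1) ^ m * (of_nat m * 0 ^ (m - 1)) / c ^ Suc m) (at 0)"
      using assms by (auto intro!: derivative_eq_intros)
    also have "(-1) ^ m * (of_nat m * 0 ^ (m - 1)) / c ^ Suc m = fps_nth (fps_const (- 1 / c ^ 2) * fps_X) m"
      by (cases m; cases "m - 1") (auto simp: power2_eq_square)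
    finally show "((\<lambda>d. (-1) ^ m * d ^ m / c ^ Suc m) has_field_derivative fps_nth (fps_const (- 1 / c ^ 2) * fps_X) m) (at 0)" .
  qed
qed

lemma dir_deriv_log_deriv:
  assumes "has_log_deriv (\<lambda>d. wp_fps ((ind_par S)(j := d)) n) l" "j \<notin> S"
  shows "dir_deriv j (\<lambda>u. fps_nth (wp_fps u n) m) S = fps_nth (wp_fps (ind_par S) n * l) m"
proof -
  have "(ind_par S)(j := 0) = ind_par S" using assms(2) by (auto simp: ind_par_def)
  thus ?thesis using assms(1) unfolding has_log_deriv_def dir_deriv_def by (metis DERIV_imp_deriv)
qed

text \<open>On a coordinate axis only the \<open>m\<close>-th power of that coordinate survives, and
  its derivative at 0 vanishes for \<open>m\<close> at least 2.\<close>

lemma edge_coeff_0: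
  assumes "m \<ge> 2"
  shows "edge_coeff m 0 = 0"
proof -
  have "dir_deriv 0 (\<lambda>u. fps_nth (wp_fps u n) m) {} = 0" for n
  proof -
    obtain N :: nat and a w where w: "\<And>i. i < N \<Longrightarrow> length (w i) = m" "\<And>i. i < N \<Longrightarrow> set (w i) \<subseteq> {..<5}"
      "(\<lambda>u. fps_nth (wp_fps u n) m) = (\<lambda>u. \<Sum>i<N. a i * prod_list (map u (w i)))"
      using homog_words[OF wp_fps_homog[of m n]] by blast
    have "dir_deriv 0 (\<lambda>u. fps_nth (wp_fps u n) m) {} = (\<Sum>i<N. a i * of_bool (count_list (w i) 0 = 1 \<and> set (w i) \<subseteq> insert 0 {}))"
      by (rule dir_deriv_word_poly[OF w(3,2)]) auto
    also have "\<dots> = 0"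
    proof (intro sum.neutral ballI)
      fix i assume i: "i \<in> {..<N}"
      have "count_list v 0 = length v" if "set v \<subseteq> insert 0 {}" for v :: "nat list"
        using that by (induction v) auto
      thus "a i * of_bool (count_list (w i) 0 = 1 \<and> set (w i) \<subseteq> insert 0 {}) = 0"
        using w(1)[of i] i assms by fastforce
    qed
    finally show ?thesis .
  qed
  hence "(\<lambda>n. 0) sums dir_deriv 0 (\<lambda>u. wp_coeff u m) {}"
    using dir_deriv_sums[of 0 m "{}"] by simp
  moreover have "dir_deriv 0 (\<lambda>u. wp_coeff u m) {} = edge_coeff m 0"
    by (subst edge_coeff_eq) auto
  ultimately show ?thesis using sums_unique2 sums_zero by metis
qed

text \<open>The cubic form vanishes at \<open>d = 0\<close>, so the telescoped identity gives
  nothing here and the terms are differentiated. In the logarithmic derivative all harmonic sums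
  cancel except one last summand, which is why only single zeta values appear.\<close>

lemma edge_coeff_2:
  "edge_coeff (Suc k) 2 = - ((-1) ^ k * (of_nat (k + 3) / 2)) * zeta_nat (k + 4)"
proof -
  have ld: "has_log_deriv (\<lambda>d. wp_fps ((ind_par {2,3})(1 := d)) n)
     (fps_const (1/2) * fps_X * inverse (lin_fps (2 * of_nat n + 2) 1) - fps_const (1 / of_nat (Suc n)) * fps_X)" for n
  proof -
    define I where "I = (\<lambda>j v. inverse (lin_fps (of_nat (Suc j)) v))"
    have eq: "wp_fps ((ind_par {2,3})(1 := d)) n = lin_fps (2 * of_nat n + 2) (1 + 1/2 * d) *
       (((\<Prod>j<n. lin_fps (of_nat (Suc j)) (1 + -1/2 * d)) * (\<Prod>j<Suc n. inverse (lin_fps (of_nat (Suc j)) d))) *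
        ((\<Prod>j<n. lin_fps (of_nat (Suc j)) (0 + 1/2 * d)) * (\<Prod>j<Suc n. I j 1)) *
        ((\<Prod>j<n. lin_fps (of_nat (Suc j)) (0 + 1/2 * d)) * (\<Prod>j<Suc n. I j 1)) *
        ((\<Prod>j<n. lin_fps (of_nat (Suc j)) (1 + 1/2 * d)) * (\<Prod>j<Suc n. I j 0)))" for d
    proof -
      define u where "u = (ind_par {2,3})(1 := d)"
      have u: "u 0 = 0" "u 1 = d" "u 2 = 1" "u 3 = 1" "u 4 = 0" by (simp_all add: u_def ind_par_def)
      have p: "wp_par u = 1 + 1/2 * d" unfolding wp_par_def u by (simp add: field_simps)
      have q: "1 + 1/2 * d - d = 1 + -1/2 * d" "1 + 1/2 * d - 1 = 0 + 1/2 * d" "1 + 1/2 * d - 0 = 1 + 1/2 * d" by simp_all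
      show ?thesis unfolding u_def[symmetric] wp_fps_def p prod_1_4 u q I_def by (rule refl)
    qed
    have c: "(of_nat (Suc j) :: complex) \<noteq> 0" for j by (rule of_nat_neq_0)
    have c2: "(2 * of_nat n + 2 :: complex) \<noteq> 0" using c[of n] by (metis add_2_eq_Suc' c mult_2 of_nat_Suc of_nat_add of_nat_mult of_nat_numeral)
    have "has_log_deriv (\<lambda>d. wp_fps ((ind_par {2,3})(1 := d)) n)
      (fps_const (1/2) * fps_X * inverse (lin_fps (2 * of_nat n + 2) 1) +
       (((\<Sum>j<n. fps_const (-1/2) * fps_X * I j 1) + (\<Sum>j<Suc n. - fps_const (1 / of_nat (Suc j)) * fps_X)) +
        ((\<Sum>j<n. fps_const (1/2) * fps_X * I j 0) + 0) + ((\<Sum>j<n. fps_const (1/2) * fps_X * I j 0) + 0) +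
        ((\<Sum>j<n. fps_const (1/2) * fps_X * I j 1) + 0)))"
      unfolding eq unfolding I_def
      by (intro has_log_deriv_mult has_log_deriv_prod has_log_deriv_lin has_log_deriv_const has_log_deriv_inverse_lin_0 c c2 finite_lessThan)
    also have "(\<Sum>j<n. fps_const (-1/2) * fps_X * I j 1) = - (\<Sum>j<n. fps_const (1/2) * fps_X * I j 1)"
      unfolding sum_negf[symmetric] by (intro sum.cong refl) (simp flip: fps_const_neg)
    also have "(\<Sum>j<n. fps_const (1/2) * fps_X * I j 0) = (\<Sum>j<n. fps_const (1/2) * fps_X * fps_const (1 / of_nat (Suc j)))"
      unfolding I_def inverse_lin_fps_0[OF c] ..
    also have "\<dots> = (\<Sum>j<n. fps_const (1/2) * (fps_const (1 / of_nat (Suc j)) * fps_X))"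
      by (intro sum.cong refl) (simp only: mult_ac)
    also have "\<dots> = fps_const (1/2) * (\<Sum>j<n. fps_const (1 / of_nat (Suc j)) * fps_X)"
      by (simp only: sum_distrib_left)
    also have "(\<Sum>j<Suc n. - fps_const (1 / of_nat (Suc j) :: complex) * fps_X) = - (\<Sum>j<n. fps_const (1 / of_nat (Suc j)) * fps_X) - fps_const (1 / of_nat (Suc n)) * fps_X"
      by (simp only: mult_minus_left sum_negf sum.lessThan_Suc minus_add_distrib diff_conv_add_uminus)
    \<comment> \<open>\<open>a\<close> and \<open>b\<close> stand for the two harmonic sums, over
      shifted and unshifted arguments; \<open>x\<close> is the extra last factor of the
      denominator.\<close>
    also have "fps_const (1/2) * fps_X * inverse (lin_fps (2 * of_nat n + 2) 1) +
       (- a + (- b - x) + (fps_const (1/2) * b + 0) + (fps_const (1/2) * b + 0) + (a + 0))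
      = fps_const (1/2) * fps_X * inverse (lin_fps (2 * of_nat n + 2) 1) - x" for a b x :: "complex fps"
    proof -
      have "fps_const (1/2) * b + fps_const (1/2) * b = (fps_const (1/2) + fps_const (1/2 :: complex)) * b" by (rule distrib_right[symmetric])
      also have "fps_const (1/2) + fps_const (1/2 :: complex) = 1" by simp
      finally have "fps_const (1/2) * b + fps_const (1/2) * b = b" by simp
      thus ?thesis by (simp add: algebra_simps)
    qed
    finally show ?thesis .
  qed
  have deriv_term: "dir_deriv 1 (\<lambda>u. fps_nth (wp_fps u n) (Suc k)) {2,3} = - ((-1) ^ k * (of_nat (k + 3) / 2)) * (1 / of_nat (Suc n) ^ (k + 4))" for n
  proof -
    define c where "c = (of_nat (Suc n) :: complex)"
    have c: "c \<noteq> 0" unfolding c_def by (rule of_nat_neq_0)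
    have c2: "2 * of_nat n + 2 = 2 * c" by (simp add: c_def)
    define I L where "I = inverse (lin_fps c 1)" "L = lin_fps (2 * c) 1"
    note IL = this
    have LL: "L * inverse L = 1" unfolding IL by (rule lin_fps_nz) (use c in simp)
    have "dir_deriv 1 (\<lambda>u. fps_nth (wp_fps u n) (Suc k)) {2,3} = 
      fps_nth (L * I ^ 2 * fps_const (1 / c ^ 2) * (fps_const (1/2) * fps_X * inverse L - fps_const (1 / c) * fps_X)) (Suc k)"
      using dir_deriv_log_deriv[OF ld[of n], of "Suc k"] unfolding wp_fps_face_2 c2 c_def[symmetric] IL[symmetric] by simp
    also have "L * I ^ 2 * fps_const (1 / c ^ 2) * (fps_const (1/2) * fps_X * inverse L - fps_const (1 / c) * fps_X)
      = fps_X * (fps_const (1 / c ^ 2 * (1/2)) * (I ^ 2 * (L * inverse L)) - fps_const (1 / c ^ 2 * (1 / c)) * (L * I ^ 2))"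
      unfolding fps_const_mult[symmetric] by (simp only: right_diff_distrib mult_ac)
    also have "fps_nth \<dots> (Suc k) = 1 / c ^ 2 * (1/2) * fps_nth (I ^ 2) k - 1 / c ^ 2 * (1 / c) * fps_nth (L * I ^ 2) k"
      unfolding LL by simp
    also have "fps_nth (I ^ 2) k = (-1) ^ k * of_nat (k + 1) / c ^ (k + 2)"
      unfolding IL using inverse_lin_fps_power_nth[OF c, of 1 k] by (simp add: numeral_2_eq_2)
    also have "fps_nth (L * I ^ 2) k = (-1) ^ k * of_nat (k + 2) / c ^ (k + 1)"
      unfolding IL by (rule lin_inverse_lin_nth[OF c])
    also have "1 / c ^ 2 * (1/2) * ((-1) ^ k * of_nat (k + 1) / c ^ (k + 2)) - 1 / c ^ 2 * (1 / c) * ((-1) ^ k * of_nat (k + 2) / c ^ (k + 1))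
       = - ((-1) ^ k * (of_nat (k + 3) / 2)) * (1 / c ^ (k + 4))"
    proof -
      define E where "E = c ^ (k + 1)"
      have E: "c ^ (k + 1) = E" "c ^ (k + 2) = c * E" "c ^ (k + 4) = c * c * c * E" by (simp_all add: E_def eval_nat_numeral)
      have "E \<noteq> 0" using c by (simp add: E_def)
      thus ?thesis unfolding E using c by (simp add: divide_simps power2_eq_square) (simp add: algebra_simps)
    qed
    finally show ?thesis by (simp only: c_def)
  qed
  have "(\<lambda>n. - ((-1) ^ k * (of_nat (k + 3) / 2)) * (1 / of_nat (Suc n) ^ (k + 4))) sums dir_deriv 1 (\<lambda>u. wp_coeff u (Suc k)) {2,3}"
    using dir_deriv_sums[of 1 "Suc k" "{2,3}"] unfolding deriv_term by simp
  moreover have "(\<lambda>n. - ((-1) ^ k * (of_nat (k + 3) / 2)) * (1 / of_nat (Suc n) ^ (k + 4))) sums (- ((-1) ^ k * (of_nat (k + 3) / 2)) * zeta_nat (k + 4))"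
    by (intro sums_mult zeta_nat_sums) simp
  moreover have "dir_deriv 1 (\<lambda>u. wp_coeff u (Suc k)) {2,3} = edge_coeff (Suc k) 2"
  proof -
    have "card {2,3::nat} = 2" by simp
    thus ?thesis by (subst edge_coeff_eq) (auto simp: numeral_2_eq_2)
  qed
  ultimately show ?thesis using sums_unique2 by metis
qed

subsection \<open>Double zeta values\<close>

definition rzeta :: "nat \<Rightarrow> real" where
  "rzeta k = (\<Sum>n. 1 / real (Suc n) ^ k)"

text \<open>The double zeta value with larger index \<open>m + n + 2\<close> and smaller index
  \<open>n + 1\<close>. In these coordinates the domain is the whole quadrant and the reciprocals of
  \<open>m + 1\<close>, \<open>n + 1\<close> and \<open>m + n + 2\<close> satisfy the relation
  \<open>X * Y = Z * X + Z * Y\<close>.\<close>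

definition rdzeta :: "nat \<Rightarrow> nat \<Rightarrow> real" where
  "rdzeta a b = infsum (\<lambda>(m,n). (1 / real (m + n + 2)) ^ a * (1 / real (Suc n)) ^ b) UNIV"

lemma rzeta_sums: "k \<ge> 2 \<Longrightarrow> (\<lambda>n. (1 / real (Suc n)) ^ k) sums rzeta k"
proof -
  assume "k \<ge> 2"
  hence "summable (\<lambda>n. inverse (real (Suc n) ^ k))"
    using inverse_power_summable[of k] by (subst summable_Suc_iff)
  thus ?thesis unfolding rzeta_def power_one_over by (intro summable_sums) (simp add: inverse_eq_divide)
qed

lemma rzeta_has_sum: "k \<ge> 2 \<Longrightarrow> ((\<lambda>n. (1 / real (Suc n)) ^ k) has_sum rzeta k) UNIV"
  by (rule sums_nonneg_imp_has_sum[OF rzeta_sums]) auto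

lemma zeta_nat_rzeta: "k \<ge> 2 \<Longrightarrow> zeta_nat k = of_real (rzeta k)"
proof -
  assume k: "k \<ge> 2"
  have "(\<lambda>n. of_real ((1 / real (Suc n)) ^ k)) sums (of_real (rzeta k) :: complex)"
    by (intro sums_of_real rzeta_sums k)
  hence "(\<lambda>n. 1 / of_nat (Suc n) ^ k) sums (of_real (rzeta k) :: complex)"
    by (simp add: power_one_over)
  thus ?thesis using zeta_nat_sums[OF k] sums_unique2 by blast
qed

lemma product_has_sum:
  fixes f g :: "nat \<Rightarrow> real"
  assumes "(f has_sum a) UNIV" "(g has_sum b) UNIV" "\<And>n. f n \<ge> 0" "\<And>n. g n \<ge> 0"
  shows "((\<lambda>(m,n). f m * g n) has_sum a * b) UNIV"
proof -
  have inner: "((\<lambda>n. (\<lambda>(m,n). f m * g n) (m, n)) has_sum f m * b) UNIV" for m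
    using has_sum_cmult_right[OF assms(2)] by simp
  have outer: "((\<lambda>m. f m * b) has_sum a * b) UNIV" by (rule has_sum_cmult_left[OF assms(1)])
  have "(\<lambda>(m,n). f m * g n) summable_on Sigma UNIV (\<lambda>_. UNIV)"
    by (rule summable_on_SigmaI[OF inner has_sum_imp_summable[OF outer]]) (use assms in auto)
  from has_sum_SigmaI[OF inner outer this] show ?thesis by simp
qed

text \<open>The delicate exponents are 2 and 1. Splitting the inverse square of \<open>p\<close>
  into exponents -3/2 and -1/2 lets one part dominate decay in \<open>m\<close> and the other
  complete the decay in \<open>n\<close>.\<close>

lemma rdzeta_summable:
  assumes "a \<ge> 2" "b \<ge> 1"
  shows "(\<lambda>(m,n). (1 / real (m + n + 2)) ^ a * (1 / real (Suc n)) ^ b) summable_on UNIV"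
proof (rule summable_on_comparison_test)
  have "summable (\<lambda>n. real n powr (-3/2))" by (subst summable_real_powr_iff) auto
  hence "summable (\<lambda>n. real (Suc n) powr (-3/2))" by (subst summable_Suc_iff)
  hence s: "((\<lambda>n. real (Suc n) powr (-3/2)) has_sum (\<Sum>n. real (Suc n) powr (-3/2))) UNIV"
    by (intro sums_nonneg_imp_has_sum summable_sums) auto
  show "(\<lambda>(m,n). real (Suc m) powr (-3/2) * real (Suc n) powr (-3/2)) summable_on UNIV"
    by (rule has_sum_imp_summable[OF product_has_sum[OF s s]]) auto
  fix x :: "nat \<times> nat"
  obtain m n where x: "x = (m, n)" by (cases x)
  define p where "p = real (m + n + 2)"
  have p: "p \<ge> real (Suc m)" "p \<ge> real (Suc n)" "p \<ge> 1" by (auto simp: p_def)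
  have "(1 / p) ^ a * (1 / real (Suc n)) ^ b \<le> (1 / p) ^ 2 * (1 / real (Suc n)) ^ 1"
    using assms p by (intro mult_mono power_decreasing) auto
  also have "(1 / p) ^ 2 = p powr (-3/2) * p powr (-1/2)"
    using p by (simp add: powr_add[symmetric] powr_minus_divide power_one_over powr_numeral)
  also have "\<dots> \<le> real (Suc m) powr (-3/2) * real (Suc n) powr (-1/2)"
    using p by (intro mult_mono powr_mono2') auto
  hence "p powr (-3/2) * p powr (-1/2) * (1 / real (Suc n)) ^ 1 \<le> real (Suc m) powr (-3/2) * real (Suc n) powr (-1/2) * (1 / real (Suc n)) ^ 1"
    by (intro mult_right_mono) auto
  also have "(1 / real (Suc n)) ^ 1 = real (Suc n) powr (-1)" by (simp add: powr_minus_divide del: of_nat_Suc)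
  also have "real (Suc m) powr (-3/2) * real (Suc n) powr (-1/2) * real (Suc n) powr (-1) = real (Suc m) powr (-3/2) * real (Suc n) powr (-3/2)"
    by (simp only: mult.assoc powr_add[symmetric]) simp
  finally show "(case x of (m, n) \<Rightarrow> (1 / real (m + n + 2)) ^ a * (1 / real (Suc n)) ^ b) \<le>
     (case x of (m, n) \<Rightarrow> real (Suc m) powr (-3/2) * real (Suc n) powr (-3/2))"
    by (simp add: x p_def)
  show "0 \<le> (case x of (m, n) \<Rightarrow> (1 / real (m + n + 2)) ^ a * (1 / real (Suc n)) ^ b)" by (simp add: x)
qed

lemma rdzeta_has_sum:
  assumes "a \<ge> 2" "b \<ge> 1"
  shows "((\<lambda>(m,n). (1 / real (m + n + 2)) ^ a * (1 / real (Suc n)) ^ b) has_sum rdzeta a b) UNIV"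
  unfolding rdzeta_def by (rule has_sum_infsum[OF rdzeta_summable[OF assms]])

lemma rdzeta_has_sum':
  assumes "a \<ge> 2" "b \<ge> 1"
  shows "((\<lambda>(m,n). (1 / real (m + n + 2)) ^ a * (1 / real (Suc m)) ^ b) has_sum rdzeta a b) UNIV"
  using rdzeta_has_sum[OF assms] has_sum_swap[where f = "\<lambda>(m,n). (1 / real (m + n + 2)) ^ a * (1 / real (Suc n)) ^ b" and S = "rdzeta a b" and A = UNIV and B = UNIV]
  by (simp add: add_ac)

lemma rdzeta_sums:
  assumes "a \<ge> 2" "b \<ge> 1"
  shows "(\<lambda>n. (1 / real (Suc n)) ^ a * (\<Sum>j<n. (1 / real (Suc j)) ^ b)) sums rdzeta a b"
proof -
  define f where "f = (\<lambda>(n,j). (1 / real (Suc n)) ^ a * (1 / real (Suc j)) ^ b)"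
  have bij: "bij_betw (\<lambda>(m,n). (m + n + 1, n)) (UNIV :: (nat \<times> nat) set) (Sigma UNIV (\<lambda>n. {..<n}))"
    by (rule bij_betwI[where g = "\<lambda>(n,j). (n - j - 1, j)"]) auto
  have "((\<lambda>x. f (case x of (m,n) \<Rightarrow> (m + n + 1, n))) has_sum rdzeta a b) UNIV"
    using rdzeta_has_sum[OF assms] by (simp add: f_def case_prod_unfold add_ac)
  hence "(f has_sum rdzeta a b) (Sigma UNIV (\<lambda>n. {..<n}))"
    unfolding has_sum_reindex_bij_betw[OF bij] .
  hence "((\<lambda>n. \<Sum>j<n. f (n, j)) has_sum rdzeta a b) UNIV"
    by (rule has_sum_SigmaD) (rule has_sum_finite, simp)
  hence "(\<lambda>n. \<Sum>j<n. f (n, j)) sums rdzeta a b" by (rule has_sum_imp_sums)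
  thus ?thesis by (simp add: f_def sum_distrib_left)
qed

lemma rzeta_stuffle:
  assumes "a \<ge> 2" "b \<ge> 2"
  shows "rzeta a * rzeta b = rdzeta a b + rdzeta b a + rzeta (a + b)"
proof -
  define f where "f = (\<lambda>(i,j). (1 / real (Suc i)) ^ a * (1 / real (Suc j)) ^ b)"
  have f: "(f has_sum rzeta a * rzeta b) UNIV"
    unfolding f_def by (rule product_has_sum[OF rzeta_has_sum rzeta_has_sum]) (use assms in auto)
  have b1: "bij_betw (\<lambda>(m,n). (m + n + 1, n)) (UNIV :: (nat \<times> nat) set) {(i,j). j < i}"
    by (rule bij_betwI[where g = "\<lambda>(n,j). (n - j - 1, j)"]) auto
  have b2: "bij_betw (\<lambda>(m,n). (n, m + n + 1)) (UNIV :: (nat \<times> nat) set) {(i,j). i < j}"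
    by (rule bij_betwI[where g = "\<lambda>(n,j). (j - n - 1, n)"]) auto
  have b3: "bij_betw (\<lambda>i. (i, i)) (UNIV :: nat set) {(i,j). i = j}"
    by (rule bij_betwI[where g = fst]) auto
  have 1: "(f has_sum rdzeta a b) {(i,j). j < i}"
    unfolding has_sum_reindex_bij_betw[OF b1, symmetric]
    using rdzeta_has_sum[of a b] assms by (simp add: f_def case_prod_unfold add_ac)
  have 2: "(f has_sum rdzeta b a) {(i,j). i < j}"
    unfolding has_sum_reindex_bij_betw[OF b2, symmetric]
    using rdzeta_has_sum[of b a] assms by (simp add: f_def case_prod_unfold add_ac mult.commute)
  have 3: "(f has_sum rzeta (a + b)) {(i,j). i = j}"
    unfolding has_sum_reindex_bij_betw[OF b3, symmetric]
    using rzeta_has_sum[of "a + b"] assms by (simp add: f_def power_add)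
  have "(f has_sum rdzeta a b + rdzeta b a) ({(i,j). j < i} \<union> {(i,j). i < j})"
    by (rule has_sum_Un_disjoint[OF 1 2]) auto
  hence "(f has_sum rdzeta a b + rdzeta b a + rzeta (a + b)) ({(i,j). j < i} \<union> {(i,j). i < j} \<union> {(i,j). i = j})"
    by (rule has_sum_Un_disjoint[OF _ 3]) auto
  also have "{(i,j). j < i} \<union> {(i,j). i < j} \<union> {(i,j). i = j} = (UNIV :: (nat \<times> nat) set)" by auto
  finally show ?thesis using f has_sum_unique by blast
qed

text \<open>The intended values are the reciprocals of two positive integers and of their
  sum.\<close>

lemma partial_fractions:
  fixes X Y Z :: real
  assumes z: "X * Y = Z * X + Z * Y"
  shows "X * Y ^ Suc s = Z ^ Suc s * X + (\<Sum>i\<le>s. Z ^ Suc i * Y ^ (Suc s - i))"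
proof (induction s)
  case 0 thus ?case using z by simp
next
  case (Suc s)
  have "X * Y ^ Suc (Suc s) = (X * Y ^ Suc s) * Y" by (simp add: mult_ac)
  also have "\<dots> = Z ^ Suc s * (X * Y) + (\<Sum>i\<le>s. Z ^ Suc i * Y ^ (Suc s - i)) * Y"
    unfolding Suc by (simp add: algebra_simps)
  also have "(\<Sum>i\<le>s. Z ^ Suc i * Y ^ (Suc s - i)) * Y = (\<Sum>i\<le>s. Z ^ Suc i * Y ^ (Suc (Suc s) - i))"
    unfolding sum_distrib_right by (intro sum.cong refl) (simp add: Suc_diff_le mult_ac)
  also have "Z ^ Suc s * (X * Y) = Z ^ Suc (Suc s) * X + Z ^ Suc (Suc s) * Y" unfolding z by (simp add: algebra_simps)
  finally show ?case by simp
qed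

lemma harmonic_difference_has_sum:
  "((\<lambda>m. 1 / real (Suc m) - 1 / real (m + n + 2)) has_sum (\<Sum>j<Suc n. 1 / real (Suc j))) UNIV"
proof (rule sums_nonneg_imp_has_sum)
  show "(\<lambda>m. 1 / real (Suc m) - 1 / real (m + n + 2)) sums (\<Sum>j<Suc n. 1 / real (Suc j))"
  proof (induction n)
    case 0
    have "(\<lambda>m. 1 / real (Suc m) - 1 / real (Suc (Suc m))) sums (1 / real (Suc 0) - 0)"
      by (rule telescope_sums'[where f = "\<lambda>m. 1 / real (Suc m)"]) (use LIMSEQ_inverse_real_of_nat in \<open>simp add: inverse_eq_divide\<close>)
    thus ?case by simp
  next
    case (Suc n)
    have "(\<lambda>m. 1 / real (Suc (m + n + 1)) - 1 / real (Suc (Suc (m + n + 1)))) sums (1 / real (Suc (0 + n + 1)) - 0)"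
    proof (rule telescope_sums'[where f = "\<lambda>m. 1 / real (Suc (m + n + 1))", simplified add_Suc])
      show "(\<lambda>m. 1 / real (Suc (m + n + 1))) \<longlonglongrightarrow> 0"
        using LIMSEQ_ignore_initial_segment[OF LIMSEQ_inverse_real_of_nat, of "n + 1"] by (simp add: inverse_eq_divide add_ac)
    qed
    from sums_add[OF Suc this] show ?case by (simp add: add_ac)
  qed
qed (simp add: frac_le)

lemma has_sum_finite_family:
  fixes f :: "'a \<Rightarrow> 'b \<Rightarrow> real"
  assumes "\<And>i. i \<in> I \<Longrightarrow> (f i has_sum S i) A"
  shows "((\<lambda>x. \<Sum>i\<in>I. f i x) has_sum (\<Sum>i\<in>I. S i)) A"
proof (cases "finite I")
  case True
  thus ?thesis using assms by (induction rule: finite_induct) (auto intro!: has_sum_add)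
qed auto

text \<open>Euler's sum formula. The shuffle product with the divergent series at exponent 1 is
  regularised by subtracting \<open>Z\<close> from \<open>X\<close>, which removes exactly the
  divergent term of the partial fraction expansion. The resulting double series is evaluated in two
  ways, and \<open>rdzeta s 1\<close> drops out.\<close>

lemma rdzeta_sum_formula:
  assumes "s \<ge> 2"
  shows "rzeta (Suc s) = (\<Sum>a=2..s. rdzeta a (Suc s - a))"
proof -
  obtain t where t: "s = Suc t" using assms by (cases s) auto
  define X Y where "X = (\<lambda>m::nat. 1 / real (Suc m))" "Y = (\<lambda>n::nat. 1 / real (Suc n))"
  define Z where "Z = (\<lambda>m n::nat. 1 / real (m + n + 2))"
  define f where "f = (\<lambda>(n,m). (X m - Z m n) * Y n ^ s)"
  have xyz: "X m * Y n = Z m n * X m + Z m n * Y n" for m n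
    unfolding X_Y_def Z_def by (simp add: divide_simps)
  have feq: "f (n, m) = Z m n ^ s * X m ^ 1 + (\<Sum>a=2..s. Z m n ^ a * Y n ^ (Suc s - a))" for m n
  proof -
    have "X m * Y n ^ s = Z m n ^ s * X m + (\<Sum>i\<le>t. Z m n ^ Suc i * Y n ^ (s - i))"
      unfolding t by (rule partial_fractions[OF xyz])
    also have "(\<Sum>i\<le>t. Z m n ^ Suc i * Y n ^ (s - i)) = (\<Sum>a=1..s. Z m n ^ a * Y n ^ (Suc s - a))"
      unfolding t by (rule sum.reindex_bij_witness[where i = "\<lambda>a. a - 1" and j = Suc]) auto
    also have "{1..s} = insert 1 {2..s}" using assms by auto
    also have "(\<Sum>a\<in>insert 1 {2..s}. Z m n ^ a * Y n ^ (Suc s - a)) = Z m n * Y n ^ s + (\<Sum>a=2..s. Z m n ^ a * Y n ^ (Suc s - a))"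
      by simp
    finally show ?thesis by (simp add: f_def algebra_simps)
  qed
  have "((\<lambda>(m,n). Z m n ^ s * X m ^ 1 + (\<Sum>a=2..s. Z m n ^ a * Y n ^ (Suc s - a))) has_sum
     (rdzeta s 1 + (\<Sum>a=2..s. rdzeta a (Suc s - a)))) UNIV"
    unfolding case_prod_unfold
    by (intro has_sum_add has_sum_finite_family) (use rdzeta_has_sum'[of s 1] rdzeta_has_sum assms in \<open>auto simp: X_Y_def Z_def case_prod_unfold\<close>)
  hence "((\<lambda>(n,m). Z m n ^ s * X m ^ 1 + (\<Sum>a=2..s. Z m n ^ a * Y n ^ (Suc s - a))) has_sum
     (rdzeta s 1 + (\<Sum>a=2..s. rdzeta a (Suc s - a)))) (UNIV \<times> UNIV)"
    by (subst has_sum_swap) (simp add: case_prod_unfold)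
  hence fs: "(f has_sum (rdzeta s 1 + (\<Sum>a=2..s. rdzeta a (Suc s - a)))) (UNIV \<times> UNIV)"
    by (rule has_sum_cong[THEN iffD1, rotated]) (auto simp: feq)
  \<comment> \<open>Summing over \<open>m\<close> first telescopes to a harmonic number of length
    \<open>n + 1\<close>; its last term produces the single zeta value, the others
    \<open>rdzeta s 1\<close>.\<close>
  have inner: "((\<lambda>m. f (n, m)) has_sum (\<Sum>j<Suc n. 1 / real (Suc j)) * Y n ^ s) UNIV" for n
    unfolding f_def prod.case X_Y_def Z_def
    by (rule has_sum_cmult_left[OF harmonic_difference_has_sum])
  have "((\<lambda>n. (\<Sum>j<Suc n. 1 / real (Suc j)) * Y n ^ s) has_sum (rdzeta s 1 + (\<Sum>a=2..s. rdzeta a (Suc s - a)))) UNIV"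
    by (rule has_sum_SigmaD[OF fs inner])
  hence "(\<lambda>n. (\<Sum>j<Suc n. 1 / real (Suc j)) * Y n ^ s) sums (rdzeta s 1 + (\<Sum>a=2..s. rdzeta a (Suc s - a)))"
    by (rule has_sum_imp_sums)
  moreover have "(\<lambda>n. (1 / real (Suc n)) ^ s * (\<Sum>j<n. (1 / real (Suc j)) ^ 1) + (1 / real (Suc n)) ^ (Suc s)) sums (rdzeta s 1 + rzeta (Suc s))"
    by (intro sums_add rdzeta_sums rzeta_sums) (use assms in auto)
  moreover have "(1 / real (Suc n)) ^ s * (\<Sum>j<n. (1 / real (Suc j)) ^ 1) + (1 / real (Suc n)) ^ (Suc s) = (\<Sum>j<Suc n. 1 / real (Suc j)) * Y n ^ s" for n
    by (simp add: X_Y_def algebra_simps)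
  ultimately show ?thesis using sums_unique2 by fastforce
qed

text \<open>The exponent of \<open>X\<close> is raised by one at a time: the previous expansion is
  multiplied by \<open>X\<close>, and every product of \<open>X\<close> with a power of
  \<open>Y\<close> is expanded again.\<close>

lemma shuffle_partial_fractions:
  fixes X Y Z :: real
  assumes z: "X * Y = Z * X + Z * Y"
  shows "X ^ 2 * Y ^ 6 = (Z ^ 2 * Y ^ 6) + 2 * (Z ^ 3 * Y ^ 5) + 3 * (Z ^ 4 * Y ^ 4) + 4 * (Z ^ 5 * Y ^ 3) + 5 * (Z ^ 6 * Y ^ 2) + 6 * (Z ^ 7 * Y ^ 1) + (Z ^ 6 * X ^ 2) + 6 * (Z ^ 7 * X ^ 1)"
    "X ^ 2 * Y ^ 7 = (Z ^ 2 * Y ^ 7) + 2 * (Z ^ 3 * Y ^ 6) + 3 * (Z ^ 4 * Y ^ 5) + 4 * (Z ^ 5 * Y ^ 4) + 5 * (Z ^ 6 * Y ^ 3) + 6 * (Z ^ 7 * Y ^ 2) + 7 * (Z ^ 8 * Y ^ 1) + (Z ^ 7 * X ^ 2) + 7 * (Z ^ 8 * X ^ 1)"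
    "X ^ 3 * Y ^ 6 = (Z ^ 3 * Y ^ 6) + 3 * (Z ^ 4 * Y ^ 5) + 6 * (Z ^ 5 * Y ^ 4) + 10 * (Z ^ 6 * Y ^ 3) + 15 * (Z ^ 7 * Y ^ 2) + 21 * (Z ^ 8 * Y ^ 1) + (Z ^ 6 * X ^ 3) + 6 * (Z ^ 7 * X ^ 2) + 21 * (Z ^ 8 * X ^ 1)"
    "X ^ 4 * Y ^ 5 = (Z ^ 4 * Y ^ 5) + 4 * (Z ^ 5 * Y ^ 4) + 10 * (Z ^ 6 * Y ^ 3) + 20 * (Z ^ 7 * Y ^ 2) + 35 * (Z ^ 8 * Y ^ 1) + (Z ^ 5 * X ^ 4) + 5 * (Z ^ 6 * X ^ 3) + 15 * (Z ^ 7 * X ^ 2) + 35 * (Z ^ 8 * X ^ 1)"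
proof -
  have p1_1: "X ^ 1 * Y ^ 1 = (Z ^ 1 * Y ^ 1) + (Z ^ 1 * X ^ 1)"
    using partial_fractions[OF z, of 0] by (simp add: eval_nat_numeral algebra_simps)
  have p1_2: "X ^ 1 * Y ^ 2 = (Z ^ 1 * Y ^ 2) + (Z ^ 2 * Y ^ 1) + (Z ^ 2 * X ^ 1)"
    using partial_fractions[OF z, of 1] by (simp add: eval_nat_numeral algebra_simps)
  have p1_3: "X ^ 1 * Y ^ 3 = (Z ^ 1 * Y ^ 3) + (Z ^ 2 * Y ^ 2) + (Z ^ 3 * Y ^ 1) + (Z ^ 3 * X ^ 1)"
    using partial_fractions[OF z, of 2] by (simp add: eval_nat_numeral algebra_simps)
  have p1_4: "X ^ 1 * Y ^ 4 = (Z ^ 1 * Y ^ 4) + (Z ^ 2 * Y ^ 3) + (Z ^ 3 * Y ^ 2) + (Z ^ 4 * Y ^ 1) + (Z ^ 4 * X ^ 1)"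
    using partial_fractions[OF z, of 3] by (simp add: eval_nat_numeral algebra_simps)
  have p1_5: "X ^ 1 * Y ^ 5 = (Z ^ 1 * Y ^ 5) + (Z ^ 2 * Y ^ 4) + (Z ^ 3 * Y ^ 3) + (Z ^ 4 * Y ^ 2) + (Z ^ 5 * Y ^ 1) + (Z ^ 5 * X ^ 1)"
    using partial_fractions[OF z, of 4] by (simp add: eval_nat_numeral algebra_simps)
  have p1_6: "X ^ 1 * Y ^ 6 = (Z ^ 1 * Y ^ 6) + (Z ^ 2 * Y ^ 5) + (Z ^ 3 * Y ^ 4) + (Z ^ 4 * Y ^ 3) + (Z ^ 5 * Y ^ 2) + (Z ^ 6 * Y ^ 1) + (Z ^ 6 * X ^ 1)"
    using partial_fractions[OF z, of 5] by (simp add: eval_nat_numeral algebra_simps)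
  have p1_7: "X ^ 1 * Y ^ 7 = (Z ^ 1 * Y ^ 7) + (Z ^ 2 * Y ^ 6) + (Z ^ 3 * Y ^ 5) + (Z ^ 4 * Y ^ 4) + (Z ^ 5 * Y ^ 3) + (Z ^ 6 * Y ^ 2) + (Z ^ 7 * Y ^ 1) + (Z ^ 7 * X ^ 1)"
    using partial_fractions[OF z, of 6] by (simp add: eval_nat_numeral algebra_simps)
  have p2_5: "X ^ 2 * Y ^ 5 = (Z ^ 2 * Y ^ 5) + 2 * (Z ^ 3 * Y ^ 4) + 3 * (Z ^ 4 * Y ^ 3) + 4 * (Z ^ 5 * Y ^ 2) + 5 * (Z ^ 6 * Y ^ 1) + (Z ^ 5 * X ^ 2) + 5 * (Z ^ 6 * X ^ 1)"
  proof -
    have "X ^ 2 * Y ^ 5 = X * (X ^ 1 * Y ^ 5)" by (simp add: eval_nat_numeral)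
    also have "\<dots> = Z ^ 1 * (X ^ 1 * Y ^ 5) + Z ^ 2 * (X ^ 1 * Y ^ 4) + Z ^ 3 * (X ^ 1 * Y ^ 3) + Z ^ 4 * (X ^ 1 * Y ^ 2) + Z ^ 5 * (X ^ 1 * Y ^ 1) + Z ^ 5 * X ^ 2"
      by (subst p1_5) (simp add: eval_nat_numeral algebra_simps)
    also have "\<dots> = (Z ^ 2 * Y ^ 5) + 2 * (Z ^ 3 * Y ^ 4) + 3 * (Z ^ 4 * Y ^ 3) + 4 * (Z ^ 5 * Y ^ 2) + 5 * (Z ^ 6 * Y ^ 1) + (Z ^ 5 * X ^ 2) + 5 * (Z ^ 6 * X ^ 1)"
      unfolding p1_1 p1_2 p1_3 p1_4 p1_5 by (simp add: eval_nat_numeral algebra_simps)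
    finally show ?thesis .
  qed
  have p2_6: "X ^ 2 * Y ^ 6 = (Z ^ 2 * Y ^ 6) + 2 * (Z ^ 3 * Y ^ 5) + 3 * (Z ^ 4 * Y ^ 4) + 4 * (Z ^ 5 * Y ^ 3) + 5 * (Z ^ 6 * Y ^ 2) + 6 * (Z ^ 7 * Y ^ 1) + (Z ^ 6 * X ^ 2) + 6 * (Z ^ 7 * X ^ 1)"
  proof -
    have "X ^ 2 * Y ^ 6 = X * (X ^ 1 * Y ^ 6)" by (simp add: eval_nat_numeral)
    also have "\<dots> = Z ^ 1 * (X ^ 1 * Y ^ 6) + Z ^ 2 * (X ^ 1 * Y ^ 5) + Z ^ 3 * (X ^ 1 * Y ^ 4) + Z ^ 4 * (X ^ 1 * Y ^ 3) + Z ^ 5 * (X ^ 1 * Y ^ 2) + Z ^ 6 * (X ^ 1 * Y ^ 1) + Z ^ 6 * X ^ 2"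
      by (subst p1_6) (simp add: eval_nat_numeral algebra_simps)
    also have "\<dots> = (Z ^ 2 * Y ^ 6) + 2 * (Z ^ 3 * Y ^ 5) + 3 * (Z ^ 4 * Y ^ 4) + 4 * (Z ^ 5 * Y ^ 3) + 5 * (Z ^ 6 * Y ^ 2) + 6 * (Z ^ 7 * Y ^ 1) + (Z ^ 6 * X ^ 2) + 6 * (Z ^ 7 * X ^ 1)"
      unfolding p1_1 p1_2 p1_3 p1_4 p1_5 p1_6 by (simp add: eval_nat_numeral algebra_simps)
    finally show ?thesis .
  qed
  have p2_7: "X ^ 2 * Y ^ 7 = (Z ^ 2 * Y ^ 7) + 2 * (Z ^ 3 * Y ^ 6) + 3 * (Z ^ 4 * Y ^ 5) + 4 * (Z ^ 5 * Y ^ 4) + 5 * (Z ^ 6 * Y ^ 3) + 6 * (Z ^ 7 * Y ^ 2) + 7 * (Z ^ 8 * Y ^ 1) + (Z ^ 7 * X ^ 2) + 7 * (Z ^ 8 * X ^ 1)"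
  proof -
    have "X ^ 2 * Y ^ 7 = X * (X ^ 1 * Y ^ 7)" by (simp add: eval_nat_numeral)
    also have "\<dots> = Z ^ 1 * (X ^ 1 * Y ^ 7) + Z ^ 2 * (X ^ 1 * Y ^ 6) + Z ^ 3 * (X ^ 1 * Y ^ 5) + Z ^ 4 * (X ^ 1 * Y ^ 4) + Z ^ 5 * (X ^ 1 * Y ^ 3) + Z ^ 6 * (X ^ 1 * Y ^ 2) + Z ^ 7 * (X ^ 1 * Y ^ 1) + Z ^ 7 * X ^ 2"
      by (subst p1_7) (simp add: eval_nat_numeral algebra_simps)
    also have "\<dots> = (Z ^ 2 * Y ^ 7) + 2 * (Z ^ 3 * Y ^ 6) + 3 * (Z ^ 4 * Y ^ 5) + 4 * (Z ^ 5 * Y ^ 4) + 5 * (Z ^ 6 * Y ^ 3) + 6 * (Z ^ 7 * Y ^ 2) + 7 * (Z ^ 8 * Y ^ 1) + (Z ^ 7 * X ^ 2) + 7 * (Z ^ 8 * X ^ 1)"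
      unfolding p1_1 p1_2 p1_3 p1_4 p1_5 p1_6 p1_7 by (simp add: eval_nat_numeral algebra_simps)
    finally show ?thesis .
  qed
  have p3_5: "X ^ 3 * Y ^ 5 = (Z ^ 3 * Y ^ 5) + 3 * (Z ^ 4 * Y ^ 4) + 6 * (Z ^ 5 * Y ^ 3) + 10 * (Z ^ 6 * Y ^ 2) + 15 * (Z ^ 7 * Y ^ 1) + (Z ^ 5 * X ^ 3) + 5 * (Z ^ 6 * X ^ 2) + 15 * (Z ^ 7 * X ^ 1)"
  proof -
    have "X ^ 3 * Y ^ 5 = X * (X ^ 2 * Y ^ 5)" by (simp add: eval_nat_numeral)
    also have "\<dots> = Z ^ 2 * (X ^ 1 * Y ^ 5) + 2 * Z ^ 3 * (X ^ 1 * Y ^ 4) + 3 * Z ^ 4 * (X ^ 1 * Y ^ 3) + 4 * Z ^ 5 * (X ^ 1 * Y ^ 2) + 5 * Z ^ 6 * (X ^ 1 * Y ^ 1) + Z ^ 5 * X ^ 3 + 5 * Z ^ 6 * X ^ 2"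
      by (subst p2_5) (simp add: eval_nat_numeral algebra_simps)
    also have "\<dots> = (Z ^ 3 * Y ^ 5) + 3 * (Z ^ 4 * Y ^ 4) + 6 * (Z ^ 5 * Y ^ 3) + 10 * (Z ^ 6 * Y ^ 2) + 15 * (Z ^ 7 * Y ^ 1) + (Z ^ 5 * X ^ 3) + 5 * (Z ^ 6 * X ^ 2) + 15 * (Z ^ 7 * X ^ 1)"
      unfolding p1_1 p1_2 p1_3 p1_4 p1_5 by (simp add: eval_nat_numeral algebra_simps)
    finally show ?thesis .
  qed
  have p3_6: "X ^ 3 * Y ^ 6 = (Z ^ 3 * Y ^ 6) + 3 * (Z ^ 4 * Y ^ 5) + 6 * (Z ^ 5 * Y ^ 4) + 10 * (Z ^ 6 * Y ^ 3) + 15 * (Z ^ 7 * Y ^ 2) + 21 * (Z ^ 8 * Y ^ 1) + (Z ^ 6 * X ^ 3) + 6 * (Z ^ 7 * X ^ 2) + 21 * (Z ^ 8 * X ^ 1)"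
  proof -
    have "X ^ 3 * Y ^ 6 = X * (X ^ 2 * Y ^ 6)" by (simp add: eval_nat_numeral)
    also have "\<dots> = Z ^ 2 * (X ^ 1 * Y ^ 6) + 2 * Z ^ 3 * (X ^ 1 * Y ^ 5) + 3 * Z ^ 4 * (X ^ 1 * Y ^ 4) + 4 * Z ^ 5 * (X ^ 1 * Y ^ 3) + 5 * Z ^ 6 * (X ^ 1 * Y ^ 2) + 6 * Z ^ 7 * (X ^ 1 * Y ^ 1) + Z ^ 6 * X ^ 3 + 6 * Z ^ 7 * X ^ 2"
      by (subst p2_6) (simp add: eval_nat_numeral algebra_simps)
    also have "\<dots> = (Z ^ 3 * Y ^ 6) + 3 * (Z ^ 4 * Y ^ 5) + 6 * (Z ^ 5 * Y ^ 4) + 10 * (Z ^ 6 * Y ^ 3) + 15 * (Z ^ 7 * Y ^ 2) + 21 * (Z ^ 8 * Y ^ 1) + (Z ^ 6 * X ^ 3) + 6 * (Z ^ 7 * X ^ 2) + 21 * (Z ^ 8 * X ^ 1)"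
      unfolding p1_1 p1_2 p1_3 p1_4 p1_5 p1_6 by (simp add: eval_nat_numeral algebra_simps)
    finally show ?thesis .
  qed
  have p4_5: "X ^ 4 * Y ^ 5 = (Z ^ 4 * Y ^ 5) + 4 * (Z ^ 5 * Y ^ 4) + 10 * (Z ^ 6 * Y ^ 3) + 20 * (Z ^ 7 * Y ^ 2) + 35 * (Z ^ 8 * Y ^ 1) + (Z ^ 5 * X ^ 4) + 5 * (Z ^ 6 * X ^ 3) + 15 * (Z ^ 7 * X ^ 2) + 35 * (Z ^ 8 * X ^ 1)"
  proof -
    have "X ^ 4 * Y ^ 5 = X * (X ^ 3 * Y ^ 5)" by (simp add: eval_nat_numeral)
    also have "\<dots> = Z ^ 3 * (X ^ 1 * Y ^ 5) + 3 * Z ^ 4 * (X ^ 1 * Y ^ 4) + 6 * Z ^ 5 * (X ^ 1 * Y ^ 3) + 10 * Z ^ 6 * (X ^ 1 * Y ^ 2) + 15 * Z ^ 7 * (X ^ 1 * Y ^ 1) + Z ^ 5 * X ^ 4 + 5 * Z ^ 6 * X ^ 3 + 15 * Z ^ 7 * X ^ 2"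
      by (subst p3_5) (simp add: eval_nat_numeral algebra_simps)
    also have "\<dots> = (Z ^ 4 * Y ^ 5) + 4 * (Z ^ 5 * Y ^ 4) + 10 * (Z ^ 6 * Y ^ 3) + 20 * (Z ^ 7 * Y ^ 2) + 35 * (Z ^ 8 * Y ^ 1) + (Z ^ 5 * X ^ 4) + 5 * (Z ^ 6 * X ^ 3) + 15 * (Z ^ 7 * X ^ 2) + 35 * (Z ^ 8 * X ^ 1)"
      unfolding p1_1 p1_2 p1_3 p1_4 p1_5 by (simp add: eval_nat_numeral algebra_simps)
    finally show ?thesis .
  qed
  show "X ^ 2 * Y ^ 6 = (Z ^ 2 * Y ^ 6) + 2 * (Z ^ 3 * Y ^ 5) + 3 * (Z ^ 4 * Y ^ 4) + 4 * (Z ^ 5 * Y ^ 3) + 5 * (Z ^ 6 * Y ^ 2) + 6 * (Z ^ 7 * Y ^ 1) + (Z ^ 6 * X ^ 2) + 6 * (Z ^ 7 * X ^ 1)" "X ^ 2 * Y ^ 7 = (Z ^ 2 * Y ^ 7) + 2 * (Z ^ 3 * Y ^ 6) + 3 * (Z ^ 4 * Y ^ 5) + 4 * (Z ^ 5 * Y ^ 4) + 5 * (Z ^ 6 * Y ^ 3) + 6 * (Z ^ 7 * Y ^ 2) + 7 * (Z ^ 8 * Y ^ 1) + (Z ^ 7 * X ^ 2) + 7 * (Z ^ 8 * X ^ 1)" "X ^ 3 * Y ^ 6 = (Z ^ 3 * Y ^ 6) + 3 * (Z ^ 4 * Y ^ 5) + 6 * (Z ^ 5 * Y ^ 4) + 10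 * (Z ^ 6 * Y ^ 3) + 15 * (Z ^ 7 * Y ^ 2) + 21 * (Z ^ 8 * Y ^ 1) + (Z ^ 6 * X ^ 3) + 6 * (Z ^ 7 * X ^ 2) + 21 * (Z ^ 8 * X ^ 1)" "X ^ 4 * Y ^ 5 = (Z ^ 4 * Y ^ 5) + 4 * (Z ^ 5 * Y ^ 4) + 10 * (Z ^ 6 * Y ^ 3) + 20 * (Z ^ 7 * Y ^ 2) + 35 * (Z ^ 8 * Y ^ 1) + (Z ^ 5 * X ^ 4) + 5 * (Z ^ 6 * X ^ 3) + 15 * (Z ^ 7 * X ^ 2) + 35 * (Z ^ 8 * X ^ 1)"
    by (fact p2_6 p2_7 p3_6 p4_5)+
qed

lemma rzeta_shuffle_2_6:
  "rzeta 2 * rzeta 6 = rdzeta 2 6 + 2 * rdzeta 3 5 + 3 * rdzeta 4 4 + 4 * rdzeta 5 3 + 5 * rdzeta 6 2 + 6 * rdzeta 7 1 + rdzeta 6 2 + 6 * rdzeta 7 1"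
proof -
  define X Y Z where "X = (\<lambda>m::nat. 1 / real (Suc m))" "Y = (\<lambda>n::nat. 1 / real (Suc n))" "Z = (\<lambda>m n::nat. 1 / real (m + n + 2))"
  note defs = this
  have xyz: "X m * Y n = Z m n * X m + Z m n * Y n" for m n
    unfolding defs by (simp add: divide_simps)
  have ZY: "((\<lambda>x. Z (fst x) (snd x) ^ a * Y (snd x) ^ b) has_sum rdzeta a b) UNIV" if "a \<ge> 2" "b \<ge> 1" for a b
    using rdzeta_has_sum[OF that] by (simp add: defs case_prod_unfold)
  have ZX: "((\<lambda>x. Z (fst x) (snd x) ^ a * X (fst x) ^ b) has_sum rdzeta a b) UNIV" if "a \<ge> 2" "b \<ge> 1" for a b
    using rdzeta_has_sum'[OF that] by (simp add: defs case_prod_unfold)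
  have "((\<lambda>x. X (fst x) ^ 2 * Y (snd x) ^ 6) has_sum (rdzeta 2 6 + 2 * rdzeta 3 5 + 3 * rdzeta 4 4 + 4 * rdzeta 5 3 + 5 * rdzeta 6 2 + 6 * rdzeta 7 1 + rdzeta 6 2 + 6 * rdzeta 7 1)) UNIV"
    unfolding shuffle_partial_fractions(1)[OF xyz]
    by (intro has_sum_add has_sum_cmult_right ZX ZY) simp_all
  moreover have "((\<lambda>x. X (fst x) ^ 2 * Y (snd x) ^ 6) has_sum rzeta 2 * rzeta 6) UNIV"
    using product_has_sum[OF rzeta_has_sum[of 2] rzeta_has_sum[of 6]] by (simp add: defs case_prod_unfold)
  ultimately show ?thesis by (rule has_sum_unique[symmetric])
qed

lemma rzeta_shuffle_2_7:
  "rzeta 2 * rzeta 7 = rdzeta 2 7 + 2 * rdzeta 3 6 + 3 * rdzeta 4 5 + 4 * rdzeta 5 4 + 5 * rdzeta 6 3 + 6 * rdzeta 7 2 + 7 * rdzeta 8 1 + rdzeta 7 2 + 7 * rdzeta 8 1"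
proof -
  define X Y Z where "X = (\<lambda>m::nat. 1 / real (Suc m))" "Y = (\<lambda>n::nat. 1 / real (Suc n))" "Z = (\<lambda>m n::nat. 1 / real (m + n + 2))"
  note defs = this
  have xyz: "X m * Y n = Z m n * X m + Z m n * Y n" for m n
    unfolding defs by (simp add: divide_simps)
  have ZY: "((\<lambda>x. Z (fst x) (snd x) ^ a * Y (snd x) ^ b) has_sum rdzeta a b) UNIV" if "a \<ge> 2" "b \<ge> 1" for a b
    using rdzeta_has_sum[OF that] by (simp add: defs case_prod_unfold)
  have ZX: "((\<lambda>x. Z (fst x) (snd x) ^ a * X (fst x) ^ b) has_sum rdzeta a b) UNIV" if "a \<ge> 2" "b \<ge> 1" for a b
    using rdzeta_has_sum'[OF that] by (simp add: defs case_prod_unfold)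
  have "((\<lambda>x. X (fst x) ^ 2 * Y (snd x) ^ 7) has_sum (rdzeta 2 7 + 2 * rdzeta 3 6 + 3 * rdzeta 4 5 + 4 * rdzeta 5 4 + 5 * rdzeta 6 3 + 6 * rdzeta 7 2 + 7 * rdzeta 8 1 + rdzeta 7 2 + 7 * rdzeta 8 1)) UNIV"
    unfolding shuffle_partial_fractions(2)[OF xyz]
    by (intro has_sum_add has_sum_cmult_right ZX ZY) simp_all
  moreover have "((\<lambda>x. X (fst x) ^ 2 * Y (snd x) ^ 7) has_sum rzeta 2 * rzeta 7) UNIV"
    using product_has_sum[OF rzeta_has_sum[of 2] rzeta_has_sum[of 7]] by (simp add: defs case_prod_unfold)
  ultimately show ?thesis by (rule has_sum_unique[symmetric])
qed

lemma rzeta_shuffle_3_6: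
  "rzeta 3 * rzeta 6 = rdzeta 3 6 + 3 * rdzeta 4 5 + 6 * rdzeta 5 4 + 10 * rdzeta 6 3 + 15 * rdzeta 7 2 + 21 * rdzeta 8 1 + rdzeta 6 3 + 6 * rdzeta 7 2 + 21 * rdzeta 8 1"
proof -
  define X Y Z where "X = (\<lambda>m::nat. 1 / real (Suc m))" "Y = (\<lambda>n::nat. 1 / real (Suc n))" "Z = (\<lambda>m n::nat. 1 / real (m + n + 2))"
  note defs = this
  have xyz: "X m * Y n = Z m n * X m + Z m n * Y n" for m n
    unfolding defs by (simp add: divide_simps)
  have ZY: "((\<lambda>x. Z (fst x) (snd x) ^ a * Y (snd x) ^ b) has_sum rdzeta a b) UNIV" if "a \<ge> 2" "b \<ge> 1" for a b
    using rdzeta_has_sum[OF that] by (simp add: defs case_prod_unfold)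
  have ZX: "((\<lambda>x. Z (fst x) (snd x) ^ a * X (fst x) ^ b) has_sum rdzeta a b) UNIV" if "a \<ge> 2" "b \<ge> 1" for a b
    using rdzeta_has_sum'[OF that] by (simp add: defs case_prod_unfold)
  have "((\<lambda>x. X (fst x) ^ 3 * Y (snd x) ^ 6) has_sum (rdzeta 3 6 + 3 * rdzeta 4 5 + 6 * rdzeta 5 4 + 10 * rdzeta 6 3 + 15 * rdzeta 7 2 + 21 * rdzeta 8 1 + rdzeta 6 3 + 6 * rdzeta 7 2 + 21 * rdzeta 8 1)) UNIV"
    unfolding shuffle_partial_fractions(3)[OF xyz]
    by (intro has_sum_add has_sum_cmult_right ZX ZY) simp_all
  moreover have "((\<lambda>x. X (fst x) ^ 3 * Y (snd x) ^ 6) has_sum rzeta 3 * rzeta 6) UNIV"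
    using product_has_sum[OF rzeta_has_sum[of 3] rzeta_has_sum[of 6]] by (simp add: defs case_prod_unfold)
  ultimately show ?thesis by (rule has_sum_unique[symmetric])
qed

lemma rzeta_shuffle_4_5:
  "rzeta 4 * rzeta 5 = rdzeta 4 5 + 4 * rdzeta 5 4 + 10 * rdzeta 6 3 + 20 * rdzeta 7 2 + 35 * rdzeta 8 1 + rdzeta 5 4 + 5 * rdzeta 6 3 + 15 * rdzeta 7 2 + 35 * rdzeta 8 1"
proof -
  define X Y Z where "X = (\<lambda>m::nat. 1 / real (Suc m))" "Y = (\<lambda>n::nat. 1 / real (Suc n))" "Z = (\<lambda>m n::nat. 1 / real (m + n + 2))"
  note defs = this
  have xyz: "X m * Y n = Z m n * X m + Z m n * Y n" for m n
    unfolding defs by (simp add: divide_simps)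
  have ZY: "((\<lambda>x. Z (fst x) (snd x) ^ a * Y (snd x) ^ b) has_sum rdzeta a b) UNIV" if "a \<ge> 2" "b \<ge> 1" for a b
    using rdzeta_has_sum[OF that] by (simp add: defs case_prod_unfold)
  have ZX: "((\<lambda>x. Z (fst x) (snd x) ^ a * X (fst x) ^ b) has_sum rdzeta a b) UNIV" if "a \<ge> 2" "b \<ge> 1" for a b
    using rdzeta_has_sum'[OF that] by (simp add: defs case_prod_unfold)
  have "((\<lambda>x. X (fst x) ^ 4 * Y (snd x) ^ 5) has_sum (rdzeta 4 5 + 4 * rdzeta 5 4 + 10 * rdzeta 6 3 + 20 * rdzeta 7 2 + 35 * rdzeta 8 1 + rdzeta 5 4 + 5 * rdzeta 6 3 + 15 * rdzeta 7 2 + 35 * rdzeta 8 1)) UNIV"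
    unfolding shuffle_partial_fractions(4)[OF xyz]
    by (intro has_sum_add has_sum_cmult_right ZX ZY) simp_all
  moreover have "((\<lambda>x. X (fst x) ^ 4 * Y (snd x) ^ 5) has_sum rzeta 4 * rzeta 5) UNIV"
    using product_has_sum[OF rzeta_has_sum[of 4] rzeta_has_sum[of 5]] by (simp add: defs case_prod_unfold)
  ultimately show ?thesis by (rule has_sum_unique[symmetric])
qed

text \<open>The left-hand side is the combination arising in \<open>edge_coeff 5 4\<close>. The sum
  formula, three stuffle relations and one shuffle relation are five linear equations for six double
  zeta values, and \<open>rdzeta 5 3\<close> is left as the one that remains.\<close>

lemma rdzeta_weight_8:
  "rdzeta 3 5 + 3 * rdzeta 4 4 + 6 * rdzeta 5 3 + 10 * rdzeta 6 2 + 15 * rdzeta 7 1 =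
     rdzeta 5 3 + 6 * (rzeta 3 * rzeta 5) + 3 * (rzeta 4 * rzeta 4) + 9 * (rzeta 2 * rzeta 6) - 25 * rzeta 8"
proof -
  have "{2..7} = {2,3,4,5,6,7::nat}" by auto
  hence "rzeta 8 = rdzeta 2 6 + rdzeta 3 5 + rdzeta 4 4 + rdzeta 5 3 + rdzeta 6 2 + rdzeta 7 1"
    using rdzeta_sum_formula[of 7] by simp
  moreover have "rzeta 2 * rzeta 6 = rdzeta 2 6 + rdzeta 6 2 + rzeta 8"
    "rzeta 3 * rzeta 5 = rdzeta 3 5 + rdzeta 5 3 + rzeta 8"
    "rzeta 4 * rzeta 4 = rdzeta 4 4 + rdzeta 4 4 + rzeta 8"
    using rzeta_stuffle[of 2 6] rzeta_stuffle[of 3 5] rzeta_stuffle[of 4 4] by simp_all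
  ultimately show ?thesis using rzeta_shuffle_2_6 by linarith
qed

text \<open>The combination arising in \<open>edge_coeff 6 4\<close>. Sum formula, three stuffle and
  three shuffle relations face seven double zeta values; the weight is odd, and the combination
  reduces entirely to single zeta values and their products.\<close>

lemma rdzeta_weight_9:
  "rdzeta 3 6 + 3 * rdzeta 4 5 + 6 * rdzeta 5 4 + 10 * rdzeta 6 3 + 15 * rdzeta 7 2 + 21 * rdzeta 8 1 =
     10 * (rzeta 3 * rzeta 6) + 3 * (rzeta 4 * rzeta 5) - 29/2 * rzeta 9"
proof -
  have "{2..8} = {2,3,4,5,6,7,8::nat}" by auto
  hence "rzeta 9 = rdzeta 2 7 + rdzeta 3 6 + rdzeta 4 5 + rdzeta 5 4 + rdzeta 6 3 + rdzeta 7 2 + rdzeta 8 1"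
    using rdzeta_sum_formula[of 8] by simp
  moreover have "rzeta 2 * rzeta 7 = rdzeta 2 7 + rdzeta 7 2 + rzeta 9"
    "rzeta 3 * rzeta 6 = rdzeta 3 6 + rdzeta 6 3 + rzeta 9"
    "rzeta 4 * rzeta 5 = rdzeta 4 5 + rdzeta 5 4 + rzeta 9"
    using rzeta_stuffle[of 2 7] rzeta_stuffle[of 3 6] rzeta_stuffle[of 4 5] by simp_all
  ultimately show ?thesis using rzeta_shuffle_2_7 rzeta_shuffle_3_6 rzeta_shuffle_4_5 by linarith
qed

text \<open>Direction 0 is convenient because \<open>u 0\<close> enters only the linear factor and
  the numerators. Each of the four numerators contributes -1/2 times the same harmonic sum, and
  nothing cancels it; its product with the cube from \<open>wp_fps_face_4\<close> expands into
  double zeta values with larger exponent at least 3.\<close>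

lemma edge_coeff_4:
  "edge_coeff (Suc k) 4 = - ((-1) ^ k * (1/2 * of_nat ((k + 3) choose 3) * zeta_nat (k + 4)
     + 4 * (\<Sum>i\<le>k. of_nat ((i + 2) choose 2) * of_real (rdzeta (i + 3) (k + 1 - i)))))"
proof -
  define S where "S = {1,2,3,4::nat}"
  define I where "I = (\<lambda>j. inverse (lin_fps (of_nat (Suc j)) 1))"
  have c: "(of_nat (Suc j) :: complex) \<noteq> 0" for j by (rule of_nat_neq_0)
  have c2: "2 * of_nat n + 2 = (2 * of_nat (Suc n) :: complex)" for n by simp
  have ld: "has_log_deriv (\<lambda>d. wp_fps ((ind_par S)(0 := d)) n)
     (fps_const (-1/2) * fps_X * inverse (lin_fps (2 * of_nat (Suc n)) (2 * 1)) + (\<Sum>i\<in>{1..4::nat}. (\<Sum>j<n. fps_const (-1/2) * fps_X * I j) + 0))" for n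
  proof -
    have eq: "wp_fps ((ind_par S)(0 := d)) n = lin_fps (2 * of_nat (Suc n)) (2 * 1 + -1/2 * d) *
       (\<Prod>i\<in>{1..4::nat}. (\<Prod>j<n. lin_fps (of_nat (Suc j)) (1 + -1/2 * d)) * (\<Prod>j<Suc n. I j))" for d
    proof -
      define u where "u = (ind_par S)(0 := d)"
      have u: "u 0 = d" "u 1 = 1" "u 2 = 1" "u 3 = 1" "u 4 = 1" by (simp_all add: u_def S_def ind_par_def)
      have p: "wp_par u - d = 2 * 1 + -1/2 * d" unfolding wp_par_def u by (simp add: field_simps)
      have q: "2 * 1 + -1/2 * d - 1 = 1 + -1/2 * d" by simp
      show ?thesis unfolding u_def[symmetric] wp_fps_def prod_1_4 u p q I_def c2 by (rule refl)
    qed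
    have "(2 * of_nat (Suc n) :: complex) \<noteq> 0" using c[of n] by (metis mult_eq_0_iff zero_neq_numeral)
    thus ?thesis unfolding eq unfolding I_def
      by (intro has_log_deriv_mult has_log_deriv_prod has_log_deriv_lin has_log_deriv_const c finite_lessThan finite_atLeastAtMost)
  qed
  define T where "T = (\<lambda>n. 1/2 * of_nat ((k + 3) choose 3) * (1 / of_nat (Suc n) ^ (k + 4)) +
      4 * (\<Sum>i\<le>k. of_nat ((i + 2) choose 2) * of_real ((1 / real (Suc n)) ^ (i + 3) * (\<Sum>j<n. (1 / real (Suc j)) ^ (k + 1 - i)))) :: complex)"
  have deriv_term: "dir_deriv 0 (\<lambda>u. fps_nth (wp_fps u n) (Suc k)) S = - ((-1) ^ k) * T n" for n
  proof -
    define L where "L = lin_fps (of_nat (Suc n)) 1"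
    have "inverse (lin_fps (2 * of_nat (Suc n)) (2 * 1)) = fps_const (1/2) * I n"
    proof -
      have "inverse (lin_fps (2 * of_nat (Suc n)) (2 * 1)) = inverse (fps_const 2) * I n"
        unfolding lin_fps_scale I_def by (rule fps_inverse_mult)
      also have "inverse (fps_const (2::complex)) = fps_const (1/2)"
        unfolding divide_inverse mult_1_left by (rule fps_const_inverse)
      finally show ?thesis .
    qed
    note inv2 = this
    have "dir_deriv 0 (\<lambda>u. fps_nth (wp_fps u n) (Suc k)) S =
      fps_nth (fps_const 2 * I n ^ 3 * (fps_const (-1/2) * fps_X * (fps_const (1/2) * I n) + (\<Sum>i\<in>{1..4::nat}. (\<Sum>j<n. fps_const (-1/2) * fps_X * I j) + 0))) (Suc k)"
      using dir_deriv_log_deriv[OF ld[of n], of "Suc k"] wp_fps_face_4[of n] unfolding inv2 S_def I_def by simp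
    also have "(\<Sum>i\<in>{1..4::nat}. (\<Sum>j<n. fps_const (-1/2) * fps_X * I j) + 0) = fps_const (-2) * fps_X * (\<Sum>j<n. I j)"
    proof -
      have "(\<Sum>i\<in>{1..4::nat}. (\<Sum>j<n. fps_const (-1/2) * fps_X * I j) + 0) = of_nat 4 * (fps_const (-1/2) * fps_X * (\<Sum>j<n. I j))"
        by (simp add: sum_distrib_left)
      also have "of_nat 4 = (fps_const 4 :: complex fps)" by (simp add: numeral_fps_const)
      also have "fps_const 4 * (fps_const (-1/2) * fps_X * (\<Sum>j<n. I j)) = (fps_const 4 * fps_const (-1/2)) * fps_X * (\<Sum>j<n. I j)" by (simp only: mult.assoc)
      also have "fps_const 4 * fps_const (-1/2) = (fps_const (-2) :: complex fps)" by simp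
      finally show ?thesis .
    qed
    \<comment> \<open>The fourth power of \<open>I n\<close> leads to the single zeta value, the
      products of \<open>I n\<close> and \<open>I j\<close> with \<open>j\<close> below
      \<open>n\<close> to the double ones.\<close>
    also have "fps_const 2 * I n ^ 3 * (fps_const (-1/2) * fps_X * (fps_const (1/2) * I n) + fps_const (-2) * fps_X * (\<Sum>j<n. I j))
       = fps_X * ((fps_const 2 * fps_const (-1/2) * fps_const (1/2)) * I n ^ Suc 3 + (fps_const 2 * fps_const (-2)) * (\<Sum>j<n. I n ^ Suc 2 * I j))"
    proof -
      have "(\<Sum>j<n. I n ^ Suc 2 * I j) = I n ^ Suc 2 * (\<Sum>j<n. I j)" by (rule sum_distrib_left[symmetric])
      thus ?thesis by (simp only: distrib_left power_Suc numeral_3_eq_3 numeral_2_eq_2 power_0 mult_1_right mult_ac)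
    qed
    also have "fps_const 2 * fps_const (-1/2) * fps_const (1/2) = (fps_const (-1/2) :: complex fps)" by simp
    also have "fps_const 2 * fps_const (-2) = (fps_const (-4) :: complex fps)" by simp
    also have "fps_nth (fps_X * (fps_const (-1/2) * I n ^ Suc 3 + fps_const (-4) * (\<Sum>j<n. I n ^ Suc 2 * I j))) (Suc k)
       = - 1/2 * fps_nth (I n ^ Suc 3) k + (-4) * (\<Sum>j<n. fps_nth (I n ^ Suc 2 * I j) k)"
      by (simp only: fps_X_mult_nth fps_add_nth fps_mult_left_const_nth fps_sum_nth diff_Suc_1 nat.simps if_False)
    also have "fps_nth (I n ^ Suc 3) k = (-1) ^ k * (of_nat ((k + 3) choose 3) * (1 / of_nat (Suc n) ^ (k + 4)))"
    proof -
      have n: "k + 3 + 1 = k + 4" by simp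
      show ?thesis unfolding I_def inverse_lin_fps_power_nth[OF c] n by (simp only: times_divide_eq_right mult_1_right mult.assoc)
    qed
    also have "(\<Sum>j<n. fps_nth (I n ^ Suc 2 * I j) k) = (-1) ^ k * (\<Sum>i\<le>k. of_nat ((i + 2) choose 2) * of_real ((1 / real (Suc n)) ^ (i + 3) * (\<Sum>j<n. (1 / real (Suc j)) ^ (k + 1 - i))))"
    proof -
      have "fps_nth (I n ^ Suc 2 * I j) k = (\<Sum>i\<le>k. (-1) ^ k * of_nat ((i + 2) choose 2) * (1 / of_nat (Suc n)) ^ (i + 3) * (1 / of_nat (Suc j)) ^ (k + 1 - i))" for j
        unfolding fps_mult_nth atLeast0AtMost
      proof (intro sum.cong refl)
        fix i assume i: "i \<in> {..k}"
        have n: "i + 2 + 1 = i + 3" "k + 1 - i = Suc (k - i)" using i by auto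
        have s: "(-1) ^ k = (-1) ^ i * ((-1) ^ (k - i) :: complex)" using i by (simp flip: power_add)
        show "fps_nth (I n ^ Suc 2) i * fps_nth (I j) (k - i) = (-1) ^ k * of_nat ((i + 2) choose 2) * (1 / of_nat (Suc n)) ^ (i + 3) * (1 / of_nat (Suc j)) ^ (k + 1 - i)"
          unfolding I_def inverse_lin_fps_power_nth[OF c] unfolding inverse_lin_fps[OF c] fps_nth_Abs_fps n s power_one_over
          by (simp only: power_one mult_1_left mult_1_right times_divide_eq_right times_divide_eq_left divide_divide_eq_left mult_ac)
      qed
      hence "(\<Sum>j<n. fps_nth (I n ^ Suc 2 * I j) k) = (\<Sum>i\<le>k. \<Sum>j<n. (-1) ^ k * of_nat ((i + 2) choose 2) * (1 / of_nat (Suc n)) ^ (i + 3) * (1 / of_nat (Suc j)) ^ (k + 1 - i))"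
        by (simp only: sum.swap[of _ "{..k}"])
      also have "\<dots> = (-1) ^ k * (\<Sum>i\<le>k. of_nat ((i + 2) choose 2) * of_real ((1 / real (Suc n)) ^ (i + 3) * (\<Sum>j<n. (1 / real (Suc j)) ^ (k + 1 - i))))"
        by (simp add: sum_distrib_left mult.assoc)
      finally show ?thesis .
    qed
    finally show ?thesis unfolding T_def by (simp only: distrib_left mult_minus_left mult_ac) (simp add: mult_ac)
  qed
  have Ts: "T sums (1/2 * of_nat ((k + 3) choose 3) * zeta_nat (k + 4) + 4 * (\<Sum>i\<le>k. of_nat ((i + 2) choose 2) * of_real (rdzeta (i + 3) (k + 1 - i))))"
    unfolding T_def by (intro sums_add sums_mult sums_sum sums_of_real rdzeta_sums zeta_nat_sums) auto
  have "(\<lambda>n. - ((-1) ^ k) * T n) sums dir_deriv 0 (\<lambda>u. wp_coeff u (Suc k)) S"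
    using dir_deriv_sums[of 0 "Suc k" S] unfolding deriv_term by simp
  moreover note sums_mult[OF Ts, of "- ((-1) ^ k)"]
  moreover have "dir_deriv 0 (\<lambda>u. wp_coeff u (Suc k)) S = edge_coeff (Suc k) 4"
  proof -
    have "card S = 4" "S \<subseteq> {..<5} - {0}" by (auto simp: S_def)
    thus ?thesis using edge_coeff_eq[of 0 S "Suc k"] by simp
  qed
  ultimately show ?thesis using sums_unique2 by fastforce
qed

subsection \<open>The WZ pair\<close>

text \<open>The WZ relation with denominators cleared, in the variables
  \<open>N = n + 2 + 2 * y\<close> and \<open>w = 1 + y\<close>; the local \<open>p\<close> is
  \<open>wz_poly w\<close>.\<close>

lemma wz_identity:
  fixes N w :: complex
  defines "p \<equiv> (\<lambda>N. 2 * N^6 - 2 * (2 - w) * N^5 + (w^2 - 2 * w + 2) * N^4 - 2 * w^5 * N + w^6)"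
  shows "2 * (2 * w - 1) * (2 * N - 1 - w) * (N^4 * (N + 1)^4) + w^5 * (2 * N + 2 - w) * (N - w)^4
     = p N * (N + 1)^4 - p (N + 1) * (N - w)^4"
  unfolding p_def by algebra

definition wz_quot :: "complex \<Rightarrow> nat \<Rightarrow> complex" where
  "wz_quot y n = (pochhammer (1 + y) n / pochhammer (1 + 2 * y) (Suc n)) ^ 4"

definition wz_poly :: "complex \<Rightarrow> complex \<Rightarrow> complex" where
  "wz_poly w N = 2 * N^6 - 2 * (2 - w) * N^5 + (w^2 - 2 * w + 2) * N^4 - 2 * w^5 * N + w^6"

text \<open>The companion of the diagonal term: a rational multiple of \<open>wz_quot\<close> whose
  differences in \<open>n\<close> give the combination in \<open>wz_telescope\<close>.\<close>

definition wz_cert :: "complex \<Rightarrow> nat \<Rightarrow> complex" where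
  "wz_cert y n = wz_poly (1 + y) (of_nat n + 2 + 2 * y) / (2 * (1 + 2 * y) * (of_nat n + 2 + 2 * y) ^ 4) * wz_quot y n"

text \<open>The quotient of the Gamma prefactors at \<open>y + 1\<close> and \<open>y\<close>, see
  \<open>gamma_pref_shift\<close>.\<close>

definition wz_ratio :: "complex \<Rightarrow> complex" where
  "wz_ratio y = (1 + y) ^ 5 / (32 * (1 + 2 * y) ^ 5)"

lemma wp_term_diag: "wp_term (\<lambda>_. 2 * y) n = (2 * of_nat n + 2 + 3 * y) * wz_quot y n"
proof -
  have 1: "wp_par (\<lambda>_. 2 * y) - 2 * y = 3 * y" by (simp add: wp_par_def)
  have 2: "1 + wp_par (\<lambda>_. 2 * y) - 2 * y - 2 * y = 1 + y" by (simp add: wp_par_def)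
  have 3: "2 * of_nat n + 2 + wp_par (\<lambda>_. 2 * y) - 2 * y = 2 * of_nat n + 2 + 3 * y" by (simp add: wp_par_def)
  show ?thesis unfolding wp_term_def 2 3 wz_quot_def by simp
qed

context
  fixes y :: complex
  assumes y: "Re y > -1/4"
begin

lemma wz_nz: "of_nat n + 1 + 2 * y \<noteq> 0" "of_nat n + 1 + y \<noteq> 0"
  using y by (auto simp: complex_eq_iff)

lemma wz_nz': "of_nat n + 2 + 2 * y \<noteq> 0" "of_nat n + 3 + 2 * y \<noteq> 0" "1 + 2 * y \<noteq> 0" "1 + y \<noteq> 0" "2 + 2 * y \<noteq> 0"
  using wz_nz(1)[of "Suc n"] wz_nz(1)[of "Suc (Suc n)"] wz_nz(1)[of 0] wz_nz(2)[of 0] wz_nz(1)[of 1]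
  by (simp_all add: add_ac)

lemma wz_quot_Suc: "wz_quot y (Suc n) = wz_quot y n * ((of_nat n + 1 + y) / (of_nat n + 2 + 2 * y)) ^ 4"
  unfolding wz_quot_def pochhammer_Suc[of _ n] pochhammer_Suc[of _ "Suc n"] power_mult_distrib[symmetric]
  by (simp add: add_ac)

lemma wz_quot_shift:
  "wz_quot (y + 1) n = wz_quot y n * (2 * (1 + 2 * y) * (of_nat n + 1 + y) / ((of_nat n + 2 + 2 * y) * (of_nat n + 3 + 2 * y))) ^ 4"
proof -
  define P Q where "P = pochhammer (1 + y) n" "Q = pochhammer (1 + 2 * y) (Suc n)"
  have "(1 + y) * pochhammer (2 + y) n = P * (of_nat n + 1 + y)"
    using pochhammer_rec[of "1 + y" n] pochhammer_Suc[of "1 + y" n] by (simp add: P_Q_def add_ac)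
  hence a: "pochhammer (1 + (y + 1)) n = P * (of_nat n + 1 + y) / (1 + y)"
    using wz_nz' by (simp add: eq_divide_eq mult_ac add_ac)
  have "(1 + 2 * y) * ((2 + 2 * y) * pochhammer (3 + 2 * y) (Suc n)) = pochhammer (1 + 2 * y) (Suc (Suc (Suc n)))"
    unfolding pochhammer_rec[of _ "Suc (Suc n)"] pochhammer_rec[of "1 + 2 * y + 1" "Suc n"] by (simp add: add_ac)
  also have "\<dots> = Q * (of_nat n + 2 + 2 * y) * (of_nat n + 3 + 2 * y)"
    unfolding pochhammer_Suc[of _ "Suc (Suc n)"] pochhammer_Suc[of _ "Suc n"] P_Q_def by (simp add: add_ac)
  finally have "(1 + 2 * y) * ((2 + 2 * y) * pochhammer (3 + 2 * y) (Suc n)) = Q * (of_nat n + 2 + 2 * y) * (of_nat n + 3 + 2 * y)" .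
  moreover have "X = R / (k * m)" if "k * (m * X) = R" "k \<noteq> 0" "m \<noteq> 0" for X R k m :: complex
    using that by (auto simp: eq_divide_eq mult_ac)
  moreover have "1 + 2 * (y + 1) = 3 + 2 * y" by simp
  ultimately have b: "pochhammer (1 + 2 * (y + 1)) (Suc n) = Q * (of_nat n + 2 + 2 * y) * (of_nat n + 3 + 2 * y) / ((1 + 2 * y) * (2 + 2 * y))"
    using wz_nz'(3,5) by metis
  have c: "2 + 2 * y = 2 * (1 + y)" by simp
  have gen: "(P * A / w) / (Q * N * M / (k * (2 * w))) = P / Q * (2 * k * A / (N * M))" if "w \<noteq> 0" for A N M k w
    using that by (simp add: divide_simps)
  have "pochhammer (1 + (y + 1)) n / pochhammer (1 + 2 * (y + 1)) (Suc n) = P / Q * (2 * (1 + 2 * y) * (of_nat n + 1 + y) / ((of_nat n + 2 + 2 * y) * (of_nat n + 3 + 2 * y)))"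
    unfolding a b c using gen[OF wz_nz'(4)] by (simp only: mult.assoc)
  thus ?thesis unfolding wz_quot_def P_Q_def by (simp only: power_mult_distrib)
qed

text \<open>The sum of two consecutive diagonal terms, instead of their difference, is telescoping
  in \<open>n\<close>. This plus sign is the origin of the alternating series. Over the common
  denominator \<open>D\<close> the claim is \<open>wz_identity\<close>.\<close>

lemma wz_telescope:
  "wp_term (\<lambda>_. 2 * y) n + wz_ratio y * wp_term (\<lambda>_. 2 * (y + 1)) n = wz_cert y n - wz_cert y (Suc n)"
proof -
  define N w where "N = of_nat n + 2 + 2 * y" "w = 1 + y"
  define r where "r = wz_quot y n"
  have s: "of_nat n + 1 + y = N - w" "of_nat n + 3 + 2 * y = N + 1" "1 + 2 * y = 2 * w - 1"
    "of_nat (Suc n) + 2 + 2 * y = N + 1" "2 * of_nat n + 2 + 3 * y = 2 * N - 1 - w" "2 * of_nat n + 2 + 3 * (y + 1) = 2 * N + 2 - w"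
    by (simp_all add: N_w_def algebra_simps)
  have nz: "N \<noteq> 0" "N + 1 \<noteq> 0" "2 * w - 1 \<noteq> 0"
    using wz_nz'(1)[of n] wz_nz'(2)[of n] wz_nz'(3) unfolding s by (simp_all add: N_w_def)
  have q1: "wz_quot y (Suc n) = r * ((N - w) / N) ^ 4"
    unfolding wz_quot_Suc s r_def by (simp add: N_w_def)
  have q2: "wz_quot (y + 1) n = r * (2 * (2 * w - 1) * (N - w) / (N * (N + 1))) ^ 4"
    unfolding wz_quot_shift s r_def by (simp add: N_w_def)
  have id: "2 * (2 * w - 1) * (2 * N - 1 - w) * (N^4 * (N + 1)^4) + w^5 * (2 * N + 2 - w) * (N - w)^4
     = wz_poly w N * (N + 1)^4 - wz_poly w (N + 1) * (N - w)^4"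
    unfolding wz_poly_def by (rule wz_identity)
  define D where "D = 2 * (2 * w - 1) * (N^4 * (N + 1)^4)"
  have D: "D \<noteq> 0" using nz by (simp add: D_def)
  have l1: "wp_term (\<lambda>_. 2 * y) n = r * (2 * (2 * w - 1) * (2 * N - 1 - w) * (N^4 * (N + 1)^4)) / D"
    unfolding wp_term_diag s r_def[symmetric] using D nz by (simp add: D_def)
  have l2: "wz_ratio y * wp_term (\<lambda>_. 2 * (y + 1)) n = r * (w^5 * (2 * N + 2 - w) * (N - w)^4) / D"
  proof -
    have "w ^ 5 / (32 * k ^ 5) * (c * (r * (2 * k * A / (N * M)) ^ 4)) = r * (w ^ 5 * c * A ^ 4) / (2 * k * (N ^ 4 * M ^ 4))"
      if "k \<noteq> 0" "N \<noteq> 0" "M \<noteq> 0" for k c A M :: complex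
      using that by (simp add: power_mult_distrib power_divide) (simp add: divide_simps eval_nat_numeral)
    from this[OF nz(3,1,2)] show ?thesis
      unfolding wz_ratio_def wp_term_diag q2 s N_w_def(2)[symmetric] D_def .
  qed
  have l3: "wz_cert y n = r * (wz_poly w N * (N + 1)^4) / D"
    unfolding wz_cert_def s r_def[symmetric] N_w_def[symmetric] using D nz by (simp add: D_def)
  have l4: "wz_cert y (Suc n) = r * (wz_poly w (N + 1) * (N - w)^4) / D"
    unfolding wz_cert_def s q1 N_w_def(2)[symmetric] using D nz by (simp add: D_def power_divide mult_ac)
  show ?thesis unfolding l1 l2 l3 l4 add_divide_distrib[symmetric] diff_divide_distrib[symmetric]
    distrib_left[symmetric] right_diff_distrib[symmetric] id ..
qed

text \<open>At \<open>n = 0\<close> the variable \<open>N\<close> equals \<open>2 * w\<close>, and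
  \<open>wz_poly w (2 * w)\<close> is the fourth power of \<open>w\<close> times the quadratic
  polynomial of \<open>f12\<close>. This is where 205, 160 and 32 come from.\<close>

lemma wz_cert_0:
  "wz_cert y 0 = (205 * (1 + y)^2 - 160 * (1 + y) + 32) / (32 * (1 + 2 * y) ^ 5)"
proof -
  define w where "w = 1 + y"
  have w: "w \<noteq> 0" "1 + 2 * y \<noteq> 0" using wz_nz' by (simp_all add: w_def)
  have p: "wz_poly w (2 * w) = w ^ 4 * (205 * w^2 - 160 * w + 32)"
    unfolding wz_poly_def by algebra
  have N: "of_nat 0 + 2 + 2 * y = 2 * w" by (simp add: w_def)
  have "wz_cert y 0 = w ^ 4 * (205 * w^2 - 160 * w + 32) / (2 * (1 + 2 * y) * (2 * w) ^ 4) * (1 / (1 + 2 * y)) ^ 4"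
    unfolding wz_cert_def N w_def[symmetric] p by (simp add: wz_quot_def)
  also have "\<dots> = (205 * w^2 - 160 * w + 32) / (32 * (1 + 2 * y) ^ 5)"
  proof -
    have "w ^ 4 * Q / (2 * k * (2 * w) ^ 4) * (1 / k) ^ 4 = Q / (32 * k ^ 5)" if "k \<noteq> 0" for Q k :: complex
      using that w by (simp add: power_mult_distrib power_divide eval_nat_numeral)
    from this[OF w(2)] show ?thesis .
  qed
  finally show ?thesis by (simp only: w_def)
qed

end

text \<open>The factors are bounded by 1/2, 2, 3, 1 and the fourth power of 1/2, in total 3/16. The
  bound holds uniformly in \<open>n\<close> and on the half-plane, so it can be iterated along
  \<open>z + K\<close>.\<close>

lemma wz_term_contract:
  assumes w: "Re y \<ge> -1/10"
  shows "norm (wz_ratio y * wp_term (\<lambda>_. 2 * (y + 1)) n) \<le> 1/2 * norm (wp_term (\<lambda>_. 2 * y) n)"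
proof -
  have y: "Re y > -1/4" using assms by simp
  define N w where "N = of_nat n + 2 + 2 * y" "w = 1 + y"
  have Rw: "Re w \<ge> 9/10" using assms by (simp add: N_w_def)
  have Nw: "N = of_nat n + 2 * w" by (simp add: N_w_def)
  have mono: "norm (a *\<^sub>R w) \<le> norm (of_real b + a *\<^sub>R w)" if "a \<ge> 0" "b \<ge> 0" for a b :: real
  proof -
    have "(a * Re w) ^ 2 \<le> (b + a * Re w) ^ 2" using that Rw by (intro power_mono) auto
    thus ?thesis by (simp add: cmod_def)
  qed
  have n1: "norm (N - w) \<le> norm N"
  proof -
    have "(real n + Re w) ^ 2 \<le> (real n + 2 * Re w) ^ 2" using Rw by (intro power_mono) auto
    moreover have "(Im w) ^ 2 \<le> (2 * Im w) ^ 2" by (simp add: power2_eq_square)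
    ultimately have "(real n + Re w) ^ 2 + (Im w) ^ 2 \<le> (real n + 2 * Re w) ^ 2 + (2 * Im w) ^ 2" by linarith
    moreover have "Re (N - w) = real n + Re w" "Im (N - w) = Im w" "Re N = real n + 2 * Re w" "Im N = 2 * Im w"
      by (simp_all add: Nw)
    ultimately show ?thesis unfolding cmod_def by (simp only: real_sqrt_le_iff)
  qed
  have n2: "2 * norm w \<le> norm (N + 1)"
    using mono[of 2 "real n + 1"] by (simp add: Nw scaleR_conv_of_real norm_mult add_ac)
  have n3: "norm w \<ge> 9/10" using Rw complex_Re_le_cmod[of w] by linarith
  have n4: "norm w \<le> 2 * norm (2 * w - 1)"
  proof -
    have "norm (2 * w) \<le> norm (2 * w - 1) + 1" using norm_triangle_ineq[of "2 * w - 1" 1] by simp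
    thus ?thesis using n3 by (simp add: norm_mult)
  qed
  have n5: "norm (2 * N + 2 - w) \<le> 3 * norm (2 * N - 1 - w)"
  proof -
    have "Re (2 * N - 1 - w) \<ge> 17/10" using Rw by (simp add: Nw)
    hence "norm (2 * N - 1 - w) \<ge> 17/10" using complex_Re_le_cmod[of "2 * N - 1 - w"] by linarith
    moreover have "norm (2 * N + 2 - w) \<le> norm (2 * N - 1 - w) + 3"
    proof -
      have "2 * N + 2 - w = (2 * N - 1 - w) + 3" by simp
      thus ?thesis using norm_triangle_ineq[of "2 * N - 1 - w" 3] by (simp only: norm_numeral)
    qed
    ultimately show ?thesis by linarith
  qed
  have s: "of_nat n + 1 + y = N - w" "of_nat n + 3 + 2 * y = N + 1" "1 + 2 * y = 2 * w - 1"
    "2 * of_nat n + 2 + 3 * y = 2 * N - 1 - w" "2 * of_nat n + 2 + 3 * (y + 1) = 2 * N + 2 - w"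
    by (simp_all add: N_w_def algebra_simps)
  have nz: "N \<noteq> 0" "N + 1 \<noteq> 0" "2 * w - 1 \<noteq> 0"
    using wz_nz'(1)[OF y, of n] wz_nz'(2)[OF y, of n] wz_nz'(3)[OF y] unfolding s by (simp_all add: N_w_def)
  define r where "r = wz_quot y n"
  have q2: "wz_quot (y + 1) n = r * (2 * (2 * w - 1) * (N - w) / (N * (N + 1))) ^ 4"
    unfolding wz_quot_shift[OF y] s r_def by (simp add: N_w_def)
  have "w ^ 5 / (32 * k ^ 5) * (c * (r * (2 * k * A / (N * M)) ^ 4)) = 1/2 * (w / k) * (c * r) * (A / N) ^ 4 * (w / M) ^ 4"
      if "k \<noteq> 0" "N \<noteq> 0" "M \<noteq> 0" for k c A M :: complex
      using that by (simp add: power_mult_distrib power_divide) (simp add: divide_simps eval_nat_numeral)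
  from this[OF nz(3,1,2)] have "wz_ratio y * wp_term (\<lambda>_. 2 * (y + 1)) n =
     1/2 * (w / (2 * w - 1)) * ((2 * N + 2 - w) * r) * ((N - w) / N) ^ 4 * (w / (N + 1)) ^ 4"
    unfolding wz_ratio_def wp_term_diag q2 s N_w_def(2)[symmetric] .
  hence "norm (wz_ratio y * wp_term (\<lambda>_. 2 * (y + 1)) n) =
     1/2 * norm (w / (2 * w - 1)) * norm ((2 * N + 2 - w) * r) * norm ((N - w) / N) ^ 4 * norm (w / (N + 1)) ^ 4"
    by (simp only: norm_mult norm_power) simp
  also have "\<dots> \<le> 1/2 * 2 * norm (3 * ((2 * N - 1 - w) * r)) * 1 ^ 4 * (1/2) ^ 4"
  proof (intro mult_mono power_mono)
    show "norm (w / (2 * w - 1)) \<le> 2" using n4 nz by (simp add: norm_divide divide_simps)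
    show "norm ((N - w) / N) \<le> 1" using n1 nz by (simp add: norm_divide divide_simps)
    show "norm (w / (N + 1)) \<le> 1/2" using n2 nz by (simp add: norm_divide divide_simps)
    show "norm ((2 * N + 2 - w) * r) \<le> norm (3 * ((2 * N - 1 - w) * r))"
      using mult_right_mono[OF n5 norm_ge_zero[of r]] by (simp only: norm_mult norm_numeral mult.assoc)
  qed auto
  also have "\<dots> \<le> 1/2 * norm ((2 * N - 1 - w) * r)" by (simp only: norm_mult[of 3] norm_numeral) (simp add: power_divide)
  finally show ?thesis unfolding wp_term_diag s r_def .
qed

definition gamma_pref :: "complex \<Rightarrow> complex" where
  "gamma_pref y = Gamma (1 + y) ^ 10 / Gamma (1 + 2 * y) ^ 5"

definition fast_term :: "complex \<Rightarrow> complex" where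
  "fast_term x = (205 * x^2 - 160 * x + 32) * Gamma x ^ 10 / (32 * Gamma (2 * x) ^ 5)"

lemma not_nonpos_Int_Re: "Re x > 0 \<Longrightarrow> x \<notin> \<int>\<^sub>\<le>\<^sub>0"
  by (auto elim!: nonpos_Ints_cases)

lemma gamma_pref_shift:
  assumes "Re y \<ge> -1/10"
  shows "gamma_pref (y + 1) = wz_ratio y * gamma_pref y"
    and "gamma_pref y * wz_cert y 0 = fast_term (y + 1)"
proof -
  have nn: "1 + y \<notin> \<int>\<^sub>\<le>\<^sub>0" "1 + 2 * y \<notin> \<int>\<^sub>\<le>\<^sub>0" "2 + 2 * y \<notin> \<int>\<^sub>\<le>\<^sub>0"
    using assms by (intro not_nonpos_Int_Re; simp)+
  have nz: "1 + y \<noteq> 0" "1 + 2 * y \<noteq> 0" "2 + 2 * y \<noteq> 0" "Gamma (1 + 2 * y) \<noteq> 0"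
    using nn by (auto simp: Gamma_eq_zero_iff)
  have G1: "Gamma (1 + (y + 1)) = (1 + y) * Gamma (1 + y)"
    using Gamma_plus1[of "1 + y"] nz nn by (simp add: add_ac)
  have G2: "Gamma (2 + 2 * y) = (1 + 2 * y) * Gamma (1 + 2 * y)"
    using Gamma_plus1[of "1 + 2 * y"] nz nn by (simp add: add_ac)
  have G3: "Gamma (1 + 2 * (y + 1)) = (2 + 2 * y) * ((1 + 2 * y) * Gamma (1 + 2 * y))"
    using Gamma_plus1[of "2 + 2 * y"] nz nn by (simp add: add_ac G2[symmetric])
  have "(w * G) ^ 10 / (2 * w * (k * H)) ^ 5 = w ^ 5 / (32 * k ^ 5) * (G ^ 10 / H ^ 5)" if "w \<noteq> 0" for w G k H :: complex
    using that by (simp add: power_mult_distrib eval_nat_numeral mult_ac)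
  from this[OF nz(1), of "Gamma (1 + y)" "1 + 2 * y" "Gamma (1 + 2 * y)"]
  show "gamma_pref (y + 1) = wz_ratio y * gamma_pref y"
    unfolding gamma_pref_def wz_ratio_def G1 G3 by (simp add: ring_distribs)
  have y: "Re y > -1/4" using assms by simp
  have e: "y + 1 = 1 + y" and e2: "2 * (1 + y) = 2 + 2 * y" by simp_all
  show "gamma_pref y * wz_cert y 0 = fast_term (y + 1)"
    unfolding gamma_pref_def wz_cert_0[OF y] fast_term_def e e2 G2 by (simp add: power_mult_distrib mult_ac)
qed

text \<open>The general estimate for terms covers only parameters near 0, which settles
  \<open>K = 0\<close>. Each unit shift multiplies by a rational function of \<open>n\<close>
  tending to 0.\<close>

lemma wz_quot_decay:
  assumes z: "norm z \<le> 1/100"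
  shows "(\<lambda>n. of_nat (Suc n) ^ 2 * wz_quot (z + of_nat K) n) \<longlonglongrightarrow> 0"
proof (induction K)
  case 0
  have sm: "small_par (\<lambda>_. 2 * z)" using z by (simp add: small_par_def norm_mult)
  show ?case
  proof (rule Lim_null_comparison)
    show "(\<lambda>n. 6 / (real n + 1)) \<longlonglongrightarrow> 0"
      using tendsto_mult_left[OF LIMSEQ_inverse_real_of_nat, of 6] by (simp add: divide_inverse add_ac)
    show "\<forall>\<^sub>F n in sequentially. norm (of_nat (Suc n) ^ 2 * wz_quot (z + of_nat 0) n) \<le> 6 / (real n + 1)"
    proof (intro always_eventually allI)
      fix n
      define v where "v = 2 * of_nat n + 2 + 3 * z"
      have "norm (complex_of_nat (2 * n + 2) + 3 * z) \<ge> real (2 * n + 2) - 3/100"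
        by (rule norm_add_lower) (use z in \<open>simp add: norm_mult\<close>)
      moreover have "v = complex_of_nat (2 * n + 2) + 3 * z" by (simp add: v_def)
      ultimately have v: "norm v \<ge> real n + 1" by simp
      have "norm v * norm (wz_quot z n) \<le> 6 / (real n + 1) ^ 2"
        using wp_term_bound[OF sm, of n] unfolding wp_term_diag v_def[symmetric] norm_mult .
      hence "(real n + 1) * norm (wz_quot z n) \<le> 6 / (real n + 1) ^ 2"
        using mult_right_mono[OF v, of "norm (wz_quot z n)"] by simp
      note le = this
      have gen: "x * (6 / x ^ 2) = 6 / x" if "x \<noteq> 0" for x :: real using that by (simp add: power2_eq_square)
      have "(real n + 1) * ((real n + 1) * norm (wz_quot z n)) \<le> (real n + 1) * (6 / (real n + 1) ^ 2)"
        by (intro mult_left_mono le) auto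
      also have "(real n + 1) * (6 / (real n + 1) ^ 2) = 6 / (real n + 1)" by (rule gen) simp
      finally show "norm (of_nat (Suc n) ^ 2 * wz_quot (z + of_nat 0) n) \<le> 6 / (real n + 1)"
        unfolding norm_mult norm_power norm_of_nat power2_eq_square by (simp add: add_ac mult.assoc)
    qed
  qed
next
  case (Suc K)
  define y where "y = z + of_nat K"
  have "\<bar>Re z\<bar> \<le> 1/100" using abs_Re_le_cmod[of z] z by linarith
  hence y: "Re y > -1/4" by (simp add: y_def)
  have i: "(\<lambda>n. inverse (of_nat n + c)) \<longlonglongrightarrow> 0" for c :: complex
    by (intro filterlim_compose[OF tendsto_inverse_0] tendsto_add_filterlim_at_infinity'[OF _ tendsto_const] tendsto_of_nat)
  have 1: "(\<lambda>n. (of_nat n + 1 + y) / (of_nat n + 2 + 2 * y)) \<longlonglongrightarrow> 1 - (1 + y) * 0"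
  proof (rule Lim_transform_eventually)
    show "(\<lambda>n. 1 - (1 + y) * inverse (of_nat n + (2 + 2 * y))) \<longlonglongrightarrow> 1 - (1 + y) * 0"
      by (intro tendsto_intros i)
    have "1 - (1 + y) * inverse (of_nat n + (2 + 2 * y)) = (of_nat n + 1 + y) / (of_nat n + 2 + 2 * y)" for n
      using wz_nz'(1)[OF y, of n] by (simp add: field_simps)
    thus "\<forall>\<^sub>F n in sequentially. 1 - (1 + y) * inverse (of_nat n + (2 + 2 * y)) = (of_nat n + 1 + y) / (of_nat n + 2 + 2 * y)"
      by simp
  qed
  have "(\<lambda>n. (of_nat (Suc n) ^ 2 * wz_quot y n) * (2 * (1 + 2 * y) * ((of_nat n + 1 + y) / (of_nat n + 2 + 2 * y)) * inverse (of_nat n + (3 + 2 * y))) ^ 4)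
     \<longlonglongrightarrow> 0 * (2 * (1 + 2 * y) * (1 - (1 + y) * 0) * 0) ^ 4"
    using Suc.IH unfolding y_def[symmetric] by (intro tendsto_mult tendsto_power tendsto_const 1 i)
  also have "(\<lambda>n. (of_nat (Suc n) ^ 2 * wz_quot y n) * (2 * (1 + 2 * y) * ((of_nat n + 1 + y) / (of_nat n + 2 + 2 * y)) * inverse (of_nat n + (3 + 2 * y))) ^ 4)
     = (\<lambda>n. of_nat (Suc n) ^ 2 * wz_quot (z + of_nat (Suc K)) n)"
  proof
    fix n
    have yy: "z + of_nat (Suc K) = y + 1" by (simp add: y_def)
    show "(of_nat (Suc n) ^ 2 * wz_quot y n) * (2 * (1 + 2 * y) * ((of_nat n + 1 + y) / (of_nat n + 2 + 2 * y)) * inverse (of_nat n + (3 + 2 * y))) ^ 4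
       = of_nat (Suc n) ^ 2 * wz_quot (z + of_nat (Suc K)) n"
      unfolding yy wz_quot_shift[OF y] by (simp add: divide_inverse mult_ac add_ac)
  qed
  finally show ?case by simp
qed

text \<open>The rational factor of the certificate grows like the square of \<open>n\<close>, which
  \<open>wz_quot_decay\<close> compensates. \<open>P\<close> is this factor divided by the square of
  \<open>N\<close>, rewritten in powers of \<open>1 / N\<close>.\<close>

lemma wz_cert_tendsto_0:
  assumes z: "norm z \<le> 1/100"
  shows "wz_cert (z + of_nat K) \<longlonglongrightarrow> 0"
proof -
  define y where "y = z + of_nat K"
  have "\<bar>Re z\<bar> \<le> 1/100" using abs_Re_le_cmod[of z] z by linarith
  hence y: "Re y > -1/4" by (simp add: y_def)
  define w where "w = 1 + y"
  define I where "I = (\<lambda>n. inverse (complex_of_nat n + 2 + 2 * y))"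
  have i: "(\<lambda>n. inverse (of_nat n + c)) \<longlonglongrightarrow> 0" for c :: complex
    by (intro filterlim_compose[OF tendsto_inverse_0] tendsto_add_filterlim_at_infinity'[OF _ tendsto_const] tendsto_of_nat)
  have I0: "I \<longlonglongrightarrow> 0" using i[of "2 + 2 * y"] by (simp add: I_def add_ac)
  define P where "P = (\<lambda>n. (2 - 2 * (2 - w) * I n + (w^2 - 2 * w + 2) * I n ^ 2 - 2 * w^5 * I n ^ 5 + w^6 * I n ^ 6) / (2 * (1 + 2 * y)))"
  have P: "P \<longlonglongrightarrow> (2 - 2 * (2 - w) * 0 + (w^2 - 2 * w + 2) * 0 ^ 2 - 2 * w^5 * 0 ^ 5 + w^6 * 0 ^ 6) / (2 * (1 + 2 * y))"
    unfolding P_def using wz_nz'(3)[OF y] by (intro tendsto_intros I0) (metis mult_eq_0_iff zero_neq_numeral)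
  have R: "(\<lambda>n. 1 + (1 + 2 * y) * inverse (of_nat n + 1)) \<longlonglongrightarrow> 1 + (1 + 2 * y) * 0"
    by (intro tendsto_intros i)
  have "(\<lambda>n. P n * (1 + (1 + 2 * y) * inverse (of_nat n + 1)) ^ 2 * (of_nat (Suc n) ^ 2 * wz_quot y n)) \<longlonglongrightarrow>
     ((2 - 2 * (2 - w) * 0 + (w^2 - 2 * w + 2) * 0 ^ 2 - 2 * w^5 * 0 ^ 5 + w^6 * 0 ^ 6) / (2 * (1 + 2 * y))) * (1 + (1 + 2 * y) * 0) ^ 2 * 0"
    using wz_quot_decay[OF z, of K] unfolding y_def[symmetric] by (intro tendsto_mult tendsto_power P R)
  moreover have "P n * (1 + (1 + 2 * y) * inverse (of_nat n + 1)) ^ 2 * (of_nat (Suc n) ^ 2 * wz_quot y n) = wz_cert y n" for n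
  proof -
    define N where "N = of_nat n + 2 + 2 * y"
    have N: "N \<noteq> 0" using wz_nz'(1)[OF y, of n] by (simp add: N_def)
    have "(of_nat n + 1 :: complex) \<noteq> 0" by (metis of_nat_Suc_nz add.commute)
    hence "(1 + (1 + 2 * y) * inverse (of_nat n + 1)) * of_nat (Suc n) = N" by (simp add: N_def field_simps)
    hence a: "(1 + (1 + 2 * y) * inverse (of_nat n + 1)) ^ 2 * of_nat (Suc n) ^ 2 = N ^ 2"
      by (simp only: power_mult_distrib[symmetric])
    have b: "P n * N ^ 2 = wz_poly w N / (2 * (1 + 2 * y) * N ^ 4)"
    proof -
      define A where "A = 2 - 2 * (2 - w) * I n + (w^2 - 2 * w + 2) * I n ^ 2 - 2 * w^5 * I n ^ 5 + w^6 * I n ^ 6"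
      have NI: "I n = inverse N" by (simp add: I_def N_def)
      have pw: "N ^ 6 * I n = N ^ 5" "N ^ 6 * I n ^ 2 = N ^ 4" "N ^ 6 * I n ^ 5 = N" "N ^ 6 * I n ^ 6 = 1"
        unfolding NI using N by (simp_all add: field_simps eval_nat_numeral)
      have "N ^ 6 * A = 2 * N ^ 6 - 2 * (2 - w) * (N ^ 6 * I n) + (w^2 - 2 * w + 2) * (N ^ 6 * I n ^ 2) - 2 * w^5 * (N ^ 6 * I n ^ 5) + w^6 * (N ^ 6 * I n ^ 6)"
        unfolding A_def by (simp only: distrib_left right_diff_distrib mult_ac)
      hence A: "N ^ 6 * A = wz_poly w N" unfolding pw wz_poly_def by simp
      have "P n * N ^ 2 = A / (2 * (1 + 2 * y)) * N ^ 2" by (simp only: P_def A_def)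
      also have "\<dots> = (N ^ 6 * A) / (2 * (1 + 2 * y) * N ^ 4)"
        using N by (simp add: eval_nat_numeral)
      finally show ?thesis unfolding A .
    qed
    have "P n * (1 + (1 + 2 * y) * inverse (of_nat n + 1)) ^ 2 * (of_nat (Suc n) ^ 2 * wz_quot y n) = 
      (P n * ((1 + (1 + 2 * y) * inverse (of_nat n + 1)) ^ 2 * of_nat (Suc n) ^ 2)) * wz_quot y n" by (simp only: mult_ac)
    also have "\<dots> = wz_cert y n" unfolding a b wz_cert_def by (simp only: w_def N_def)
    finally show ?thesis .
  qed
  ultimately show ?thesis by (simp add: y_def)
qed

text \<open>Summing \<open>wz_telescope\<close> over \<open>n\<close> leaves the certificate at 0,
  so the sums \<open>S K\<close> satisfy
  \<open>S K + S (Suc K) = fast_term (z + of_nat (Suc K))\<close>; the alternating sum telescopes to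
  \<open>S 0\<close> because \<open>S K\<close> decays geometrically. At \<open>z = 0\<close> it is
  the Amdeberhan-Zeilberger series for twice zeta(3). The bound serves as a majorant for termwise
  differentiation in \<open>z\<close>.\<close>

theorem fast_series:
  assumes z: "norm z \<le> 1/100"
  shows fast_term_bound: "norm (fast_term (z + of_nat (Suc K))) \<le> (1/2) ^ K * (12 * norm (gamma_pref z) * (\<Sum>n. 1 / (real n + 1) ^ 2))"
    and fast_series_sums: "(\<lambda>k. (-1) ^ k * fast_term (z + of_nat (Suc k))) sums (gamma_pref z * (\<Sum>n. wp_term (\<lambda>_. 2 * z) n))"
proof -
  \<comment> \<open>The parameters are \<open>2 * z\<close>, so 1/100 is half the radius in
    \<open>small_par\<close>.\<close>
  have sm: "small_par (\<lambda>_. 2 * z)" using z by (simp add: small_par_def norm_mult)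
  have "\<bar>Re z\<bar> \<le> 1/100" using abs_Re_le_cmod[of z] z by linarith
  hence Re: "Re (z + of_nat K) \<ge> -1/10" for K by simp
  define V where "V = (\<lambda>K n. gamma_pref (z + of_nat K) * wp_term (\<lambda>_. 2 * (z + of_nat K)) n)"
  have step: "z + of_nat (Suc K) = (z + of_nat K) + 1" for K by simp
  have VS: "V (Suc K) n = gamma_pref (z + of_nat K) * (wz_ratio (z + of_nat K) * wp_term (\<lambda>_. 2 * ((z + of_nat K) + 1)) n)" for K n
    unfolding V_def step gamma_pref_shift(1)[OF Re] by (simp only: mult_ac)
  have dec: "norm (V (Suc K) n) \<le> 1/2 * norm (V K n)" for K n
  proof -
    have "norm (V (Suc K) n) = norm (gamma_pref (z + of_nat K)) * norm (wz_ratio (z + of_nat K) * wp_term (\<lambda>_. 2 * ((z + of_nat K) + 1)) n)"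
      unfolding VS by (rule norm_mult)
    also have "\<dots> \<le> norm (gamma_pref (z + of_nat K)) * (1/2 * norm (wp_term (\<lambda>_. 2 * (z + of_nat K)) n))"
      by (intro mult_left_mono wz_term_contract[OF Re]) auto
    also have "\<dots> = 1/2 * norm (V K n)" unfolding V_def norm_mult by simp
    finally show ?thesis .
  qed
  have bd: "norm (V K n) \<le> (1/2) ^ K * norm (V 0 n)" for K n
  proof (induction K)
    case (Suc K)
    have "norm (V (Suc K) n) \<le> 1/2 * ((1/2) ^ K * norm (V 0 n))" using dec[of K n] Suc by simp
    thus ?case by simp
  qed auto
  have V0: "summable (\<lambda>n. norm (V 0 n))"
  proof -
    have "summable (\<lambda>n. norm (wp_term (\<lambda>_. 2 * z) n))"
    proof (rule summable_comparison_test'[OF summable_inverse_squares_real[of 6], where N = 0])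
      show "norm (norm (wp_term (\<lambda>_. 2 * z) n)) \<le> 6 / (real n + 1) ^ 2" for n
        unfolding real_norm_def abs_norm_cancel by (rule wp_term_bound[OF sm])
    qed
    thus ?thesis unfolding V_def norm_mult of_nat_0 add_0_right by (rule summable_mult)
  qed
  have Vs: "summable (\<lambda>n. norm (V K n))" for K
  proof (rule summable_comparison_test'[OF summable_mult[OF V0, of "(1/2) ^ K"], where N = 0])
    show "norm (norm (V K n)) \<le> (1/2) ^ K * norm (V 0 n)" for n unfolding real_norm_def abs_norm_cancel by (rule bd)
  qed
  define S where "S = (\<lambda>K. \<Sum>n. V K n)"
  have SS: "V K sums S K" for K unfolding S_def by (rule summable_sums[OF summable_norm_cancel[OF Vs]])
  have rec: "S K + S (Suc K) = fast_term (z + of_nat (Suc K))" for K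
  proof -
    define y where "y = z + of_nat K"
    have y: "Re y > -1/4" using Re[of K] by (simp add: y_def)
    have s1: "(\<lambda>n. V K n + V (Suc K) n) sums (S K + S (Suc K))" by (intro sums_add SS)
    have eq: "V K n + V (Suc K) n = gamma_pref y * (wz_cert y n - wz_cert y (Suc n))" for n
      unfolding VS unfolding V_def y_def[symmetric] wz_telescope[OF y, symmetric] by (simp only: distrib_left)
    have s2: "(\<lambda>n. gamma_pref y * (wz_cert y n - wz_cert y (Suc n))) sums (gamma_pref y * (wz_cert y 0 - 0))"
      by (intro sums_mult telescope_sums') (use wz_cert_tendsto_0[OF z, of K] in \<open>simp add: y_def\<close>)
    have "S K + S (Suc K) = gamma_pref y * (wz_cert y 0 - 0)"
      by (rule sums_unique2[OF s1[unfolded eq] s2])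
    also have "\<dots> = fast_term (y + 1)" using gamma_pref_shift(2)[OF Re, of K] by (simp add: y_def)
    finally show ?thesis by (simp only: y_def step)
  qed
  have part: "(\<Sum>k<M. (-1) ^ k * fast_term (z + of_nat (Suc k))) = S 0 - (-1) ^ M * S M" for M
  proof (induction M)
    case (Suc M)
    have "(\<Sum>k<Suc M. (-1) ^ k * fast_term (z + of_nat (Suc k))) = S 0 - (-1) ^ M * S M + (-1) ^ M * (S M + S (Suc M))"
      unfolding sum.lessThan_Suc Suc.IH rec ..
    thus ?case by (simp add: distrib_left)
  qed auto
  have Sb: "norm (S K) \<le> (1/2) ^ K * (\<Sum>n. norm (V 0 n))" for K
  proof -
    have "norm (S K) \<le> (\<Sum>n. norm (V K n))" unfolding S_def by (rule summable_norm[OF Vs])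
    also have "\<dots> \<le> (\<Sum>n. (1/2) ^ K * norm (V 0 n))" by (intro suminf_le bd Vs summable_mult V0)
    also have "\<dots> = (1/2) ^ K * (\<Sum>n. norm (V 0 n))" by (rule suminf_mult[OF V0])
    finally show ?thesis .
  qed
  define Q where "Q = (\<Sum>n. norm (V 0 n))"
  have Q0: "Q \<ge> 0" unfolding Q_def by (intro suminf_nonneg V0) auto
  have sq: "summable (\<lambda>n. 1 / (real n + 1) ^ 2)" using summable_inverse_squares_real[of 1] by simp
  have Qb: "Q \<le> 6 * norm (gamma_pref z) * (\<Sum>n. 1 / (real n + 1) ^ 2)"
  proof -
    have "norm (V 0 n) \<le> 6 * norm (gamma_pref z) * (1 / (real n + 1) ^ 2)" for n
      using mult_left_mono[OF wp_term_bound[OF sm, of n], of "norm (gamma_pref z)"] by (simp add: V_def norm_mult mult.commute[of 6])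
    hence "Q \<le> (\<Sum>n. 6 * norm (gamma_pref z) * (1 / (real n + 1) ^ 2))"
      unfolding Q_def by (intro suminf_le V0 summable_mult sq)
    also have "\<dots> = 6 * norm (gamma_pref z) * (\<Sum>n. 1 / (real n + 1) ^ 2)" by (rule suminf_mult[OF sq])
    finally show ?thesis .
  qed
  have "norm (S K) + norm (S (Suc K)) \<le> (1/2) ^ K * Q + (1/2) ^ K * Q"
  proof (rule add_mono)
    show "norm (S K) \<le> (1/2) ^ K * Q" using Sb unfolding Q_def .
    have "norm (S (Suc K)) \<le> 1/2 * ((1/2) ^ K * Q)" using Sb[of "Suc K"] unfolding Q_def by simp
    also have "\<dots> \<le> (1/2) ^ K * Q" using Q0 by simp
    finally show "norm (S (Suc K)) \<le> (1/2) ^ K * Q" .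
  qed
  hence "norm (S K + S (Suc K)) \<le> (1/2) ^ K * Q + (1/2) ^ K * Q"
    using norm_triangle_ineq[of "S K" "S (Suc K)"] by linarith
  also have "(1/2) ^ K * Q + (1/2) ^ K * Q = (1/2) ^ K * (2 * Q)" by simp
  also have "\<dots> \<le> (1/2) ^ K * (2 * (6 * norm (gamma_pref z) * (\<Sum>n. 1 / (real n + 1) ^ 2)))"
    using Qb by (intro mult_left_mono) auto
  also have "\<dots> = (1/2) ^ K * (12 * norm (gamma_pref z) * (\<Sum>n. 1 / (real n + 1) ^ 2))" by simp
  finally show "norm (fast_term (z + of_nat (Suc K))) \<le> (1/2) ^ K * (12 * norm (gamma_pref z) * (\<Sum>n. 1 / (real n + 1) ^ 2))"
    unfolding rec .
  have "S \<longlonglongrightarrow> 0"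
  proof (rule Lim_null_comparison)
    show "(\<lambda>K. (1/2) ^ K * (\<Sum>n. norm (V 0 n))) \<longlonglongrightarrow> 0"
      by (intro tendsto_mult_left_zero LIMSEQ_power_zero) auto
    show "\<forall>\<^sub>F K in sequentially. norm (S K) \<le> (1/2) ^ K * (\<Sum>n. norm (V 0 n))"
      using Sb by simp
  qed
  hence "(\<lambda>M. (-1) ^ M * S M) \<longlonglongrightarrow> 0"
    by (subst tendsto_norm_zero_iff[symmetric]) (simp add: norm_mult norm_power tendsto_norm_zero)
  hence "(\<lambda>M. S 0 - (-1) ^ M * S M) \<longlonglongrightarrow> S 0 - 0" by (intro tendsto_diff tendsto_const)
  hence "(\<lambda>k. (-1) ^ k * fast_term (z + of_nat (Suc k))) sums S 0"
    unfolding sums_def part by simp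
  moreover have "S 0 = gamma_pref z * (\<Sum>n. wp_term (\<lambda>_. 2 * z) n)"
    unfolding S_def V_def by (simp add: suminf_mult[OF wp_term_summable[OF sm]])
  ultimately show "(\<lambda>k. (-1) ^ k * fast_term (z + of_nat (Suc k))) sums (gamma_pref z * (\<Sum>n. wp_term (\<lambda>_. 2 * z) n))"
    by simp
qed

subsection \<open>Zeta values at even integers\<close>

lemma zeta_numeral: "zeta (numeral k) = zeta_nat (numeral k)"
  unfolding zeta_def zeta_nat_def powr_minus_divide powr_complexnumeral ..

lemma double_zeta_numeral:
  assumes "numeral a \<ge> (2::nat)"
  shows "double_zeta (numeral a) (numeral b) = of_real (rdzeta (numeral a) (numeral b))"
proof -
  define A where "A = {(k1, k2). k1 > k2 \<and> k2 > (0::nat)}"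
  define g where "g = (\<lambda>(m,n::nat). (m + n + 2, n + 1))"
  have bij: "bij_betw g UNIV A"
    by (rule bij_betwI[of _ _ _ "\<lambda>(k1, k2). (k1 - k2 - 1, k2 - 1)"]) (auto simp: g_def A_def)
  have "((\<lambda>(m,n). (1 / real (m + n + 2)) ^ numeral a * (1 / real (Suc n)) ^ numeral b) has_sum rdzeta (numeral a) (numeral b)) UNIV"
    by (rule rdzeta_has_sum) (use assms in auto)
  from has_sum_bounded_linear[OF bounded_linear_of_real this]
  have "((\<lambda>x. of_real (case x of (m,n) \<Rightarrow> (1 / real (m + n + 2)) ^ numeral a * (1 / real (Suc n)) ^ numeral b) :: complex)
     has_sum of_real (rdzeta (numeral a) (numeral b))) UNIV" by (simp only: o_def)
  also have "(\<lambda>x. of_real (case x of (m,n) \<Rightarrow> (1 / real (m + n + 2)) ^ numeral a * (1 / real (Suc n)) ^ numeral b) :: complex)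
     = (\<lambda>x. (\<lambda>(k1, k2). 1 / (of_nat k1 powr numeral a * of_nat k2 powr numeral b)) (g x))"
    by (rule ext) (auto simp: g_def power_one_over divide_inverse power_inverse)
  finally have "((\<lambda>(k1, k2). 1 / (of_nat k1 powr numeral a * of_nat k2 powr numeral b)) has_sum (of_real (rdzeta (numeral a) (numeral b)) :: complex)) A"
    unfolding has_sum_reindex_bij_betw[OF bij] .
  thus ?thesis unfolding double_zeta_def A_def[symmetric] by (rule infsumI)
qed

lemma digamma_fps_nth: "k \<ge> 2 \<Longrightarrow> fps_nth (digamma_fps c) (k - 1) = (-1) ^ k * zeta_nat k * c ^ k"
  by (cases k) (auto simp: digamma_fps_def)

lemma fps_eq_coeff: "F = G \<Longrightarrow> fps_nth F n = fps_nth G n"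
  by simp

text \<open>The reflection formula in the form that
  \<open>Gamma (1 + z) * Gamma (1 - z) * sin (p * z)\<close> equals \<open>p * z\<close>. The
  logarithm of the Gamma product contains only even zeta values, and comparison with the sine series
  determines them one after another.\<close>

lemma zeta_even_values:
  defines "p \<equiv> complex_of_real pi"
  shows "zeta_nat 2 = p ^ 2 / 6" "zeta_nat 4 = p ^ 4 / 90" "zeta_nat 6 = p ^ 6 / 945" "zeta_nat 8 = p ^ 8 / 9450"
proof -
  define l where "l = digamma_fps 1 + digamma_fps (-1)"
  define a where "a = (\<lambda>k. ((-1) ^ k + 1) * zeta_nat k / of_nat k)"
  have "log_deriv_fps (\<lambda>z. Gamma (1 + 1 * z) * Gamma (1 + (-1) * z)) l"
    unfolding l_def by (intro log_deriv_fps_mult log_deriv_fps_Gamma)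
  then obtain F where F: "(\<lambda>z. Gamma (1 + 1 * z) * Gamma (1 + (-1) * z)) has_fps_expansion F"
      "fps_nth F 0 = 1" "fps_deriv F = F * l"
    unfolding log_deriv_fps_def by blast
  have l0: "fps_nth l 0 = 0" by (simp add: l_def digamma_fps_def)
  have la: "fps_nth l (k - 1) / of_nat k = a k" if "k \<ge> 2" for k
  proof -
    have "(-1) ^ k * zeta_nat k * 1 ^ k + (-1) ^ k * zeta_nat k * (-1) ^ k = ((-1) ^ k + (-1) ^ k * (-1) ^ k) * zeta_nat k"
      by (simp add: algebra_simps del: power_mult_distrib)
    also have "(-1) ^ k * (-1) ^ k = (1 :: complex)" by (simp flip: power_mult_distrib)
    finally show ?thesis unfolding l_def fps_add_nth digamma_fps_nth[OF that] a_def by simp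
  qed
  note c = exp_type_exp_poly[OF F(2,3) l0 la]
  have z: "Gamma (1 + 1 * z) * Gamma (1 + (-1) * z) * sin (p * z) = p * z" if "z \<in> ball 0 1" for z
  proof (cases "z = 0")
    case False
    have n: "\<bar>Re z\<bar> < 1" using that abs_Re_le_cmod[of z] by simp
    have z: "z \<notin> \<int>\<^sub>\<le>\<^sub>0" using that False by (auto elim!: nonpos_Ints_cases' simp: norm_minus_cancel simp flip: of_nat_Suc)
    have z1: "1 - z \<notin> \<int>\<^sub>\<le>\<^sub>0" using n by (intro not_nonpos_Int_Re) simp
    have "sin (p * z) = p * (inverse (Gamma z) * inverse (Gamma (1 - z)))"
      using rGamma_reflection_complex[of z] by (simp add: rGamma_inverse_Gamma p_def field_simps)
    moreover have "Gamma (1 + z) = z * Gamma z" using Gamma_plus1[OF z] by (simp add: add_ac)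
    moreover have "Gamma z \<noteq> 0" "Gamma (1 - z) \<noteq> 0" using z z1 by (simp_all add: Gamma_eq_zero_iff)
    ultimately show ?thesis by (simp add: field_simps)
  qed simp
  have "(\<lambda>z. Gamma (1 + 1 * z) * Gamma (1 + (-1) * z) * sin (p * z)) has_fps_expansion F * fps_sin p"
    by (intro has_fps_expansion_mult F(1) has_fps_expansion_sin)
  also have "?this \<longleftrightarrow> (\<lambda>z. p * z) has_fps_expansion F * fps_sin p"
  proof (intro has_fps_expansion_cong refl)
    have "\<forall>\<^sub>F z in nhds (0::complex). z \<in> ball 0 1" by (rule eventually_nhds_in_open) auto
    thus "\<forall>\<^sub>F z in nhds 0. Gamma (1 + 1 * z) * Gamma (1 + (-1) * z) * sin (p * z) = p * z"
      by (rule eventually_mono) (rule z)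
  qed
  finally have S: "F * fps_sin p = fps_const p * fps_X"
    by (rule fps_expansion_unique_complex) (intro fps_expansion_intros)
  have sn: "fps_nth (fps_sin p) 0 = 0" "fps_nth (fps_sin p) (Suc 0) = p" "fps_nth (fps_sin p) 2 = 0" "fps_nth (fps_sin p) 3 = - (p ^ 3 / 6)"
    "fps_nth (fps_sin p) 4 = 0" "fps_nth (fps_sin p) 5 = p ^ 5 / 120" "fps_nth (fps_sin p) 6 = 0" "fps_nth (fps_sin p) 7 = - (p ^ 7 / 5040)"
    "fps_nth (fps_sin p) 8 = 0" "fps_nth (fps_sin p) 9 = p ^ 9 / 362880"
    by (simp_all add: fps_sin_def fact_numeral)
  have sm: "(\<Sum>k\<le>3. h k) = h 0 + h 1 + h 2 + h (3::nat)" "(\<Sum>k\<le>5. h k) = h 0 + h 1 + h 2 + h 3 + h 4 + h (5::nat)"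
    "(\<Sum>k\<le>7. h k) = h 0 + h 1 + h 2 + h 3 + h 4 + h 5 + h 6 + h (7::nat)"
    "(\<Sum>k\<le>9. h k) = h 0 + h 1 + h 2 + h 3 + h 4 + h 5 + h 6 + h 7 + h 8 + h (9::nat)" for h :: "nat \<Rightarrow> complex"
    by (simp_all add: numeral_eq_Suc)
  have e3: "fps_nth F 0 * (- (p ^ 3 / 6)) + fps_nth F 2 * p = 0"
    using fps_eq_coeff[OF S, of 3] unfolding fps_mult_nth atLeast0AtMost sm by (simp add: sn)
  have e5: "fps_nth F 0 * (p ^ 5 / 120) + fps_nth F 2 * (- (p ^ 3 / 6)) + fps_nth F 4 * p = 0"
    using fps_eq_coeff[OF S, of 5] unfolding fps_mult_nth atLeast0AtMost sm by (simp add: sn)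
  have e7: "fps_nth F 0 * (- (p ^ 7 / 5040)) + fps_nth F 2 * (p ^ 5 / 120) + fps_nth F 4 * (- (p ^ 3 / 6)) + fps_nth F 6 * p = 0"
    using fps_eq_coeff[OF S, of 7] unfolding fps_mult_nth atLeast0AtMost sm by (simp add: sn)
  have e9: "fps_nth F 0 * (p ^ 9 / 362880) + fps_nth F 2 * (- (p ^ 7 / 5040)) + fps_nth F 4 * (p ^ 5 / 120) + fps_nth F 6 * (- (p ^ 3 / 6)) + fps_nth F 8 * p = 0"
    using fps_eq_coeff[OF S, of 9] unfolding fps_mult_nth atLeast0AtMost sm by (simp add: sn)
  have f2: "fps_nth F 2 = zeta_nat 2" using c(2) by (simp add: a_def)
  have f4: "fps_nth F 4 = zeta_nat 4 / 2 + zeta_nat 2 ^ 2 / 2" using c(3)[of 1] by (simp add: exp_poly_def a_def)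
  have f6: "fps_nth F 6 = zeta_nat 6 / 3 + zeta_nat 2 * (zeta_nat 4 / 2) + zeta_nat 2 ^ 3 / 6"
    using c(3)[of 3] by (simp add: exp_poly_def a_def)
  have f8: "fps_nth F 8 = zeta_nat 8 / 4 + zeta_nat 2 * (zeta_nat 6 / 3) + (zeta_nat 4 / 2) ^ 2 / 2 + zeta_nat 2 ^ 2 * (zeta_nat 4 / 2) / 2 + zeta_nat 2 ^ 4 / 24"
    using c(3)[of 5] by (simp add: exp_poly_def a_def)
  \<comment> \<open>The coefficients of order 3, 5, 7 and 9 form a triangular system; each equation
    is divided by \<open>p\<close> after the earlier values have been inserted.\<close>
  have main: "z2 = p ^ 2 / 6 \<and> z4 = p ^ 4 / 90 \<and> z6 = p ^ 6 / 945 \<and> z8 = p ^ 8 / 9450"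
    if h: "1 * (- (p ^ 3 / 6)) + z2 * p = 0"
      "1 * (p ^ 5 / 120) + z2 * (- (p ^ 3 / 6)) + (z4 / 2 + z2 ^ 2 / 2) * p = 0"
      "1 * (- (p ^ 7 / 5040)) + z2 * (p ^ 5 / 120) + (z4 / 2 + z2 ^ 2 / 2) * (- (p ^ 3 / 6)) + (z6 / 3 + z2 * (z4 / 2) + z2 ^ 3 / 6) * p = 0"
      "1 * (p ^ 9 / 362880) + z2 * (- (p ^ 7 / 5040)) + (z4 / 2 + z2 ^ 2 / 2) * (p ^ 5 / 120) + (z6 / 3 + z2 * (z4 / 2) + z2 ^ 3 / 6) * (- (p ^ 3 / 6))
        + (z8 / 4 + z2 * (z6 / 3) + (z4 / 2) ^ 2 / 2 + z2 ^ 2 * (z4 / 2) / 2 + z2 ^ 4 / 24) * p = 0" and p0: "p \<noteq> 0" for z2 z4 z6 z8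
  proof -
    have cancel: "x = y" if "(x - y) * p = 0" for x y using that p0 by simp
    have "(z2 - p ^ 2 / 6) * p = 1 * (1 * (- (p ^ 3 / 6)) + z2 * p)"
      by (simp add: field_simps eval_nat_numeral)
    hence "(z2 - p ^ 2 / 6) * p = 0" unfolding h by simp
    hence 2: "z2 = p ^ 2 / 6" by (rule cancel)
    have "(z4 - p ^ 4 / 90) * p = 2 * (1 * (p ^ 5 / 120) + z2 * (- (p ^ 3 / 6)) + (z4 / 2 + z2 ^ 2 / 2) * p)"
      unfolding 2 by (simp add: field_simps eval_nat_numeral)
    hence "(z4 - p ^ 4 / 90) * p = 0" unfolding h by simp
    hence 4: "z4 = p ^ 4 / 90" by (rule cancel)
    have "(z6 - p ^ 6 / 945) * p = 3 * (1 * (- (p ^ 7 / 5040)) + z2 * (p ^ 5 / 120) + (z4 / 2 + z2 ^ 2 / 2) * (- (p ^ 3 / 6)) + (z6 / 3 + z2 * (z4 / 2) + z2 ^ 3 / 6) * p)"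
      unfolding 2 4 by (simp add: field_simps eval_nat_numeral)
    hence "(z6 - p ^ 6 / 945) * p = 0" unfolding h by simp
    hence 6: "z6 = p ^ 6 / 945" by (rule cancel)
    have "(z8 - p ^ 8 / 9450) * p = 4 * (1 * (p ^ 9 / 362880) + z2 * (- (p ^ 7 / 5040)) + (z4 / 2 + z2 ^ 2 / 2) * (p ^ 5 / 120) + (z6 / 3 + z2 * (z4 / 2) + z2 ^ 3 / 6) * (- (p ^ 3 / 6)) + (z8 / 4 + z2 * (z6 / 3) + (z4 / 2) ^ 2 / 2 + z2 ^ 2 * (z4 / 2) / 2 + z2 ^ 4 / 24) * p)"
      unfolding 2 4 6 by (simp add: field_simps eval_nat_numeral)
    hence "(z8 - p ^ 8 / 9450) * p = 0" unfolding h by simp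
    hence 8: "z8 = p ^ 8 / 9450" by (rule cancel)
    from 2 4 6 8 show ?thesis by blast
  qed
  note v = main[OF e3[unfolded F(2) f2] e5[unfolded F(2) f2 f4] e7[unfolded F(2) f2 f4 f6] e9[unfolded F(2) f2 f4 f6 f8]]
  have "p \<noteq> 0" by (simp add: p_def)
  from v[OF this] show "zeta_nat 2 = p ^ 2 / 6" "zeta_nat 4 = p ^ 4 / 90" "zeta_nat 6 = p ^ 6 / 945" "zeta_nat 8 = p ^ 8 / 9450"
    by blast+
qed

section \<open>Taylor series of the prefactor and of the diagonal sum\<close>

definition pref_exponent :: "nat \<Rightarrow> complex" where
  "pref_exponent k = (-1) ^ k * zeta_nat k / of_nat k * (10 - 5 * 2 ^ k)"

text \<open>The weight \<open>10 - 5 * 2 ^ k\<close> vanishes at \<open>k = 1\<close>, so Euler's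
  constant cancels and the prefactor has no linear term.\<close>

lemma gamma_pref_fps:
  obtains P where "gamma_pref has_fps_expansion P" "fps_nth P 0 = 1" "fps_nth P 1 = 0"
    "fps_nth P 2 = pref_exponent 2" "\<And>m. m \<le> 6 \<Longrightarrow> fps_nth P (m + 3) = exp_poly pref_exponent m"
proof -
  define l where "l = (\<Sum>i<10::nat. digamma_fps 1) + (\<Sum>i<5::nat. - digamma_fps 2)"
  have "log_deriv_fps (\<lambda>z. (\<Prod>i<10::nat. Gamma (1 + 1 * z)) * (\<Prod>i<5::nat. inverse (Gamma (1 + 2 * z)))) l"
    unfolding l_def by (intro log_deriv_fps_mult log_deriv_fps_prod log_deriv_fps_inverse log_deriv_fps_Gamma finite_lessThan)
  also have "(\<lambda>z. (\<Prod>i<10::nat. Gamma (1 + 1 * z)) * (\<Prod>i<5::nat. inverse (Gamma (1 + 2 * z)))) = gamma_pref"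
    by (simp add: gamma_pref_def fun_eq_iff divide_inverse power_inverse)
  finally obtain P where P: "gamma_pref has_fps_expansion P" "fps_nth P 0 = 1" "fps_deriv P = P * l"
    unfolding log_deriv_fps_def by blast
  have l0: "fps_nth l 0 = 0" by (simp add: l_def digamma_fps_def fps_sum_nth)
  have la: "fps_nth l (k - 1) / of_nat k = pref_exponent k" if "k \<ge> 2" for k
    unfolding l_def fps_add_nth fps_sum_nth fps_neg_nth digamma_fps_nth[OF that] pref_exponent_def
    by (simp add: algebra_simps add_divide_distrib diff_divide_distrib)
  note c = exp_type_exp_poly[OF P(2,3) l0 la]
  show ?thesis by (rule that[OF P(1,2) c(1,2)]) (use c(3) in auto)
qed

lemma wp_diag_fps:
  "(\<lambda>z. \<Sum>n. wp_term (\<lambda>_. 2 * z) n) has_fps_expansion Abs_fps (\<lambda>m. 2 ^ m * face_coeff m 5)"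
proof -
  define u where "u = ind_par {..<5}"
  have "wp_term (\<lambda>i. z * u i) n = wp_term (\<lambda>_. z) n" for z n
    unfolding wp_term_def wp_par_def prod_1_4 by (simp add: u_def ind_par_def)
  hence W: "(\<lambda>z. \<Sum>n. wp_term (\<lambda>_. z) n) has_fps_expansion Abs_fps (\<lambda>m. face_coeff m 5)"
    using wp_sum_fps_expansion[OF unit_ind_par, of "{..<5}"] by (simp add: u_def face_coeff_def)
  have "((\<lambda>z. \<Sum>n. wp_term (\<lambda>_. z) n) \<circ> (\<lambda>z. 2 * z)) has_fps_expansion (fps_compose (Abs_fps (\<lambda>m. face_coeff m 5)) (fps_const 2 * fps_X))"
    by (rule has_fps_expansion_compose[OF W]) (auto intro: fps_expansion_intros)
  moreover have "fps_compose (Abs_fps (\<lambda>m. face_coeff m 5)) (fps_const 2 * fps_X) = Abs_fps (\<lambda>m. 2 ^ m * face_coeff m 5)"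
  proof (rule fps_ext)
    fix n
    have "fps_nth (fps_compose (Abs_fps (\<lambda>m. face_coeff m 5)) (fps_const 2 * fps_X)) n = (\<Sum>i=0..n. if i = n then 2 ^ n * face_coeff n 5 else 0)"
      unfolding fps_compose_nth power_mult_distrib
      by (intro sum.cong refl) (auto simp: fps_const_power fps_X_power_nth)
    thus "fps_nth (fps_compose (Abs_fps (\<lambda>m. face_coeff m 5)) (fps_const 2 * fps_X)) n = fps_nth (Abs_fps (\<lambda>m. 2 ^ m * face_coeff m 5)) n" by simp
  qed
  ultimately show ?thesis by (simp add: o_def)
qed

subsection \<open>Derivatives of the summand\<close>

definition f12_complex :: "complex \<Rightarrow> complex" where
  "f12_complex z = exp (of_real pi * \<i> * z) * fast_term z"

lemma f12_complex_holomorphic: "f12_complex holomorphic_on {z. Re z > 0}"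
  unfolding f12_complex_def fast_term_def
  by (intro holomorphic_intros) (auto simp: Gamma_eq_zero_iff intro!: not_nonpos_Int_Re dest: not_nonpos_Int_Re[of "2 * _", simplified])

lemma open_Re_pos: "open {z. Re z > 0}"
  by (rule open_halfspace_Re_gt)

text \<open>On the positive axis \<open>f12\<close> is the restriction of a holomorphic function, so
  the iterated real derivatives can be read from the complex ones and hence from Taylor
  coefficients.\<close>

lemma nth_derivative_f12: "x > 0 \<Longrightarrow> nth_derivative m f12 x = (deriv ^^ m) f12_complex (of_real x)"
proof (induction m arbitrary: x)
  case 0
  have "2 * complex_of_real x = of_real (2 * x)" by simp
  thus ?case unfolding nth_derivative_def f12_def f12_complex_def fast_term_def
    by (simp add: Gamma_complex_of_real del: of_real_mult) simp
next
  case (Suc m)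
  have "((deriv ^^ m) f12_complex has_field_derivative deriv ((deriv ^^ m) f12_complex) (of_real x)) (at (of_real x))"
    by (rule holomorphic_derivI[OF holomorphic_higher_deriv[OF f12_complex_holomorphic open_Re_pos] open_Re_pos]) (use Suc.prems in simp)
  from has_vector_derivative_real_field[OF this]
  have "((\<lambda>y. (deriv ^^ m) f12_complex (of_real y)) has_vector_derivative (deriv ^^ Suc m) f12_complex (of_real x)) (at x)" by simp
  hence "(nth_derivative m f12 has_vector_derivative (deriv ^^ Suc m) f12_complex (of_real x)) (at x)"
    by (rule has_vector_derivative_transform_within_open[of _ _ _ "{0<..}"]) (use Suc in auto)
  from vector_derivative_at[OF this] show ?case by (simp add: nth_derivative_def)
qed

text \<open>The translates of the summand to the positive integers are regarded as functions of a
  small shift \<open>z\<close>. Their sum is known in closed form by \<open>fast_series\<close>, and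
  its derivatives at 0 are the sums sought.\<close>

theorem sums_nth_derivative_f12:
  assumes P: "gamma_pref has_fps_expansion P" and W: "(\<lambda>z. \<Sum>n. wp_term (\<lambda>_. 2 * z) n) has_fps_expansion W"
  shows "(\<lambda>k. nth_derivative m f12 (real (Suc k))) sums (fact m * fps_nth (- (fps_exp (of_real pi * \<i>) * P * W)) m)"
proof -
  \<comment> \<open>The factor 1 matches the chain rule for linear substitutions that is applied to
    \<open>g\<close> below.\<close>
  define g where "g = (\<lambda>k z. f12_complex (1 * z + of_nat (Suc k)))"
  have Re: "\<bar>Re z\<bar> < 1/100" if "z \<in> ball 0 (1/100)" for z using that abs_Re_le_cmod[of z] by simp
  have shift: "1 * z + of_nat (Suc k) \<in> {z. Re z > 0}" if "z \<in> ball 0 (1/100)" for z k using Re[OF that] by simp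
  have hol: "g k holomorphic_on ball 0 (1/100)" for k
    unfolding g_def using shift
    by (intro holomorphic_on_compose_gen[OF _ f12_complex_holomorphic, unfolded o_def] holomorphic_intros) auto
  \<comment> \<open>The first summand belongs to the integer 1, hence the exponential contributes an
    odd power of -1 at \<open>k = 0\<close> and the overall minus sign.\<close>
  have g_eq: "g k z = - exp (of_real pi * \<i> * z) * ((-1) ^ k * fast_term (z + of_nat (Suc k)))" for k z
  proof -
    have "exp (of_real pi * \<i> * of_nat n) = (-1) ^ n" for n :: nat
      using exp_of_nat_mult[of n "of_real pi * \<i>"] by (simp add: mult_ac)
    from this[of "Suc k"] show ?thesis unfolding g_def f12_complex_def by (simp add: ring_distribs exp_add del: of_nat_Suc)
  qed
  have hp: "gamma_pref holomorphic_on ball 0 (1/4)"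
    unfolding gamma_pref_def
  proof (intro holomorphic_intros)
    fix z assume "z \<in> ball (0::complex) (1/4)"
    hence r: "\<bar>Re z\<bar> < 1/4" using abs_Re_le_cmod[of z] by simp
    show a: "1 + z \<notin> \<int>\<^sub>\<le>\<^sub>0" "1 + 2 * z \<notin> \<int>\<^sub>\<le>\<^sub>0" by (intro not_nonpos_Int_Re; use r in simp)+
    thus "Gamma (1 + 2 * z) ^ 5 \<noteq> 0" by (simp add: Gamma_eq_zero_iff)
  qed
  have "compact (gamma_pref ` cball 0 (1/100))"
    by (intro compact_continuous_image holomorphic_on_imp_continuous_on[OF holomorphic_on_subset[OF hp]]) (auto simp: subset_iff)
  from compact_imp_bounded[OF this] obtain B where B: "\<And>z. z \<in> cball 0 (1/100) \<Longrightarrow> norm (gamma_pref z) \<le> B"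
    unfolding bounded_iff by blast
  define Q where "Q = (\<Sum>n. 1 / (real n + 1) ^ 2)"
  have Q: "Q \<ge> 0" unfolding Q_def using summable_inverse_squares_real[of 1] by (intro suminf_nonneg) auto
  have bd: "norm (g k z) \<le> (1/2) ^ k * (exp pi * (12 * B * Q))" if z: "z \<in> ball 0 (1/100)" for k z
  proof -
    have n: "norm z \<le> 1/100" using z by simp
    have "norm (exp (of_real pi * \<i> * z)) \<le> exp (norm (of_real pi * \<i> * z))" by (rule norm_exp)
    also have "\<dots> \<le> exp (pi * 1)" unfolding exp_le_cancel_iff norm_mult using n by (intro mult_mono) auto
    finally have e: "norm (exp (of_real pi * \<i> * z)) \<le> exp pi" by simp
    have "norm (fast_term (z + of_nat (Suc k))) \<le> (1/2) ^ k * (12 * norm (gamma_pref z) * Q)"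
      unfolding Q_def by (rule fast_term_bound[OF n])
    also have "\<dots> \<le> (1/2) ^ k * (12 * B * Q)"
      using B[of z] n Q by (intro mult_left_mono mult_right_mono) auto
    finally have f: "norm (fast_term (z + of_nat (Suc k))) \<le> (1/2) ^ k * (12 * B * Q)" .
    have "norm (g k z) = norm (exp (of_real pi * \<i> * z)) * norm (fast_term (z + of_nat (Suc k)))"
      unfolding g_eq by (simp only: norm_mult norm_minus_cancel norm_power norm_one power_one mult_1_left)
    also have "\<dots> \<le> exp pi * ((1/2) ^ k * (12 * B * Q))"
      by (intro mult_mono e f) auto
    finally show ?thesis by (simp only: mult_ac)
  qed
  have M: "summable (\<lambda>k. (1/2) ^ k * (exp pi * (12 * B * Q)))" by (intro summable_mult2 summable_geometric) simp
  have "(\<lambda>k. (deriv ^^ m) (g k) 0) sums (deriv ^^ m) (\<lambda>z. \<Sum>k. g k z) 0"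
    by (rule higher_deriv_series[OF _ hol bd M]) simp
  moreover have "(deriv ^^ m) (g k) 0 = nth_derivative m f12 (real (Suc k))" for k
  proof -
    have "(deriv ^^ m) (g k) 0 = 1 ^ m * (deriv ^^ m) f12_complex (1 * 0 + of_nat (Suc k))"
      unfolding g_def by (rule higher_deriv_compose_linear'[OF f12_complex_holomorphic open_ball[of 0 "1/100"] open_Re_pos _ shift]) auto
    also have "\<dots> = (deriv ^^ m) f12_complex (of_real (real (Suc k)))" by simp
    finally show ?thesis using nth_derivative_f12[of "real (Suc k)" m] by simp
  qed
  moreover have "(deriv ^^ m) (\<lambda>z. \<Sum>k. g k z) 0 = fact m * fps_nth (- (fps_exp (of_real pi * \<i>) * P * W)) m"
  proof -
    have s: "- (exp (of_real pi * \<i> * z) * gamma_pref z * (\<Sum>n. wp_term (\<lambda>_. 2 * z) n)) = (\<Sum>k. g k z)" if "z \<in> ball 0 (1/100)" for z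
    proof -
      have n: "norm z \<le> 1/100" using that by simp
      from sums_mult[OF fast_series_sums[OF n], of "- exp (of_real pi * \<i> * z)"] show ?thesis
        unfolding g_eq by (simp add: sums_iff mult_ac)
    qed
    have "(\<lambda>z. - (exp (of_real pi * \<i> * z) * gamma_pref z * (\<Sum>n. wp_term (\<lambda>_. 2 * z) n))) has_fps_expansion - (fps_exp (of_real pi * \<i>) * P * W)"
      by (intro has_fps_expansion_minus has_fps_expansion_mult has_fps_expansion_exp P W)
    also have "?this \<longleftrightarrow> (\<lambda>z. \<Sum>k. g k z) has_fps_expansion - (fps_exp (of_real pi * \<i>) * P * W)"
    proof (intro has_fps_expansion_cong refl)
      have "\<forall>\<^sub>F z in nhds (0::complex). z \<in> ball 0 (1/100)" by (rule eventually_nhds_in_open) auto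
      thus "\<forall>\<^sub>F z in nhds 0. - (exp (of_real pi * \<i> * z) * gamma_pref z * (\<Sum>n. wp_term (\<lambda>_. 2 * z) n)) = (\<Sum>k. g k z)"
        by (rule eventually_mono) (rule s)
    qed
    finally have "fps_nth (fps_expansion (\<lambda>z. \<Sum>k. g k z) 0) m = fps_nth (- (fps_exp (of_real pi * \<i>) * P * W)) m"
      by (simp only: fps_expansion_eqI)
    thus ?thesis by (simp add: fps_expansion_def field_simps)
  qed
  ultimately show ?thesis by simp
qed

subsection \<open>Evaluation of the coefficients\<close>

lemma exponent3_values:
  shows "exponent3 2 = 0"
    "exponent3 3 = 1 / 4 * zeta_nat 3"
    "exponent3 4 = - 9 / 16 * zeta_nat 4"
    "exponent3 5 = 15 / 16 * zeta_nat 5"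
    "exponent3 6 = - 45 / 32 * zeta_nat 6"
    "exponent3 7 = 129 / 64 * zeta_nat 7"
    "exponent3 8 = - 1449 / 512 * zeta_nat 8"
    "exponent3 9 = 3025 / 768 * zeta_nat 9"
  by (simp_all add: exponent3_def power_divide)

lemma exponent1_values:
  shows "exponent1 2 = 0"
    "exponent1 3 = - 1 / 4 * zeta_nat 3"
    "exponent1 4 = 3 / 16 * zeta_nat 4"
    "exponent1 5 = - 3 / 16 * zeta_nat 5"
    "exponent1 6 = 5 / 32 * zeta_nat 6"
    "exponent1 7 = - 9 / 64 * zeta_nat 7"
    "exponent1 8 = 63 / 512 * zeta_nat 8"
    "exponent1 9 = - 85 / 768 * zeta_nat 9"
  by (simp_all add: exponent1_def power_divide)

lemma exponent3'_values:
  shows "exponent3' 2 = 0"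
    "exponent3' 3 = - 3 / 4 * zeta_nat 3"
    "exponent3' 4 = 3 / 2 * zeta_nat 4"
    "exponent3' 5 = - 39 / 16 * zeta_nat 5"
    "exponent3' 6 = 15 / 4 * zeta_nat 6"
    "exponent3' 7 = - 363 / 64 * zeta_nat 7"
    "exponent3' 8 = 273 / 32 * zeta_nat 8"
    "exponent3' 9 = - 3279 / 256 * zeta_nat 9"
  by (simp_all add: exponent3'_def power_divide)

lemma exponent1'_values:
  shows "exponent1' 2 = 0"
    "exponent1' 3 = 1 / 4 * zeta_nat 3"
    "exponent1' 4 = 0"
    "exponent1' 5 = 1 / 16 * zeta_nat 5"
    "exponent1' 6 = 0"
    "exponent1' 7 = 1 / 64 * zeta_nat 7"
    "exponent1' 8 = 0"
    "exponent1' 9 = 1 / 256 * zeta_nat 9"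
  by (simp_all add: exponent1'_def power_divide)

lemmas exponent_values = exponent3_values exponent1_values exponent3'_values exponent1'_values

lemma binomial_values:
  "Suc (Suc 0) choose 2 = 1" "Suc (Suc (Suc 0)) choose 2 = 3" "4 choose 2 = (6::nat)" "5 choose 2 = (10::nat)" "6 choose 2 = (15::nat)"
  "7 choose 2 = (21::nat)" "8 choose 2 = (28::nat)" "7 choose 3 = (35::nat)" "8 choose 3 = (56::nat)"
  by (simp_all add: numeral_eq_Suc)

lemma top_coeff_values:
  shows "face_coeff 0 5 = 2 * zeta_nat 3"
    "face_coeff 1 5 = - 15 / 2 * zeta_nat 4"
    "face_coeff 2 5 = 35 / 2 * zeta_nat 5"
    "face_coeff 3 5 = - 5 / 4 * zeta_nat 3 ^ 2 - 125 / 4 * zeta_nat 6"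
    "face_coeff 4 5 = 75 / 8 * zeta_nat 3 * zeta_nat 4 + 345 / 8 * zeta_nat 7"
proof -
  note v = face_coeff_4 face_coeff_3 face_coeff_2 face_coeff_1[unfolded One_nat_def] binomial_values face_coeff_0 exp_poly_def exponent_values
  show "face_coeff 0 5 = 2 * zeta_nat 3"
    "face_coeff 1 5 = - 15 / 2 * zeta_nat 4"
    "face_coeff 2 5 = 35 / 2 * zeta_nat 5"
    "face_coeff 3 5 = - 5 / 4 * zeta_nat 3 ^ 2 - 125 / 4 * zeta_nat 6"
    "face_coeff 4 5 = 75 / 8 * zeta_nat 3 * zeta_nat 4 + 345 / 8 * zeta_nat 7"
    by (simp_all add: top_coeff_low v) (simp_all add: field_simps power2_eq_square power3_eq_cube)
qed

lemma edge_coeff_4_value_5: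
  "edge_coeff 5 4 = - 4 * of_real (rdzeta 5 3) - 36 * zeta_nat 2 * zeta_nat 6 - 24 * zeta_nat 3 * zeta_nat 5 - 12 * zeta_nat 4 ^ 2 + 165 / 2 * zeta_nat 8"
proof -
  have e: "edge_coeff 5 4 = - (35/2 * zeta_nat 8 + 4 * (of_real (rdzeta 3 5) + 3 * of_real (rdzeta 4 4) + 6 * of_real (rdzeta 5 3) + 10 * of_real (rdzeta 6 2) + 15 * of_real (rdzeta 7 1)))"
    using edge_coeff_4[of 4] by (simp add: atMost_nat_numeral binomial_values algebra_simps)
  have "complex_of_real (rdzeta 3 5 + 3 * rdzeta 4 4 + 6 * rdzeta 5 3 + 10 * rdzeta 6 2 + 15 * rdzeta 7 1) =
     of_real (rdzeta 5 3) + 6 * (zeta_nat 3 * zeta_nat 5) + 3 * (zeta_nat 4 * zeta_nat 4) + 9 * (zeta_nat 2 * zeta_nat 6) - 25 * zeta_nat 8"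
    unfolding rdzeta_weight_8 by (simp add: zeta_nat_rzeta)
  hence "of_real (rdzeta 3 5) + 3 * of_real (rdzeta 4 4) + 6 * of_real (rdzeta 5 3) + 10 * of_real (rdzeta 6 2) + 15 * of_real (rdzeta 7 1) = of_real (rdzeta 5 3) + 6 * (zeta_nat 3 * zeta_nat 5) + 3 * (zeta_nat 4 * zeta_nat 4) + 9 * (zeta_nat 2 * zeta_nat 6) - 25 * zeta_nat 8"
    by simp
  thus ?thesis unfolding e by algebra
qed

lemma edge_coeff_4_value_6:
  "edge_coeff 6 4 = 40 * zeta_nat 3 * zeta_nat 6 + 12 * zeta_nat 4 * zeta_nat 5 - 30 * zeta_nat 9"
proof -
  have e: "edge_coeff 6 4 = 28 * zeta_nat 9 + 4 * (of_real (rdzeta 3 6) + 3 * of_real (rdzeta 4 5) + 6 * of_real (rdzeta 5 4) + 10 * of_real (rdzeta 6 3) + 15 * of_real (rdzeta 7 2) + 21 * of_real (rdzeta 8 1))"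
    using edge_coeff_4[of 5] by (simp add: atMost_nat_numeral binomial_values algebra_simps)
  have "complex_of_real (rdzeta 3 6 + 3 * rdzeta 4 5 + 6 * rdzeta 5 4 + 10 * rdzeta 6 3 + 15 * rdzeta 7 2 + 21 * rdzeta 8 1) =
     10 * (zeta_nat 3 * zeta_nat 6) + 3 * (zeta_nat 4 * zeta_nat 5) - 29/2 * zeta_nat 9"
    unfolding rdzeta_weight_9 by (simp add: zeta_nat_rzeta)
  hence "of_real (rdzeta 3 6) + 3 * of_real (rdzeta 4 5) + 6 * of_real (rdzeta 5 4) + 10 * of_real (rdzeta 6 3) + 15 * of_real (rdzeta 7 2) + 21 * of_real (rdzeta 8 1) = 10 * (zeta_nat 3 * zeta_nat 6) + 3 * (zeta_nat 4 * zeta_nat 5) - 29/2 * zeta_nat 9"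
    by simp
  thus ?thesis unfolding e by algebra
qed

lemma top_coeff_value_5:
  "face_coeff 5 5 = - 4 * of_real (rdzeta 5 3) - 36 * zeta_nat 2 * zeta_nat 6 - 175 / 8 * zeta_nat 3 * zeta_nat 5 - 741 / 64 * zeta_nat 4 ^ 2 + 989 / 64 * zeta_nat 8"
proof -
  have e: "edge_coeff 5 2 = - 7 / 2 * zeta_nat 8" using edge_coeff_2[of 4] by simp
  show ?thesis unfolding top_coeff_5 edge_coeff_4_value_5 e
    by (simp add: edge_coeff_3 edge_coeff_1[unfolded One_nat_def] edge_coeff_0 face_coeff_4 face_coeff_3 face_coeff_2 face_coeff_1[unfolded One_nat_def] face_coeff_0 binomial_values
        exp_poly_def exp_poly_deriv_def exponent_values)
       (simp add: field_simps power2_eq_square power3_eq_cube)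
qed

lemma top_coeff_value_6:
  "face_coeff 6 5 = 625 / 16 * zeta_nat 3 * zeta_nat 6 + 25 / 48 * zeta_nat 3 ^ 3 + 225 / 32 * zeta_nat 4 * zeta_nat 5 + 6565 / 96 * zeta_nat 9"
proof -
  have e: "edge_coeff 6 2 = 4 * zeta_nat 9" using edge_coeff_2[of 5] by simp
  show ?thesis unfolding top_coeff_6 edge_coeff_4_value_6 e
    by (simp add: edge_coeff_3 edge_coeff_1[unfolded One_nat_def] edge_coeff_0 face_coeff_4 face_coeff_3 face_coeff_2 face_coeff_1[unfolded One_nat_def] face_coeff_0 binomial_values
        exp_poly_def exp_poly_deriv_def exponent_values)
       (simp add: field_simps power2_eq_square power3_eq_cube)
qed

text \<open>The terms with \<open>q 1\<close> are absent because the second factor has no linear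
  term.\<close>

lemma triple_product_coeff:
  fixes c :: complex and P W :: "complex fps"
  assumes "fps_nth P 0 = 1" "fps_nth P 1 = 0"
  defines "q \<equiv> fps_nth P" and "w \<equiv> fps_nth W"
  shows "fact 1 * fps_nth (- (fps_exp c * P * W)) 1 = - (w 1 + c * w 0)"
    and "fact 2 * fps_nth (- (fps_exp c * P * W)) 2 = - 2 * (w 2 + c * w 1 + (c^2/2 + q 2) * w 0)"
    and "fact 3 * fps_nth (- (fps_exp c * P * W)) 3 = - 6 * (w 3 + c * w 2 + (c^2/2 + q 2) * w 1 + (c^3/6 + c * q 2 + q 3) * w 0)"
    and "fact 4 * fps_nth (- (fps_exp c * P * W)) 4 = - 24 * (w 4 + c * w 3 + (c^2/2 + q 2) * w 2 + (c^3/6 + c * q 2 + q 3) * w 1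
      + (c^4/24 + c^2/2 * q 2 + c * q 3 + q 4) * w 0)"
    and "fact 5 * fps_nth (- (fps_exp c * P * W)) 5 = - 120 * (w 5 + c * w 4 + (c^2/2 + q 2) * w 3 + (c^3/6 + c * q 2 + q 3) * w 2
      + (c^4/24 + c^2/2 * q 2 + c * q 3 + q 4) * w 1 + (c^5/120 + c^3/6 * q 2 + c^2/2 * q 3 + c * q 4 + q 5) * w 0)"
    and "fact 6 * fps_nth (- (fps_exp c * P * W)) 6 = - 720 * (w 6 + c * w 5 + (c^2/2 + q 2) * w 4 + (c^3/6 + c * q 2 + q 3) * w 3
      + (c^4/24 + c^2/2 * q 2 + c * q 3 + q 4) * w 2 + (c^5/120 + c^3/6 * q 2 + c^2/2 * q 3 + c * q 4 + q 5) * w 1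
      + (c^6/720 + c^4/24 * q 2 + c^3/6 * q 3 + c^2/2 * q 4 + c * q 5 + q 6) * w 0)"
proof -
  define R where "R = fps_exp c * P"
  have sm: "(\<Sum>k\<le>1. h k) = h 0 + h (1::nat)" "(\<Sum>k\<le>2. h k) = h 0 + h 1 + h (2::nat)" "(\<Sum>k\<le>3. h k) = h 0 + h 1 + h 2 + h (3::nat)"
    "(\<Sum>k\<le>4. h k) = h 0 + h 1 + h 2 + h 3 + h (4::nat)" "(\<Sum>k\<le>5. h k) = h 0 + h 1 + h 2 + h 3 + h 4 + h (5::nat)"
    "(\<Sum>k\<le>6. h k) = h 0 + h 1 + h 2 + h 3 + h 4 + h 5 + h (6::nat)" for h :: "nat \<Rightarrow> complex"
    by (simp_all add: numeral_eq_Suc)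
  have e: "fps_nth (fps_exp c) 0 = 1" "fps_nth (fps_exp c) 1 = c" "fps_nth (fps_exp c) 2 = c^2/2" "fps_nth (fps_exp c) 3 = c^3/6"
    "fps_nth (fps_exp c) 4 = c^4/24" "fps_nth (fps_exp c) 5 = c^5/120" "fps_nth (fps_exp c) 6 = c^6/720"
    by (simp_all add: fps_exp_def fact_numeral)
  have d: "(2 - 1 :: nat) = 1" "(3 - 1 :: nat) = 2" "(3 - 2 :: nat) = 1" "(4 - 1 :: nat) = 3" "(4 - 2 :: nat) = 2" "(4 - 3 :: nat) = 1"
    "(5 - 1 :: nat) = 4" "(5 - 2 :: nat) = 3" "(5 - 3 :: nat) = 2" "(5 - 4 :: nat) = 1"
    "(6 - 1 :: nat) = 5" "(6 - 2 :: nat) = 4" "(6 - 3 :: nat) = 3" "(6 - 4 :: nat) = 2" "(6 - 5 :: nat) = 1" "n - 0 = (n::nat)" "n - n = 0" for n :: nat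
    by simp_all
  have R0: "fps_nth R 0 = 1" unfolding R_def fps_mult_nth by (simp add: assms)
  have R: "fps_nth R 1 = c" "fps_nth R 2 = c^2/2 + q 2" "fps_nth R 3 = c^3/6 + c * q 2 + q 3"
    "fps_nth R 4 = c^4/24 + c^2/2 * q 2 + c * q 3 + q 4" "fps_nth R 5 = c^5/120 + c^3/6 * q 2 + c^2/2 * q 3 + c * q 4 + q 5"
    "fps_nth R 6 = c^6/720 + c^4/24 * q 2 + c^3/6 * q 3 + c^2/2 * q 4 + c * q 5 + q 6"
    unfolding R_def fps_mult_nth atLeast0AtMost sm d e assms q_def by (simp_all only: mult_1_left mult_1_right mult_zero_right add_0_right add_0_left add_ac)
  have f: "fact 1 = (1::complex)" "fact 2 = (2::complex)" "fact 3 = (6::complex)" "fact 4 = (24::complex)" "fact 5 = (120::complex)" "fact 6 = (720::complex)"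
    by (simp_all add: fact_numeral)
  show "fact 1 * fps_nth (- (fps_exp c * P * W)) 1 = - (w 1 + c * w 0)"
    "fact 2 * fps_nth (- (fps_exp c * P * W)) 2 = - 2 * (w 2 + c * w 1 + (c^2/2 + q 2) * w 0)"
    "fact 3 * fps_nth (- (fps_exp c * P * W)) 3 = - 6 * (w 3 + c * w 2 + (c^2/2 + q 2) * w 1 + (c^3/6 + c * q 2 + q 3) * w 0)"
    "fact 4 * fps_nth (- (fps_exp c * P * W)) 4 = - 24 * (w 4 + c * w 3 + (c^2/2 + q 2) * w 2 + (c^3/6 + c * q 2 + q 3) * w 1
      + (c^4/24 + c^2/2 * q 2 + c * q 3 + q 4) * w 0)"
    "fact 5 * fps_nth (- (fps_exp c * P * W)) 5 = - 120 * (w 5 + c * w 4 + (c^2/2 + q 2) * w 3 + (c^3/6 + c * q 2 + q 3) * w 2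
      + (c^4/24 + c^2/2 * q 2 + c * q 3 + q 4) * w 1 + (c^5/120 + c^3/6 * q 2 + c^2/2 * q 3 + c * q 4 + q 5) * w 0)"
    "fact 6 * fps_nth (- (fps_exp c * P * W)) 6 = - 720 * (w 6 + c * w 5 + (c^2/2 + q 2) * w 4 + (c^3/6 + c * q 2 + q 3) * w 3
      + (c^4/24 + c^2/2 * q 2 + c * q 3 + q 4) * w 2 + (c^5/120 + c^3/6 * q 2 + c^2/2 * q 3 + c * q 4 + q 5) * w 1
      + (c^6/720 + c^4/24 * q 2 + c^3/6 * q 3 + c^2/2 * q 4 + c * q 5 + q 6) * w 0)"
    unfolding R_def[symmetric] fps_neg_nth fps_mult_nth atLeast0AtMost sm d f R R0 w_def
    by (simp_all only: mult_1_left mult_minus_left mult_minus_right add_ac)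
qed

lemma pref_exponent_values:
  shows "pref_exponent 2 = - 5 * zeta_nat 2"
    "pref_exponent 3 = 10 * zeta_nat 3"
    "pref_exponent 4 = - 35 / 2 * zeta_nat 4"
    "pref_exponent 5 = 30 * zeta_nat 5"
    "pref_exponent 6 = - 155 / 3 * zeta_nat 6"
  by (simp_all add: pref_exponent_def)

theorem theorem1p14:
  shows
    "((\<lambda>k. nth_derivative 1 f12 (real (Suc k))) sums
       (15 * zeta 4 - 2 * zeta 3 * pi * \<i>)) \<and>
     ((\<lambda>k. nth_derivative 2 f12 (real (Suc k))) sums
       (16 / 3 * pi^2 * zeta 3 - 140 * zeta 5 + pi^5 / 3 * \<i>)) \<and>
     ((\<lambda>k. nth_derivative 3 f12 (real (Suc k))) sums
       (60 * (4 * zeta 6 - zeta 3 ^ 2) + 12 * pi * \<i> * (pi^2 * zeta 3 - 35 * zeta 5))) \<and>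
     ((\<lambda>k. nth_derivative 4 f12 (real (Suc k))) sums
       (240 * (56 * zeta 2 * zeta 5 - 11 * zeta 3 * zeta 4 - 69 * zeta 7)
        + 4 * pi * \<i> / 63 * (37 * pi^6 - 3780 * zeta 3 ^ 2))) \<and>
     ((\<lambda>k. nth_derivative 5 f12 (real (Suc k))) sums
       (10 * (1536 * double_zeta 5 3 - 720 * zeta 3 * zeta 5 + 160 * pi^2 * zeta 3 ^ 2
              - 6157 * zeta 8)
        + 24 * pi * \<i> * (350 * pi^2 * zeta 5 - 3 * pi^4 * zeta 3 - 3450 * zeta 7))) \<and>
     ((\<lambda>k. nth_derivative 6 f12 (real (Suc k))) sums
       (480 * (8280 * zeta 2 * zeta 7 + 288 * zeta 3 * zeta 6 - 5775 * zeta 4 * zeta 5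
               - 50 * zeta 3 ^ 3 - 6565 * zeta 9)
        + 180 * pi * \<i> * (40 * pi^2 * zeta 3 ^ 2 - 240 * zeta 3 * zeta 5
                            + 512 * double_zeta 5 3 - 679 * zeta 8)))"
proof -
  define p where "p = complex_of_real pi"
  define c where "c = p * \<i>"
  obtain P where P: "gamma_pref has_fps_expansion P" "fps_nth P 0 = 1" "fps_nth P 1 = 0"
    "fps_nth P 2 = pref_exponent 2" "\<And>m. m \<le> 6 \<Longrightarrow> fps_nth P (m + 3) = exp_poly pref_exponent m"
    by (rule gamma_pref_fps) metis
  define W where "W = Abs_fps (\<lambda>m. 2 ^ m * face_coeff m 5)"
  note T = triple_product_coeff[OF P(2,3), of c W]
  note S = sums_nth_derivative_f12[OF P(1) wp_diag_fps, folded W_def, folded p_def, folded c_def]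
  note ev = zeta_even_values[folded p_def]
  \<comment> \<open>Even zeta values are replaced by powers of \<open>p\<close> here and below. The
    final comparison is then a polynomial identity in \<open>p\<close>, the imaginary unit, odd zeta
    values and \<open>rdzeta 5 3\<close>.\<close>
  have q: "fps_nth P 2 = - 5 / 6 * p ^ 2"
    "fps_nth P 3 = 10 * zeta_nat 3"
    "fps_nth P 4 = 11 / 72 * p ^ 4"
    "fps_nth P 5 = - 25 / 3 * zeta_nat 3 * p ^ 2 + 30 * zeta_nat 5"
    "fps_nth P 6 = 50 * zeta_nat 3 ^ 2 + 11 / 1008 * p ^ 6"
    using P(4) P(5)[of 0] P(5)[of 1] P(5)[of 2] P(5)[of 3]
    by (simp_all add: exp_poly_def pref_exponent_values ev power_divide power_mult_distrib)
  have w: "fps_nth W 0 = 2 * zeta_nat 3"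
    "fps_nth W 1 = - 1 / 6 * p ^ 4"
    "fps_nth W 2 = 70 * zeta_nat 5"
    "fps_nth W 3 = - 10 * zeta_nat 3 ^ 2 - 50 / 189 * p ^ 6"
    "fps_nth W 4 = 5 / 3 * zeta_nat 3 * p ^ 4 + 690 * zeta_nat 7"
    "fps_nth W 5 = - 128 * of_real (rdzeta 5 3) - 700 * zeta_nat 3 * zeta_nat 5 - 2477 / 12600 * p ^ 8"
    "fps_nth W 6 = 500 / 189 * zeta_nat 3 * p ^ 6 + 100 / 3 * zeta_nat 3 ^ 3 + 5 * zeta_nat 5 * p ^ 4 + 13130 / 3 * zeta_nat 9"
    by (simp_all only: W_def fps_nth_Abs_fps top_coeff_values top_coeff_value_5 top_coeff_value_6 ev)
       (simp_all add: power_divide power_mult_distrib algebra_simps)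
  have ip: "\<i> ^ 2 = - 1" "\<i> ^ 3 = - \<i>" "\<i> ^ 4 = 1" "\<i> ^ 5 = \<i>" "\<i> ^ 6 = - 1"
    by (simp_all add: eval_nat_numeral)
  \<comment> \<open>Since \<open>c\<close> is pi times the imaginary unit, its parity separates the
    real part from the imaginary part of each sum.\<close>
  have cp: "c ^ 2 = - (p ^ 2)" "c ^ 3 = - (p ^ 3 * \<i>)" "c ^ 4 = p ^ 4" "c ^ 5 = p ^ 5 * \<i>" "c ^ 6 = - (p ^ 6)"
    by (simp_all add: c_def power_mult_distrib ip)
  have "fact 1 * fps_nth (- (fps_exp c * P * W)) 1 = 15 * zeta_nat 4 - 2 * zeta_nat 3 * p * \<i>"
    unfolding T q w cp ev unfolding c_def by (simp add: field_simps eval_nat_numeral)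
  note R1 = S[of 1, unfolded this]
  have "fact 2 * fps_nth (- (fps_exp c * P * W)) 2 = 16 / 3 * p^2 * zeta_nat 3 - 140 * zeta_nat 5 + p^5 / 3 * \<i>"
    unfolding T q w cp ev unfolding c_def by (simp add: field_simps eval_nat_numeral)
  note R2 = S[of 2, unfolded this]
  have "fact 3 * fps_nth (- (fps_exp c * P * W)) 3 = 60 * (4 * zeta_nat 6 - zeta_nat 3 ^ 2) + 12 * p * \<i> * (p^2 * zeta_nat 3 - 35 * zeta_nat 5)"
    unfolding T q w cp ev unfolding c_def by (simp add: field_simps eval_nat_numeral)
  note R3 = S[of 3, unfolded this]
  have "fact 4 * fps_nth (- (fps_exp c * P * W)) 4 = 240 * (56 * zeta_nat 2 * zeta_nat 5 - 11 * zeta_nat 3 * zeta_nat 4 - 69 * zeta_nat 7) + 4 * p * \<i> / 63 * (37 * p^6 - 3780 * zeta_nat 3 ^ 2)"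
    unfolding T q w cp ev unfolding c_def by (simp add: field_simps eval_nat_numeral)
  note R4 = S[of 4, unfolded this]
  have "fact 5 * fps_nth (- (fps_exp c * P * W)) 5 = 10 * (1536 * of_real (rdzeta 5 3) - 720 * zeta_nat 3 * zeta_nat 5 + 160 * p^2 * zeta_nat 3 ^ 2 - 6157 * zeta_nat 8)
      + 24 * p * \<i> * (350 * p^2 * zeta_nat 5 - 3 * p^4 * zeta_nat 3 - 3450 * zeta_nat 7)"
    unfolding T q w cp ev unfolding c_def by (simp add: field_simps eval_nat_numeral)
  note R5 = S[of 5, unfolded this]
  have "fact 6 * fps_nth (- (fps_exp c * P * W)) 6 = 480 * (8280 * zeta_nat 2 * zeta_nat 7 + 288 * zeta_nat 3 * zeta_nat 6 - 5775 * zeta_nat 4 * zeta_nat 5 - 50 * zeta_nat 3 ^ 3 - 6565 * zeta_nat 9)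
      + 180 * p * \<i> * (40 * p^2 * zeta_nat 3 ^ 2 - 240 * zeta_nat 3 * zeta_nat 5 + 512 * of_real (rdzeta 5 3) - 679 * zeta_nat 8)"
    unfolding T q w cp ev unfolding c_def by (simp add: field_simps eval_nat_numeral)
  note R6 = S[of 6, unfolded this]
  have z: "zeta 2 = zeta_nat 2" "zeta 3 = zeta_nat 3" "zeta 4 = zeta_nat 4" "zeta 5 = zeta_nat 5" "zeta 6 = zeta_nat 6"
    "zeta 7 = zeta_nat 7" "zeta 8 = zeta_nat 8" "zeta 9 = zeta_nat 9" "double_zeta 5 3 = of_real (rdzeta 5 3)"
    by (simp_all only: zeta_numeral) (rule double_zeta_numeral, simp)
  show ?thesis
    unfolding z of_real_mult of_real_power of_real_divide of_real_numeral p_def[symmetric]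
    by (intro conjI R1 R2 R3 R4 R5 R6)
qed

end
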